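(* Let $G$ be a countable directed graph with no sources and no sinks. Let $\{P'_x\}_{x\in V(G)}$ and $\{S'_e\}_{e\in E(G)}$ be families of projections and partial isometries acting on a Hilbert space $\mathcal{H}$ which satisfy the relations $(\dagger)$ for $G$. Then there exists a $*$-epimorphism $$\tau: C^*(\mathcal{A}_G)\longrightarrow C^*(\{S'_e\}_{e\in E(G)})$$ such that $\tau(L_e)=S'_e$ for all $e\in E(G)$.
   Context: $G$ is a countable directed graph with edge set $E(G)$ and vertex set $V(G)$; $s(e)$, $r(e)$ denote the source and range vertices of an edge $e$. $G$ has no sources (resp. no sinks) if every vertex is the range (resp. source) of some edge. The free semigroupoid $\mathbb{F}^+(G)$ is the set of all vertices and all finite paths $w=e_k\cdots e_1$ of $G$ (with $s(e_{i+1})=r(e_i)$, $s(w)=s(e_1)$, $r(w)=r(e_k)$, and $s(x)=r(x)=x$ for vertices), with concatenation. A family of non-zero partial isometries $\{S_e\}$ and non-zero (orthogonal) projections $\{P_x\}$ on a common Hilbert space satisfies $(\dagger)$ for $G$ if: (i) $P_xP_y=0$ for all $x\neq y$; (ii) $S_e^*S_f=0$ for all $e\neq f$; (iii) $S_e^*S_e=P_{s(e)}$ for all $e$; (iv) $\sum_{r(e)=x} S_eS_e^*\le P_x$ for all $x\in V(G)$. $\mathcal{H}_G$ is the Hilbert space with orthonormal basis $\{\xi_w : w\in\mathbb{F}^+(G)\}$; $L_e\xi_w=\xi_{ew}$ if $r(w)=s(e)$ and $0$ otherwise; $P_x$ (on $\mathcal{H}_G$) is the projection onto $\overline{\mathrm{span}}\{\xi_w:r(w)=x\}$.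 The quiver algebra $\mathcal{A}_G$ is the norm-closed algebra generated by $\{L_e,P_x\}$, and $C^*(\mathcal{A}_G)$ is the $C^*$-subalgebra of $B(\mathcal{H}_G)$ it generates. $C^*(\{S'_e\}_{e\in E(G)})$ is the $C^*$-algebra generated by the $S'_e$. *)

theory Defs
  imports "HOL-Analysis.Analysis" "HOL-Library.Nonpos_Ints" "Graph_Theory.Arc_Walk"
begin

section \<open>Complex Hilbert spaces\<close>

text \<open>
  A complex Hilbert space is a complete real inner product space with a compatible complex
  structure; the real inner product is the real part of the complex one, so norm, topology and
  positive definiteness come from \<^class>\<open>real_inner\<close>.
  The inner product is linear in the first argument.
\<close>

class scaleC =
  fixes scaleC :: "complex \<Rightarrow> 'a \<Rightarrow> 'a"  (infixr "*\<^sub>C" 75)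

class complex_inner = real_inner + scaleC +
  fixes cinner :: "'a \<Rightarrow> 'a \<Rightarrow> complex"
  assumes scaleC_add_right: "c *\<^sub>C (x + y) = c *\<^sub>C x + c *\<^sub>C y"
    and scaleC_add_left: "(c + d) *\<^sub>C x = c *\<^sub>C x + d *\<^sub>C x"
    and scaleC_scaleC: "c *\<^sub>C d *\<^sub>C x = (c * d) *\<^sub>C x"
    and scaleC_one: "1 *\<^sub>C x = x"
    and scaleR_scaleC: "r *\<^sub>R x = complex_of_real r *\<^sub>C x"
    and cinner_commute: "cinner x y = cnj (cinner y x)"
    and cinner_add_left: "cinner (x + y) z = cinner x z + cinner y z"
    and cinner_scaleC_left: "cinner (c *\<^sub>C x) y = c * cinner x y"
    and inner_eq_Re_cinner: "inner x y = Re (cinner x y)"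

class chilbert_space = complex_inner + complete_space

lemma cinner_self: "cinner x x = complex_of_real ((norm x)\<^sup>2)"
  by (metis cinner_commute complex_eq_iff complex_cnj_cancel_iff Im_complex_of_real
      Re_complex_of_real complex_cnj inner_eq_Re_cinner power2_norm_eq_inner
      Reals_cnj_iff complex_is_Real_iff)

lemma norm_scaleC: "norm (c *\<^sub>C x) = cmod c * norm (x :: 'a :: complex_inner)"
proof -
  have "cinner (c *\<^sub>C x) (c *\<^sub>C x) = c * cnj c * cinner x x"
    by (metis cinner_commute cinner_scaleC_left complex_cnj_mult mult.assoc)
  then have "complex_of_real ((norm (c *\<^sub>C x))\<^sup>2) = complex_of_real ((cmod c * norm x)\<^sup>2)"
    by (simp add: cinner_self complex_norm_square [symmetric] power_mult_distrib)
  then have "(norm (c *\<^sub>C x))\<^sup>2 = (cmod c * norm x)\<^sup>2"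
    using of_real_eq_iff by blast
  then show ?thesis
    by simp
qed

definition closed_cspan :: "'a :: complex_inner set \<Rightarrow> 'a set" where
  "closed_cspan M = closure (module.span scaleC M)"

definition orthonormal_basis :: "'i set \<Rightarrow> ('i \<Rightarrow> 'a :: complex_inner) \<Rightarrow> bool" where
  "orthonormal_basis I b \<longleftrightarrow>
     (\<forall>i\<in>I. \<forall>j\<in>I. cinner (b i) (b j) = (if i = j then 1 else 0)) \<and>
     closed_cspan (b ` I) = UNIV"

section \<open>Bounded operators\<close>

text \<open>
  \<^typ>\<open>'a \<Rightarrow>\<^sub>L 'a\<close> is the type of bounded real-linear maps with the operator norm. The algebra of
  bounded operators on a complex Hilbert space is its subset of complex-linear maps.
\<close>

definition bounded_ops :: "('a :: complex_inner \<Rightarrow>\<^sub>L 'a) set" where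
  "bounded_ops = {T. \<forall>c x. blinfun_apply T (c *\<^sub>C x) = c *\<^sub>C blinfun_apply T x}"

definition scaleC_op :: "complex \<Rightarrow> ('a :: complex_inner \<Rightarrow>\<^sub>L 'a) \<Rightarrow> ('a \<Rightarrow>\<^sub>L 'a)" where
  "scaleC_op c T = Blinfun (\<lambda>x. c *\<^sub>C blinfun_apply T x)"

lemma scaleC_op_apply: "blinfun_apply (scaleC_op c T) x = c *\<^sub>C blinfun_apply T x"
proof -
  have "bounded_linear (\<lambda>x. c *\<^sub>C x :: 'a)"
    by (rule bounded_linear_intro [where K = "cmod c"])
      (simp_all add: scaleC_add_right scaleR_scaleC scaleC_scaleC norm_scaleC mult.commute)
  then have "bounded_linear (\<lambda>x. c *\<^sub>C blinfun_apply T x)"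
    by (rule bounded_linear_compose) (rule blinfun.bounded_linear_right)
  then show ?thesis
    by (simp add: scaleC_op_def bounded_linear_Blinfun_apply)
qed

definition hilbert_adjoint :: "('a :: chilbert_space \<Rightarrow>\<^sub>L 'a) \<Rightarrow> ('a \<Rightarrow>\<^sub>L 'a)" where
  "hilbert_adjoint T =
     (THE T'. T' \<in> bounded_ops \<and>
        (\<forall>x y. cinner (blinfun_apply T x) y = cinner x (blinfun_apply T' y)))"

definition is_projection :: "('a :: chilbert_space \<Rightarrow>\<^sub>L 'a) \<Rightarrow> bool" where
  "is_projection P \<longleftrightarrow> P \<in> bounded_ops \<and> P o\<^sub>L P = P \<and> hilbert_adjoint P = P"

text \<open>Isometric on the orthogonal complement of the kernel.\<close>

definition partial_isometry :: "('a :: chilbert_space \<Rightarrow>\<^sub>L 'a) \<Rightarrow> bool" where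
  "partial_isometry S \<longleftrightarrow> S \<in> bounded_ops \<and>
     (\<forall>x. (\<forall>y. blinfun_apply S y = 0 \<longrightarrow> cinner x y = 0) \<longrightarrow> norm (blinfun_apply S x) = norm x)"

definition op_le :: "('a :: chilbert_space \<Rightarrow>\<^sub>L 'a) \<Rightarrow> ('a \<Rightarrow>\<^sub>L 'a) \<Rightarrow> bool" where
  "op_le A B \<longleftrightarrow> (\<forall>x. cinner (blinfun_apply (B - A) x) x \<in> \<real>\<^sub>\<ge>\<^sub>0)"

definition proj_onto :: "'a :: chilbert_space set \<Rightarrow> ('a \<Rightarrow>\<^sub>L 'a)" where
  "proj_onto M = (THE P. is_projection P \<and> range (blinfun_apply P) = M)"

section \<open>Operator algebras\<close>

text \<open>Subalgebras are not required to contain the identity operator.\<close>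

definition closed_subalgebra :: "('a :: chilbert_space \<Rightarrow>\<^sub>L 'a) set \<Rightarrow> bool" where
  "closed_subalgebra A \<longleftrightarrow> A \<subseteq> bounded_ops \<and> 0 \<in> A \<and>
     (\<forall>S\<in>A. \<forall>T\<in>A. S + T \<in> A) \<and>
     (\<forall>c. \<forall>T\<in>A. scaleC_op c T \<in> A) \<and>
     (\<forall>S\<in>A. \<forall>T\<in>A. S o\<^sub>L T \<in> A) \<and>
     closed A"

definition cstar_subalgebra :: "('a :: chilbert_space \<Rightarrow>\<^sub>L 'a) set \<Rightarrow> bool" where
  "cstar_subalgebra A \<longleftrightarrow> closed_subalgebra A \<and> (\<forall>T\<in>A. hilbert_adjoint T \<in> A)"

abbreviation cstar_generated :: "('a :: chilbert_space \<Rightarrow>\<^sub>L 'a) set \<Rightarrow> ('a \<Rightarrow>\<^sub>L 'a) set" where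
  "cstar_generated X \<equiv> cstar_subalgebra hull X"

definition star_hom ::
  "('a :: chilbert_space \<Rightarrow>\<^sub>L 'a) set \<Rightarrow> ('b :: chilbert_space \<Rightarrow>\<^sub>L 'b) set \<Rightarrow>
    (('a \<Rightarrow>\<^sub>L 'a) \<Rightarrow> ('b \<Rightarrow>\<^sub>L 'b)) \<Rightarrow> bool" where
  "star_hom A B \<tau> \<longleftrightarrow> \<tau> \<in> A \<rightarrow> B \<and>
     (\<forall>S\<in>A. \<forall>T\<in>A. \<tau> (S + T) = \<tau> S + \<tau> T) \<and>
     (\<forall>c. \<forall>T\<in>A. \<tau> (scaleC_op c T) = scaleC_op c (\<tau> T)) \<and>
     (\<forall>S\<in>A. \<forall>T\<in>A. \<tau> (S o\<^sub>L T) = \<tau> S o\<^sub>L \<tau> T) \<and>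
     (\<forall>T\<in>A. \<tau> (hilbert_adjoint T) = hilbert_adjoint (\<tau> T))"

definition star_epi ::
  "('a :: chilbert_space \<Rightarrow>\<^sub>L 'a) set \<Rightarrow> ('b :: chilbert_space \<Rightarrow>\<^sub>L 'b) set \<Rightarrow>
    (('a \<Rightarrow>\<^sub>L 'a) \<Rightarrow> ('b \<Rightarrow>\<^sub>L 'b)) \<Rightarrow> bool" where
  "star_epi A B \<tau> \<longleftrightarrow> star_hom A B \<tau> \<and> \<tau> ` A = B"

section \<open>Directed graphs and quiver algebras\<close>

text \<open>
  The source and range of an edge are its \<^const>\<open>tail\<close> and \<^const>\<open>head\<close>. An element of the free
  semigroupoid is a pair of its source vertex and the list of its edges in the order in which
  they are traversed: the path $e_k \cdots e_1$ is \<open>(tail G e\<^sub>1, [e\<^sub>1, \<dots>, e\<^sub>k])\<close> and the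
  vertex $x$ is \<open>(x, [])\<close>. Multiplying a path by an edge on the left thus appends it to the list.
\<close>

definition free_semigroupoid :: "('v, 'e) pre_digraph \<Rightarrow> ('v \<times> 'e list) set" where
  "free_semigroupoid G = {(u, p). \<exists>v. pre_digraph.awalk G u p v}"

definition path_range :: "('v, 'e) pre_digraph \<Rightarrow> 'v \<times> 'e list \<Rightarrow> 'v" where
  "path_range G w = pre_digraph.awlast G (fst w) (snd w)"

definition edge_mult :: "'e \<Rightarrow> 'v \<times> 'e list \<Rightarrow> 'v \<times> 'e list" where
  "edge_mult e w = (fst w, snd w @ [e])"

definition no_sources :: "('v, 'e) pre_digraph \<Rightarrow> bool" where
  "no_sources G \<longleftrightarrow> (\<forall>x\<in>verts G. \<exists>e\<in>arcs G. head G e = x)"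

definition no_sinks :: "('v, 'e) pre_digraph \<Rightarrow> bool" where
  "no_sinks G \<longleftrightarrow> (\<forall>x\<in>verts G. \<exists>e\<in>arcs G. tail G e = x)"

text \<open>
  The sum over the edges with range \<open>x\<close>, of which there may be infinitely many, is taken in the
  strong operator topology.
\<close>

definition dagger_relations ::
  "('v, 'e) pre_digraph \<Rightarrow> ('v \<Rightarrow> ('a :: chilbert_space \<Rightarrow>\<^sub>L 'a)) \<Rightarrow> ('e \<Rightarrow> ('a \<Rightarrow>\<^sub>L 'a)) \<Rightarrow> bool"
where
  "dagger_relations G P S \<longleftrightarrow>
     (\<forall>x\<in>verts G. is_projection (P x) \<and> P x \<noteq> 0) \<and>
     (\<forall>e\<in>arcs G. partial_isometry (S e) \<and> S e \<noteq> 0) \<and>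
     (\<forall>x\<in>verts G. \<forall>y\<in>verts G. x \<noteq> y \<longrightarrow> P x o\<^sub>L P y = 0) \<and>
     (\<forall>e\<in>arcs G. \<forall>f\<in>arcs G. e \<noteq> f \<longrightarrow> hilbert_adjoint (S e) o\<^sub>L S f = 0) \<and>
     (\<forall>e\<in>arcs G. hilbert_adjoint (S e) o\<^sub>L S e = P (tail G e)) \<and>
     (\<forall>x\<in>verts G. \<exists>T\<in>bounded_ops.
        (\<forall>h. ((\<lambda>e. blinfun_apply (S e o\<^sub>L hilbert_adjoint (S e)) h) has_sum blinfun_apply T h)
                {e \<in> arcs G. head G e = x}) \<and>
        op_le T (P x))"

text \<open>
  In the following, \<open>\<xi>\<close> is an orthonormal basis, indexed by the free semigroupoid of \<open>G\<close>, of the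
  Hilbert space on which the operators act. Values of \<open>\<xi>\<close> outside the free semigroupoid are
  irrelevant.
\<close>

definition quiver_L ::
  "('v, 'e) pre_digraph \<Rightarrow> ('v \<times> 'e list \<Rightarrow> 'a :: chilbert_space) \<Rightarrow> 'e \<Rightarrow> ('a \<Rightarrow>\<^sub>L 'a)" where
  "quiver_L G \<xi> e = (THE T. T \<in> bounded_ops \<and>
     (\<forall>w\<in>free_semigroupoid G.
        blinfun_apply T (\<xi> w) = (if path_range G w = tail G e then \<xi> (edge_mult e w) else 0)))"

definition quiver_P ::
  "('v, 'e) pre_digraph \<Rightarrow> ('v \<times> 'e list \<Rightarrow> 'a :: chilbert_space) \<Rightarrow> 'v \<Rightarrow> ('a \<Rightarrow>\<^sub>L 'a)" where
  "quiver_P G \<xi> x = proj_onto (closed_cspan (\<xi> ` {w \<in> free_semigroupoid G. path_range G w = x}))"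

definition quiver_algebra ::
  "('v, 'e) pre_digraph \<Rightarrow> ('v \<times> 'e list \<Rightarrow> 'a :: chilbert_space) \<Rightarrow> ('a \<Rightarrow>\<^sub>L 'a) set" where
  "quiver_algebra G \<xi> =
     closed_subalgebra hull (quiver_L G \<xi> ` arcs G \<union> quiver_P G \<xi> ` verts G)"

end

theory Submission
  imports Defs
begin

text \<open>
  For a family that satisfies the relations, the products $S_\alpha S_\beta^*$ over pairs of paths
  with a common source span a *-algebra whose multiplication table is determined by the graph. The
  left regular family \<open>L\<close> is such a family, so \<open>\<tau>\<close> has to map $\sum c_{\alpha\beta} L_\alpha
  L_\beta^*$ to $\sum c_{\alpha\beta} S'_\alpha S_\beta'^*$, and everything rests on the estimate
  $\|\sum c_{\alpha\beta} S'_\alpha S_\beta'^*\| \le \|\sum c_{\alpha\beta} L_\alpha L_\beta^*\|$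
  (\<open>joint_alg_norm_le\<close>): it makes this map well defined and lets it extend by continuity.

  The estimate comes from a Poisson kernel. For \<open>0 \<le> r < 1\<close> put
  $K h = \sum_w \xi_w \otimes r^{|w|} \Delta_{s(w)} S_w'^* h$, where
  $\Delta_v = (P'_v - r^2 Q_v)^{1/2}$ and $Q_v = \sum_{r(e)=v} S'_e S_e'^*$. A telescoping sum shows
  that \<open>K\<close> is a contraction, and it intertwines in such a way that
  $K^* (L_\alpha L_\beta^* \otimes 1) K = r^{|\alpha|+|\beta|} S'_\alpha S_\beta'^*$. As
  $\|T \otimes 1\| = \|T\|$, the limit \<open>r \<rightarrow> 1\<close> gives the estimate. Two devices keep this elementary.
  As $Q_v$ is a projection below $P'_v$, the square root is explicit:
  $\Delta_v = P'_v - (1 - \sqrt{1 - r^2}) Q_v$. And the sum over \<open>w\<close> is cut down to the finitely many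
  paths with edges and ranges in given finite sets and of bounded length; then the tensor product
  becomes a finite double sum (\<open>amplification_bound\<close>), and the price is one remainder of the
  telescoping sum (\<open>poisson_intertwine\<close>), which vanishes as the length grows.

  The image of \<open>\<tau>\<close> contains the generators, so it only has to be closed. A contractive *-homomorphism
  has closed image because elements of the image have approximate lifts of controlled norm
  (\<open>closed_image_star_hom\<close>): for $b = \tau(a)$ of norm one, the solution \<open>c\<close> of
  $c + \frac14 a a^* c = a$ has norm at most one, and $\tau(c)$, which solves the same equation for
  \<open>b\<close>, is within $\frac14$ of \<open>b\<close>.
\<close>

section \<open>Complex inner products\<close>

instance chilbert_space \<subseteq> banach ..

interpretation complex_vector: vector_space "scaleC :: complex \<Rightarrow> 'a :: complex_inner \<Rightarrow> 'a"
  by unfold_locales (simp_all add: scaleC_add_right scaleC_add_left scaleC_scaleC scaleC_one)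

lemma cinner_add_right: "cinner x (y + z) = cinner x y + cinner x z"
  by (metis cinner_commute cinner_add_left complex_cnj_add)

lemma cinner_scaleC_right: "cinner x (c *\<^sub>C y) = cnj c * cinner x y"
  by (metis cinner_commute cinner_scaleC_left complex_cnj_mult)

lemma cinner_scaleR_left: "cinner (r *\<^sub>R x) y = complex_of_real r * cinner x y"
  by (simp add: scaleR_scaleC cinner_scaleC_left)

lemma cinner_scaleR_right: "cinner x (r *\<^sub>R y) = complex_of_real r * cinner x y"
  by (simp add: scaleR_scaleC cinner_scaleC_right)

lemma Cauchy_Schwarz_cinner: "cmod (cinner x y) \<le> norm x * norm y"
proof (cases "cinner x y = 0")
  case False
  define c where "c = cnj (sgn (cinner x y))"
  have "cinner (c *\<^sub>C x) y = complex_of_real (cmod (cinner x y))"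
    using False
    by (simp add: c_def cinner_scaleC_left sgn_eq complex_norm_square [symmetric] field_simps power2_eq_square
        flip: of_real_mult)
  then have "cmod (cinner x y) = inner (c *\<^sub>C x) y"
    by (simp add: inner_eq_Re_cinner)
  also have "\<dots> \<le> norm (c *\<^sub>C x) * norm y"
    by (rule norm_cauchy_schwarz)
  also have "norm (c *\<^sub>C x) = norm x"
    using False by (simp add: norm_scaleC c_def norm_sgn)
  finally show ?thesis .
qed simp

lemma bounded_bilinear_cinner: "bounded_bilinear cinner"
proof
  show "\<exists>K. \<forall>a b. cmod (cinner a b) \<le> norm a * norm b * K"
    using Cauchy_Schwarz_cinner by (metis mult.right_neutral)
qed (simp_all add: cinner_add_left cinner_add_right cinner_scaleR_left cinner_scaleR_right scaleR_conv_of_real)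

interpretation cinner: bounded_bilinear cinner
  by (rule bounded_bilinear_cinner)

lemma cinner_ext: "(\<And>x. cinner x y = cinner x z) \<Longrightarrow> y = z"
proof -
  assume "\<And>x. cinner x y = cinner x z"
  then have "cinner (y - z) (y - z) = 0"
    by (simp add: cinner.diff_right)
  then show ?thesis by (simp add: cinner_self)
qed

text \<open>
  Both parts of the complex inner product are real inner products, so an identity between
  complex inner products can be checked on real ones.
\<close>

lemma Im_cinner: "Im (cinner x y) = inner (- \<i> *\<^sub>C x) y"
  by (simp add: inner_eq_Re_cinner cinner_scaleC_left cinner.minus_left)

section \<open>The Riesz representation and adjoints\<close>

text \<open>
  The representing vector is the minimiser of \<open>x \<mapsto> \<parallel>x\<parallel>\<^sup>2 - 2 \<phi> x\<close>: by the parallelogram law minimising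
  sequences are Cauchy, and the first variation at the minimum is the claim.
\<close>

lemma riesz_representation:
  fixes \<phi> :: "'a :: {real_inner, complete_space} \<Rightarrow> real"
  assumes "bounded_linear \<phi>"
  obtains y where "\<And>x. \<phi> x = inner x y"
proof -
  interpret bounded_linear \<phi> by fact
  obtain B where B: "\<bar>\<phi> x\<bar> \<le> norm x * B" for x
    using bounded by auto
  define J where "J x = (norm x)\<^sup>2 - 2 * \<phi> x" for x
  have J_lower: "- (B\<^sup>2) \<le> J x" for x
  proof -
    have "0 \<le> (norm x - B)\<^sup>2" by simp
    also have "\<dots> = (norm x)\<^sup>2 - 2 * (norm x * B) + B\<^sup>2" by (simp add: power2_diff)
    finally show ?thesis using B [of x] unfolding J_def by linarith
  qed
  define m where "m = (INF x. J x)"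
  have bdd: "bdd_below (range J)"
    using J_lower by (auto intro!: bdd_belowI)
  have m_le: "m \<le> J x" for x
    unfolding m_def using bdd by (simp add: cINF_lower)
  define \<delta> where "\<delta> n = inverse (real (Suc n))" for n
  have "\<exists>x. J x < m + \<delta> n" for n
    using cInf_lessD [of "range J" "m + \<delta> n"] by (auto simp: m_def \<delta>_def)
  then obtain s where s: "J (s n) < m + \<delta> n" for n
    by metis
  have parallelogram: "(norm (x - y))\<^sup>2 \<le> 2 * (J x - m) + 2 * (J y - m)" for x y
  proof -
    have "4 * J ((1/2) *\<^sub>R (x + y)) = (norm (x + y))\<^sup>2 - 4 * \<phi> (x + y)"
      unfolding J_def scaleR norm_scaleR by (simp add: power_divide)
    moreover have "(norm (x - y))\<^sup>2 + (norm (x + y))\<^sup>2 = 2 * (norm x)\<^sup>2 + 2 * (norm y)\<^sup>2"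
      unfolding power2_norm_eq_inner
      by (simp add: inner_add_left inner_add_right inner_diff_left inner_diff_right inner_commute [of y x])
    ultimately show ?thesis
      using m_le [of "(1/2) *\<^sub>R (x + y)"] by (simp add: J_def add)
  qed
  have "Cauchy s"
  proof (rule metric_CauchyI)
    fix e :: real assume "e > 0"
    then have "0 < e\<^sup>2 / 4" by simp
    then obtain N where N: "\<delta> N < e\<^sup>2 / 4"
      unfolding \<delta>_def using reals_Archimedean by blast
    have "dist (s i) (s j) < e" if "i \<ge> N" "j \<ge> N" for i j
    proof -
      have "\<delta> i \<le> \<delta> N" "\<delta> j \<le> \<delta> N"
        using that by (auto simp: \<delta>_def divide_simps)
      then have "J (s i) - m < \<delta> N" "J (s j) - m < \<delta> N"
        using s [of i] s [of j] by linarith+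
      then have "(norm (s i - s j))\<^sup>2 < 4 * \<delta> N"
        using parallelogram [of "s i" "s j"] by (smt (verit))
      also have "\<dots> < e\<^sup>2" using N by simp
      finally have "(norm (s i - s j))\<^sup>2 < e\<^sup>2" .
      then show ?thesis
        using \<open>e > 0\<close> by (simp add: dist_norm power2_less_imp_less)
    qed
    then show "\<exists>M. \<forall>i\<ge>M. \<forall>j\<ge>M. dist (s i) (s j) < e"
      by (intro exI [of _ N] allI impI)
  qed
  then have "convergent s" by (rule Cauchy_convergent)
  then obtain y where y: "s \<longlonglongrightarrow> y"
    by (auto simp: convergent_def)
  have "(\<lambda>n. J (s n)) \<longlonglongrightarrow> J y"
    unfolding J_def by (intro tendsto_intros y tendsto)
  moreover have "(\<lambda>n. m + \<delta> n) \<longlonglongrightarrow> m + 0"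
    unfolding \<delta>_def by (intro tendsto_add tendsto_const LIMSEQ_inverse_real_of_nat)
  ultimately have "J y \<le> m + 0"
    by (rule LIMSEQ_le) (auto intro!: exI [of _ 0] less_imp_le s)
  then have Jy: "J y \<le> m" by simp
  have "\<phi> z = inner z y" for z
  proof (rule ccontr)
    assume ne: "\<phi> z \<noteq> inner z y"
    define d where "d = \<phi> z - inner z y"
    have J_shift: "J (y + t *\<^sub>R z) = J y - 2 * t * d + t\<^sup>2 * (norm z)\<^sup>2" for t
    proof -
      have "(norm (y + t *\<^sub>R z))\<^sup>2 = (norm y)\<^sup>2 + 2 * t * inner z y + t\<^sup>2 * (norm z)\<^sup>2"
        unfolding power2_norm_eq_inner
        by (simp add: inner_add_left inner_add_right inner_commute [of y z] power2_eq_square distrib_left)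
      moreover have "\<phi> (y + t *\<^sub>R z) = \<phi> y + t * \<phi> z"
        by (simp add: add scaleR)
      ultimately show ?thesis
        by (simp add: J_def d_def algebra_simps)
    qed
    have "z \<noteq> 0" using ne by auto
    then have nz: "(norm z)\<^sup>2 > 0" by simp
    \<comment> \<open>the parabola \<open>t \<mapsto> J (y + t z)\<close> has its vertex at this \<open>t\<close>\<close>
    define t where "t = d / (norm z)\<^sup>2"
    have "J (y + t *\<^sub>R z) = J y - d\<^sup>2 / (norm z)\<^sup>2"
      unfolding J_shift t_def power_divide using nz by (simp add: power2_eq_square)
    moreover have "d\<^sup>2 / (norm z)\<^sup>2 > 0"
      using nz ne by (simp add: d_def)
    ultimately show False using m_le [of "y + t *\<^sub>R z"] Jy by linarith
  qed
  then show thesis by (rule that)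
qed

lemma bounded_ops_scaleC:
  "T \<in> bounded_ops \<Longrightarrow> blinfun_apply T (c *\<^sub>C x) = c *\<^sub>C blinfun_apply T x"
  by (simp add: bounded_ops_def)

text \<open>
  The adjoint in the definitions is a definite description; uniqueness and, through the Riesz
  representation, existence make it usable.
\<close>

lemma adjoint_unique:
  assumes "\<And>x y. cinner (blinfun_apply T x) y = cinner x (blinfun_apply A y)"
    and "\<And>x y. cinner (blinfun_apply T x) y = cinner x (blinfun_apply B y)"
  shows "A = B"
  by (rule blinfun_eqI, rule cinner_ext) (metis assms)

lemma hilbert_adjoint_eqI:
  assumes "T' \<in> bounded_ops"
    and "\<And>x y. cinner (blinfun_apply T x) y = cinner x (blinfun_apply T' y)"
  shows "hilbert_adjoint T = T'"
  unfolding hilbert_adjoint_def using assms by (intro the_equality) (use adjoint_unique in blast)+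

lemma adjoint_exists:
  fixes T :: "'a :: chilbert_space \<Rightarrow>\<^sub>L 'a"
  assumes T: "T \<in> bounded_ops"
  shows "\<exists>T'\<in>bounded_ops. \<forall>x y. cinner (blinfun_apply T x) y = cinner x (blinfun_apply T' y)"
proof -
  have "\<exists>z. \<forall>x. inner (blinfun_apply T x) y = inner x z" for y
    by (rule riesz_representation
          [OF bounded_linear_compose [OF bounded_linear_inner_left [of y] blinfun.bounded_linear_right [of T]]])
      blast
  then obtain f where f: "inner (blinfun_apply T x) y = inner x (f y)" for x y
    by metis
  have cf: "cinner (blinfun_apply T x) y = cinner x (f y)" for x y
  proof (rule complex_eqI)
    show "Re (cinner (blinfun_apply T x) y) = Re (cinner x (f y))"
      using f by (simp add: inner_eq_Re_cinner)
    show "Im (cinner (blinfun_apply T x) y) = Im (cinner x (f y))"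
      unfolding Im_cinner f [symmetric] bounded_ops_scaleC [OF T] ..
  qed
  have "bounded_linear f"
  proof (rule bounded_linear_intro [where K = "norm T"])
    show "f (x + y) = f x + f y" for x y
      by (rule cinner_ext) (simp add: cinner_add_right flip: cf)
    show "f (r *\<^sub>R x) = r *\<^sub>R f x" for r x
      by (rule cinner_ext) (simp add: cinner_scaleR_right flip: cf)
    show "norm (f y) \<le> norm y * norm T" for y
    proof (cases "f y = 0")
      case False
      have "(norm (f y))\<^sup>2 = inner (blinfun_apply T (f y)) y"
        by (simp add: f power2_norm_eq_inner)
      also have "\<dots> \<le> norm (blinfun_apply T (f y)) * norm y" by (rule norm_cauchy_schwarz)
      also have "\<dots> \<le> norm T * norm (f y) * norm y"
        by (intro mult_right_mono norm_blinfun) simp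
      finally show ?thesis using False by (simp add: power2_eq_square mult.commute)
    qed simp
  qed
  then have ap: "blinfun_apply (Blinfun f) = f"
    by (rule bounded_linear_Blinfun_apply)
  have "f (c *\<^sub>C x) = c *\<^sub>C f x" for c x
    by (rule cinner_ext) (simp add: cinner_scaleC_right flip: cf)
  then have "Blinfun f \<in> bounded_ops"
    by (simp add: bounded_ops_def ap)
  with cf show ?thesis by (intro bexI [of _ "Blinfun f"]) (simp_all add: ap)
qed

lemma
  fixes T :: "'a :: chilbert_space \<Rightarrow>\<^sub>L 'a"
  assumes "T \<in> bounded_ops"
  shows adjoint_in_bounded_ops: "hilbert_adjoint T \<in> bounded_ops"
    and cinner_adjoint: "cinner (blinfun_apply T x) y = cinner x (blinfun_apply (hilbert_adjoint T) y)"
  using adjoint_exists [OF assms] hilbert_adjoint_eqI by metis+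

lemma cinner_adjoint':
  assumes "T \<in> bounded_ops"
  shows "cinner (blinfun_apply (hilbert_adjoint T) x) y = cinner x (blinfun_apply T y)"
  by (metis assms cinner_adjoint cinner_commute)

lemma adjoint_adjoint: "T \<in> bounded_ops \<Longrightarrow> hilbert_adjoint (hilbert_adjoint T) = T"
  by (simp add: cinner_adjoint' hilbert_adjoint_eqI)

section \<open>The algebra of bounded operators\<close>

lemma blinfun_compose_assoc: "(A o\<^sub>L B) o\<^sub>L C = A o\<^sub>L (B o\<^sub>L C)"
  by (rule blinfun_eqI) simp

lemma scaleC_op_one: "scaleC_op 1 T = T"
  by (rule blinfun_eqI) (simp add: scaleC_op_apply)

lemma scaleC_op_scaleC_op: "scaleC_op c (scaleC_op d T) = scaleC_op (c * d) T"
  by (rule blinfun_eqI) (simp add: scaleC_op_apply)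

lemma scaleC_op_add: "scaleC_op c (S + T) = scaleC_op c S + scaleC_op c T"
  by (rule blinfun_eqI) (simp add: scaleC_op_apply blinfun.add_left scaleC_add_right)

lemma scaleC_op_zero: "scaleC_op c 0 = 0"
  by (rule blinfun_eqI) (simp add: scaleC_op_apply)

lemma compose_scaleC_op: "x \<in> bounded_ops \<Longrightarrow> x o\<^sub>L scaleC_op c T = scaleC_op c (x o\<^sub>L T)"
  by (rule blinfun_eqI) (simp add: scaleC_op_apply bounded_ops_scaleC)

lemma scaleC_op_compose: "scaleC_op c T o\<^sub>L x = scaleC_op c (T o\<^sub>L x)"
  by (rule blinfun_eqI) (simp add: scaleC_op_apply)

lemma compose_add: "x o\<^sub>L (a + b) = (x o\<^sub>L a) + (x o\<^sub>L b)"
  "(a + b) o\<^sub>L x = (a o\<^sub>L x) + (b o\<^sub>L x)"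
  by (rule blinfun_eqI; simp add: blinfun.add_left blinfun.add_right)+

lemma zero_in_bounded_ops: "0 \<in> bounded_ops"
  by (simp add: bounded_ops_def)

lemma add_in_bounded_ops: "S \<in> bounded_ops \<Longrightarrow> T \<in> bounded_ops \<Longrightarrow> S + T \<in> bounded_ops"
  by (simp add: bounded_ops_def blinfun.add_left scaleC_add_right)

lemma diff_in_bounded_ops: "S \<in> bounded_ops \<Longrightarrow> T \<in> bounded_ops \<Longrightarrow> S - T \<in> bounded_ops"
  by (simp add: bounded_ops_def blinfun.diff_left complex_vector.scale_right_diff_distrib)

lemma scaleC_op_in_bounded_ops: "T \<in> bounded_ops \<Longrightarrow> scaleC_op c T \<in> bounded_ops"
  by (simp add: bounded_ops_def scaleC_op_apply scaleC_scaleC mult.commute)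

lemma compose_in_bounded_ops:
  "S \<in> bounded_ops \<Longrightarrow> T \<in> bounded_ops \<Longrightarrow> S o\<^sub>L T \<in> bounded_ops"
  by (simp add: bounded_ops_def)

lemmas bounded_ops_intros =
  zero_in_bounded_ops add_in_bounded_ops scaleC_op_in_bounded_ops compose_in_bounded_ops
  adjoint_in_bounded_ops

lemma adjoint_zero: "hilbert_adjoint 0 = 0"
  by (intro hilbert_adjoint_eqI) (simp_all add: zero_in_bounded_ops cinner.zero_left cinner.zero_right)

lemma adjoint_add:
  "S \<in> bounded_ops \<Longrightarrow> T \<in> bounded_ops \<Longrightarrow>
    hilbert_adjoint (S + T) = hilbert_adjoint S + hilbert_adjoint T"
  by (intro hilbert_adjoint_eqI)
    (simp_all add: bounded_ops_intros blinfun.add_left cinner_add_left cinner_add_right cinner_adjoint)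

lemma adjoint_diff:
  "S \<in> bounded_ops \<Longrightarrow> T \<in> bounded_ops \<Longrightarrow>
    hilbert_adjoint (S - T) = hilbert_adjoint S - hilbert_adjoint T"
  by (intro hilbert_adjoint_eqI)
    (simp_all add: bounded_ops_intros diff_in_bounded_ops blinfun.diff_left cinner.diff_left
      cinner.diff_right cinner_adjoint)

lemma adjoint_scaleC_op:
  "T \<in> bounded_ops \<Longrightarrow> hilbert_adjoint (scaleC_op c T) = scaleC_op (cnj c) (hilbert_adjoint T)"
  by (intro hilbert_adjoint_eqI)
    (simp_all add: bounded_ops_intros scaleC_op_apply cinner_scaleC_left cinner_scaleC_right cinner_adjoint)

lemma adjoint_compose:
  "S \<in> bounded_ops \<Longrightarrow> T \<in> bounded_ops \<Longrightarrow>
    hilbert_adjoint (S o\<^sub>L T) = hilbert_adjoint T o\<^sub>L hilbert_adjoint S"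
  by (intro hilbert_adjoint_eqI) (simp_all add: bounded_ops_intros cinner_adjoint)

lemma norm_adjoint_le:
  assumes "T \<in> bounded_ops" shows "norm (hilbert_adjoint T) \<le> norm T"
proof (rule norm_blinfun_bound)
  fix y
  let ?y = "blinfun_apply (hilbert_adjoint T) y"
  show "norm ?y \<le> norm T * norm y"
  proof (cases "?y = 0")
    case False
    have "(norm ?y)\<^sup>2 = cmod (cinner ?y ?y)" by (simp add: cinner_self norm_power)
    also have "\<dots> = cmod (cinner (blinfun_apply T ?y) y)" by (simp add: cinner_adjoint assms)
    also have "\<dots> \<le> norm (blinfun_apply T ?y) * norm y" by (rule Cauchy_Schwarz_cinner)
    also have "\<dots> \<le> norm T * norm ?y * norm y"
      by (intro mult_right_mono norm_blinfun) simp
    finally show ?thesis using False by (simp add: power2_eq_square)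
  qed simp
qed simp

lemma is_projection_norm_le:
  assumes "is_projection P" shows "norm (blinfun_apply P x) \<le> norm x"
proof (cases "blinfun_apply P x = 0")
  case False
  let ?y = "blinfun_apply P x"
  have P: "P \<in> bounded_ops" "P o\<^sub>L P = P" "hilbert_adjoint P = P"
    using assms by (auto simp: is_projection_def)
  have "cinner ?y ?y = cinner x ?y"
    using cinner_adjoint [OF P(1), of x ?y] P by (metis blinfun_apply_blinfun_compose)
  then have "(norm ?y)\<^sup>2 = cmod (cinner x ?y)" by (metis cinner_self norm_of_real abs_power2 abs_norm_cancel)
  also have "\<dots> \<le> norm x * norm ?y" by (rule Cauchy_Schwarz_cinner)
  finally show ?thesis using False by (simp add: power2_eq_square)
qed simp

section \<open>C*-subalgebras\<close>

lemma bounded_linear_scaleC: "bounded_linear (scaleC c :: 'a \<Rightarrow> 'a :: complex_inner)"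
  by (rule bounded_linear_intro [where K = "cmod c"])
    (simp_all add: scaleC_add_right scaleR_scaleC complex_vector.scale_left_commute norm_scaleC)

lemma bounded_linear_scaleC_op: "bounded_linear (scaleC_op c)"
proof (rule bounded_linear_intro [where K = "cmod c"])
  show "norm (scaleC_op c T) \<le> norm T * cmod c" for T :: "'a \<Rightarrow>\<^sub>L 'a"
  proof (rule norm_blinfun_bound)
    show "norm (blinfun_apply (scaleC_op c T) x) \<le> norm T * cmod c * norm x" for x
      using mult_left_mono [OF norm_blinfun [of T x], of "cmod c"]
      by (simp add: scaleC_op_apply norm_scaleC mult_ac)
  qed simp
qed (simp_all add: blinfun_eqI scaleC_op_apply blinfun.add_left blinfun.scaleR_left scaleC_add_right
       scaleR_scaleC complex_vector.scale_left_commute)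

lemma closed_bounded_ops: "closed (bounded_ops :: ('a :: complex_inner \<Rightarrow>\<^sub>L 'a) set)"
proof -
  have *: "continuous_on UNIV (\<lambda>T :: 'a \<Rightarrow>\<^sub>L 'a. c *\<^sub>C blinfun_apply T x)" for c x
    by (rule bounded_linear.continuous_on [OF bounded_linear_scaleC]) (intro continuous_intros)
  have "(bounded_ops :: ('a \<Rightarrow>\<^sub>L 'a) set) = (\<Inter>c. \<Inter>x. {T. blinfun_apply T (c *\<^sub>C x) = c *\<^sub>C blinfun_apply T x})"
    by (auto simp: bounded_ops_def)
  also have "closed \<dots>"
    by (intro closed_INT ballI closed_Collect_eq * continuous_intros)
  finally show ?thesis .
qed

lemma tendsto_adjoint:
  assumes "\<And>n. T n \<in> bounded_ops" "T \<longlonglongrightarrow> L"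
  shows "(\<lambda>n. hilbert_adjoint (T n)) \<longlonglongrightarrow> hilbert_adjoint L"
proof -
  have L: "L \<in> bounded_ops"
    using assms closed_bounded_ops closed_sequentially by blast
  have "norm (hilbert_adjoint (T n) - hilbert_adjoint L) \<le> norm (T n - L)" for n
  proof -
    have "hilbert_adjoint (T n) - hilbert_adjoint L = hilbert_adjoint (T n - L)"
      by (simp add: adjoint_diff assms L)
    also have "norm \<dots> \<le> norm (T n - L)"
      by (intro norm_adjoint_le diff_in_bounded_ops assms L)
    finally show ?thesis .
  qed
  then show ?thesis
    by (intro metric_tendsto_imp_tendsto [OF assms(2)] always_eventually) (simp add: dist_norm)
qed

lemma cstar_subalgebraD:
  assumes "cstar_subalgebra A"
  shows "A \<subseteq> bounded_ops" "0 \<in> A" "S \<in> A \<Longrightarrow> T \<in> A \<Longrightarrow> S + T \<in> A"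
    "T \<in> A \<Longrightarrow> scaleC_op c T \<in> A" "S \<in> A \<Longrightarrow> T \<in> A \<Longrightarrow> S o\<^sub>L T \<in> A" "closed A"
    "T \<in> A \<Longrightarrow> hilbert_adjoint T \<in> A"
  using assms by (auto simp: cstar_subalgebra_def closed_subalgebra_def)

lemma cstar_subalgebra_bounded_ops: "cstar_subalgebra bounded_ops"
  by (simp add: cstar_subalgebra_def closed_subalgebra_def bounded_ops_intros closed_bounded_ops)

lemma scaleC_op_of_real: "scaleC_op (complex_of_real r) T = r *\<^sub>R T"
  by (rule blinfun_eqI) (simp add: scaleC_op_apply blinfun.scaleR_left scaleR_scaleC)

lemma cstar_subalgebra_subspace: "cstar_subalgebra A \<Longrightarrow> subspace A"
  unfolding subspace_def by (metis cstar_subalgebraD(2,3,4) scaleC_op_of_real)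

lemma cstar_subalgebra_Inter:
  assumes "F \<noteq> {}" and F: "\<And>A. A \<in> F \<Longrightarrow> cstar_subalgebra A"
  shows "cstar_subalgebra (\<Inter>F)"
proof -
  obtain B where "B \<in> F" using assms(1) by blast
  then have "\<Inter>F \<subseteq> bounded_ops"
    using cstar_subalgebraD(1) [OF F] by (meson Inter_lower order_trans)
  moreover have "0 \<in> \<Inter>F"
    by (rule InterI) (rule cstar_subalgebraD(2) [OF F])
  moreover have "closed (\<Inter>F)"
    by (rule closed_Inter, rule ballI, rule cstar_subalgebraD(6) [OF F])
  moreover have "S + T \<in> \<Inter>F" if "S \<in> \<Inter>F" "T \<in> \<Inter>F" for S T
    by (rule InterI, rule cstar_subalgebraD(3) [OF F]) (use that in simp_all)
  moreover have "S o\<^sub>L T \<in> \<Inter>F" if "S \<in> \<Inter>F" "T \<in> \<Inter>F" for S T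
    by (rule InterI, rule cstar_subalgebraD(5) [OF F]) (use that in simp_all)
  moreover have "scaleC_op c T \<in> \<Inter>F" if "T \<in> \<Inter>F" for c T
    by (rule InterI, rule cstar_subalgebraD(4) [OF F]) (use that in simp_all)
  moreover have "hilbert_adjoint T \<in> \<Inter>F" if "T \<in> \<Inter>F" for T
    by (rule InterI, rule cstar_subalgebraD(7) [OF F]) (use that in simp_all)
  ultimately show ?thesis
    by (simp only: cstar_subalgebra_def closed_subalgebra_def) simp
qed

lemma cstar_subalgebra_generated:
  assumes "X \<subseteq> bounded_ops"
  shows "cstar_subalgebra (cstar_generated X)"
  unfolding hull_def
  by (rule cstar_subalgebra_Inter) (use assms cstar_subalgebra_bounded_ops in auto)

section \<open>Closed contractive relations\<close>

text \<open>
  A set of pairs that is closed under differences and in which the second component is dominated in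
  norm by the first is the graph of a contraction. The lemmas of this section say that its closure is
  again such a graph, with closed domain. This extends densely defined contractions to the closure
  without first choosing values; it is used once for operators on an orthonormal basis and once for
  the homomorphism itself.
\<close>

lemma contraction_closure_bound:
  fixes R :: "('a :: real_normed_vector \<times> 'b :: real_normed_vector) set"
  assumes bound: "\<And>a b. (a, b) \<in> R \<Longrightarrow> norm b \<le> norm a"
    and "(a, b) \<in> closure R"
  shows "norm b \<le> norm a"
proof -
  have "closed {p :: 'a \<times> 'b. norm (snd p) \<le> norm (fst p)}"
    by (intro closed_Collect_le continuous_intros)
  then have "closure R \<subseteq> {p. norm (snd p) \<le> norm (fst p)}"
    by (rule closure_minimal [rotated]) (use bound in force)
  with assms(2) show ?thesis by auto
qed

lemma closure_diff:
  fixes R :: "'a :: real_normed_vector set"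
  assumes diff: "\<And>p q. p \<in> R \<Longrightarrow> q \<in> R \<Longrightarrow> p - q \<in> R"
    and "p \<in> closure R" "q \<in> closure R"
  shows "p - q \<in> closure R"
proof -
  obtain f g where "\<forall>n. f n \<in> R" "f \<longlonglongrightarrow> p" "\<forall>n. g n \<in> R" "g \<longlonglongrightarrow> q"
    using assms(2,3) by (meson closure_sequential)
  then have "\<forall>n. f n - g n \<in> R" "(\<lambda>n. f n - g n) \<longlonglongrightarrow> p - q"
    by (auto intro: diff tendsto_diff)
  then show ?thesis by (auto simp: closure_sequential)
qed

lemma closure_pair_binop:
  fixes R :: "('a :: first_countable_topology \<times> 'b :: first_countable_topology) set"
  assumes closed: "\<And>a b a' b'. (a, b) \<in> R \<Longrightarrow> (a', b') \<in> R \<Longrightarrow> (f a a', g b b') \<in> R"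
    and f: "\<And>X Y x y. X \<longlonglongrightarrow> x \<Longrightarrow> Y \<longlonglongrightarrow> y \<Longrightarrow> (\<lambda>n. f (X n) (Y n)) \<longlonglongrightarrow> f x y"
    and g: "\<And>X Y x y. X \<longlonglongrightarrow> x \<Longrightarrow> Y \<longlonglongrightarrow> y \<Longrightarrow> (\<lambda>n. g (X n) (Y n)) \<longlonglongrightarrow> g x y"
    and "(a, b) \<in> closure R" "(a', b') \<in> closure R"
  shows "(f a a', g b b') \<in> closure R"
proof -
  obtain X Y where X: "\<And>n. X n \<in> R" "X \<longlonglongrightarrow> (a, b)" and Y: "\<And>n. Y n \<in> R" "Y \<longlonglongrightarrow> (a', b')"
    using assms(4,5) by (auto simp: closure_sequential)
  have "(f (fst (X n)) (fst (Y n)), g (snd (X n)) (snd (Y n))) \<in> R" for n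
    using X(1) [of n] Y(1) [of n] by (intro closed) simp_all
  moreover have "(\<lambda>n. (f (fst (X n)) (fst (Y n)), g (snd (X n)) (snd (Y n)))) \<longlonglongrightarrow> (f a a', g b b')"
    using tendsto_fst [OF X(2)] tendsto_fst [OF Y(2)] tendsto_snd [OF X(2)] tendsto_snd [OF Y(2)]
    by (intro tendsto_Pair f g) simp_all
  ultimately show ?thesis
    unfolding closure_sequential
    by (intro exI [of _ "\<lambda>n. (f (fst (X n)) (fst (Y n)), g (snd (X n)) (snd (Y n)))"] conjI allI)
qed

lemma contraction_closure_unique:
  fixes R :: "('a :: real_normed_vector \<times> 'b :: real_normed_vector) set"
  assumes bound: "\<And>a b. (a, b) \<in> R \<Longrightarrow> norm b \<le> norm a"
    and diff: "\<And>p q. p \<in> R \<Longrightarrow> q \<in> R \<Longrightarrow> p - q \<in> R"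
    and "(a, b) \<in> closure R" "(a, b') \<in> closure R"
  shows "b = b'"
proof -
  have "(a, b) - (a, b') \<in> closure R"
    by (rule closure_diff [OF diff assms(3,4)])
  then have "norm (b - b') \<le> norm (a - a)"
    by (intro contraction_closure_bound [of R, OF bound]) simp_all
  then show ?thesis by simp
qed

lemma contraction_closure_total:
  fixes R :: "('a :: real_normed_vector \<times> 'b :: banach) set"
  assumes bound: "\<And>a b. (a, b) \<in> R \<Longrightarrow> norm b \<le> norm a"
    and diff: "\<And>p q. p \<in> R \<Longrightarrow> q \<in> R \<Longrightarrow> p - q \<in> R"
    and "a \<in> closure (fst ` R)"
  obtains b where "(a, b) \<in> closure R"
proof -
  obtain f where f: "\<forall>n. f n \<in> fst ` R" "f \<longlonglongrightarrow> a"
    using assms(3) by (meson closure_sequential)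
  then have "\<forall>n. \<exists>b. (f n, b) \<in> R" by force
  then obtain g where g: "(f n, g n) \<in> R" for n by metis
  have gf: "dist (g m) (g n) \<le> dist (f m) (f n)" for m n
    using bound [of "f m - f n" "g m - g n"] diff [OF g [of m] g [of n]] by (simp add: dist_norm)
  have "Cauchy f" using f(2) by (rule LIMSEQ_imp_Cauchy)
  then have "Cauchy g" using gf by (meson Cauchy_def le_less_trans)
  then obtain b where "g \<longlonglongrightarrow> b" by (auto simp: Cauchy_convergent_iff convergent_def)
  with f g have "(\<lambda>n. (f n, g n)) \<longlonglongrightarrow> (a, b)" by (intro tendsto_Pair)
  with g have "(a, b) \<in> closure R"
    unfolding closure_sequential by (intro exI [of _ "\<lambda>n. (f n, g n)"] conjI allI)
  then show thesis by (rule that)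
qed

section \<open>The image of a contractive *-homomorphism is closed\<close>

text \<open>
  The successive approximation of the open mapping theorem: an approximate lift of \<open>b\<close> leaves a
  remainder of at most half the size, and the sum of the lifts of the remainders converges because
  their norms are controlled.
\<close>

lemma closed_image_of_approximate_lifts:
  fixes \<tau> :: "'a :: banach \<Rightarrow> 'b :: real_normed_vector"
  assumes A: "subspace A" "closed A"
    and diff: "\<And>x y. x \<in> A \<Longrightarrow> y \<in> A \<Longrightarrow> \<tau> (x - y) = \<tau> x - \<tau> y"
    and contr: "\<And>x. x \<in> A \<Longrightarrow> norm (\<tau> x) \<le> norm x"
    and lift: "\<And>b. b \<in> \<tau> ` A \<Longrightarrow> \<exists>c\<in>A. norm c \<le> norm b \<and> norm (b - \<tau> c) \<le> norm b / 4"
  shows "closed (\<tau> ` A)"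
proof -
  let ?C = "closure (\<tau> ` A)"
  have \<tau>0: "\<tau> 0 = 0"
    using diff [of 0 0] subspace_0 [OF A(1)] by simp
  have step: "\<exists>c\<in>A. norm c \<le> 2 * norm r \<and> norm (r - \<tau> c) \<le> norm r / 2" if "r \<in> ?C" for r
  proof (cases "r = 0")
    case True
    then show ?thesis using \<tau>0 subspace_0 [OF A(1)] by (intro bexI [of _ 0]) auto
  next
    case False
    then have "norm r / 8 > 0" by simp
    then have "\<exists>b\<in>\<tau> ` A. dist b r < norm r / 8"
      by (rule closure_approachable [THEN iffD1, rule_format, OF that])
    then obtain b where b: "b \<in> \<tau> ` A" "dist b r < norm r / 8"
      by (rule bexE)
    obtain c where c: "c \<in> A" "norm c \<le> norm b" "norm (b - \<tau> c) \<le> norm b / 4"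
      using lift [OF b(1)] by blast
    have br: "norm (r - b) < norm r / 8" using b(2) by (simp add: dist_norm norm_minus_commute)
    have "norm b \<le> norm r + norm (r - b)"
      using norm_triangle_ineq4 [of r "r - b"] by simp
    moreover have "norm (r - \<tau> c) \<le> norm (r - b) + norm (b - \<tau> c)"
      using norm_triangle_ineq [of "r - b" "b - \<tau> c"] by simp
    ultimately have "norm c \<le> 2 * norm r" "norm (r - \<tau> c) \<le> norm r / 2"
      using c(2,3) br norm_ge_zero [of r] by linarith+
    with c(1) show ?thesis by blast
  qed
  define g where "g r = (SOME c. c \<in> A \<and> norm c \<le> 2 * norm r \<and> norm (r - \<tau> c) \<le> norm r / 2)" for r
  have g: "g r \<in> A" "norm (g r) \<le> 2 * norm r" "norm (r - \<tau> (g r)) \<le> norm r / 2" if "r \<in> ?C" for r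
    using someI_ex [OF step [OF that, unfolded Bex_def]] by (simp_all add: g_def)
  have diffR: "p - q \<in> \<tau> ` A" if "p \<in> \<tau> ` A" "q \<in> \<tau> ` A" for p q
    using that diff subspace_diff [OF A(1)] by (auto simp flip: diff)
  have "?C \<subseteq> \<tau> ` A"
  proof
    fix b assume b: "b \<in> ?C"
    define r where "r = rec_nat b (\<lambda>_ r. r - \<tau> (g r))"
    have r0: "r 0 = b" and rS: "r (Suc n) = r n - \<tau> (g (r n))" for n
      by (simp_all add: r_def)
    have rC: "r n \<in> ?C" for n
    proof (induction n)
      case (Suc n)
      have "\<tau> (g (r n)) \<in> ?C"
        by (intro subsetD [OF closure_subset] imageI g(1) Suc)
      then show ?case unfolding rS by (intro closure_diff [OF diffR] Suc)
    qed (simp add: r0 b)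
    have rn: "norm (r n) \<le> norm b * (1/2)^n" for n
    proof (induction n)
      case (Suc n)
      then show ?case using g(3) [OF rC, of n] by (simp add: rS)
    qed (simp add: r0)
    define c where "c n = g (r n)" for n
    have cA: "c n \<in> A" for n using g(1) [OF rC] by (simp add: c_def)
    have "norm (c n) \<le> 2 * norm b * (1/2)^n" for n
      using g(2) [OF rC, of n] rn [of n] by (simp add: c_def)
    moreover have "summable (\<lambda>n. 2 * norm b * (1/2::real)^n)"
      by (intro summable_mult summable_geometric) simp
    ultimately have "summable c" by (rule summable_comparison_test' [rotated])
    then have lim: "(\<lambda>n. \<Sum>k<n. c k) \<longlonglongrightarrow> suminf c" by (rule summable_LIMSEQ)
    have pA: "(\<Sum>k<n. c k) \<in> A" for n by (intro subspace_sum A cA)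
    have sA: "suminf c \<in> A"
      using A(2) pA lim by (rule closed_sequentially)
    have add: "\<tau> (x + y) = \<tau> x + \<tau> y" if "x \<in> A" "y \<in> A" for x y
      using diff [of "x + y" y] that subspace_add [OF A(1)] by simp
    have \<tau>p: "\<tau> (\<Sum>k<n. c k) = b - r n" for n
    proof (induction n)
      case (Suc n)
      have "\<tau> (\<Sum>k<Suc n. c k) = \<tau> (\<Sum>k<n. c k) + \<tau> (c n)"
        using add [OF pA cA] by simp
      then show ?case using Suc by (simp add: rS flip: c_def)
    qed (simp add: r0 \<tau>0)
    have "(\<lambda>n. norm b * (1/2)^n) \<longlonglongrightarrow> norm b * 0"
      by (intro tendsto_intros LIMSEQ_power_zero) simp
    then have "r \<longlonglongrightarrow> 0"
      by (intro Lim_null_comparison [of r]) (use rn in auto)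
    then have l1: "(\<lambda>n. \<tau> (\<Sum>k<n. c k)) \<longlonglongrightarrow> b - 0"
      unfolding \<tau>p by (intro tendsto_diff tendsto_const)
    have "dist (\<tau> (\<Sum>k<n. c k)) (\<tau> (suminf c)) \<le> dist (\<Sum>k<n. c k) (suminf c)" for n
      using contr [of "(\<Sum>k<n. c k) - suminf c"] subspace_diff [OF A(1) pA sA]
      by (simp add: dist_norm diff pA sA)
    then have l2: "(\<lambda>n. \<tau> (\<Sum>k<n. c k)) \<longlonglongrightarrow> \<tau> (suminf c)"
      by (intro metric_tendsto_imp_tendsto [OF lim] always_eventually) simp
    have "b = \<tau> (suminf c)"
      using LIMSEQ_unique [OF l1 l2] by simp
    with sA show "b \<in> \<tau> ` A" by blast
  qed
  then show ?thesis by (simp add: closure_subset_eq)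
qed

text \<open>
  With \<open>u = c v\<close> the equation gives $\|u\|^2 + \frac14 \|a^* u\|^2 = \langle a v, u \rangle \le
  \|v\| \|a^* u\|$, and $t \|v\| - \frac14 t^2 \le \|v\|^2$ for every \<open>t\<close>.
\<close>

lemma bounded_resolvent:
  fixes a c :: "'a :: chilbert_space \<Rightarrow>\<^sub>L 'a"
  assumes a: "a \<in> bounded_ops"
    and c: "c + (1/4) *\<^sub>R (a o\<^sub>L (hilbert_adjoint a o\<^sub>L c)) = a"
  shows "norm c \<le> 1"
proof (rule norm_blinfun_bound)
  fix v
  define u where "u = blinfun_apply c v"
  define t where "t = norm (blinfun_apply (hilbert_adjoint a) u)"
  have "blinfun_apply a v = blinfun_apply (c + (1/4) *\<^sub>R (a o\<^sub>L (hilbert_adjoint a o\<^sub>L c))) v"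
    by (simp only: c)
  then have "blinfun_apply a v = u + (1/4) *\<^sub>R blinfun_apply a (blinfun_apply (hilbert_adjoint a) u)"
    by (simp add: blinfun.add_left blinfun.scaleR_left u_def)
  then have "cinner (blinfun_apply a v) u = cinner u u + (1/4) * complex_of_real (t\<^sup>2)"
    using cinner_adjoint [OF a, of "blinfun_apply (hilbert_adjoint a) u" u]
    by (simp add: cinner_add_left cinner_scaleR_left cinner_self t_def)
  then have "Re (cinner (blinfun_apply a v) u) = (norm u)\<^sup>2 + t\<^sup>2 / 4"
    by (simp add: cinner_self)
  moreover have "Re (cinner (blinfun_apply a v) u) \<le> norm v * t"
    unfolding cinner_adjoint [OF a] t_def inner_eq_Re_cinner [symmetric] by (rule norm_cauchy_schwarz)
  moreover have "0 \<le> (norm v - t / 2)\<^sup>2" by simp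
  then have "norm v * t \<le> (norm v)\<^sup>2 + t\<^sup>2 / 4" by (simp add: power2_diff power_divide)
  ultimately have "(norm u)\<^sup>2 \<le> (norm v)\<^sup>2" by linarith
  then show "norm (blinfun_apply c v) \<le> 1 * norm v"
    by (simp add: u_def)
qed simp

text \<open>
  One step of size \<open>l\<close> of the iteration that solves $c + \frac14 a a^* c = a$ acts on differences as
  $(1 - l) - \frac{l}{4} a a^*$. For small \<open>l\<close> the quadratic term in the norm square of this operator
  is absorbed by the mixed term, which leaves the factor \<open>1 - l\<close>.
\<close>

lemma norm_resolvent_step:
  fixes a :: "'a :: chilbert_space \<Rightarrow>\<^sub>L 'a"
  assumes a: "a \<in> bounded_ops" and l: "0 \<le> l" "l \<le> 1" "l * (norm a)\<^sup>2 / 4 \<le> 2 * (1 - l)"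
  shows "norm (d - l *\<^sub>R (d + (1/4) *\<^sub>R (a o\<^sub>L (hilbert_adjoint a o\<^sub>L d)))) \<le> (1 - l) * norm d"
proof (rule norm_blinfun_bound)
  fix x
  define v where "v = blinfun_apply d x"
  define w where "w = blinfun_apply (hilbert_adjoint a) v"
  define y where "y = blinfun_apply a w"
  have "inner y v = (norm w)\<^sup>2"
    by (simp add: y_def inner_eq_Re_cinner cinner_adjoint [OF a] cinner_self flip: w_def)
  have "norm y \<le> norm a * norm w" unfolding y_def by (rule norm_blinfun)
  then have "(norm y)\<^sup>2 \<le> (norm a)\<^sup>2 * (norm w)\<^sup>2"
    by (metis norm_ge_zero power_mono power_mult_distrib)
  have expand: "(norm (p *\<^sub>R v - q *\<^sub>R y))\<^sup>2
      = p\<^sup>2 * (norm v)\<^sup>2 - 2 * q * p * inner y v + q\<^sup>2 * (norm y)\<^sup>2" for p q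
    unfolding power2_norm_eq_inner
    by (simp add: inner_diff_left inner_diff_right inner_commute [of v y] power2_eq_square algebra_simps)
  have "(norm ((1 - l) *\<^sub>R v - (l / 4) *\<^sub>R y))\<^sup>2
      = (1 - l)\<^sup>2 * (norm v)\<^sup>2 - (l / 2) * (1 - l) * inner y v + (l / 4)\<^sup>2 * (norm y)\<^sup>2"
    using expand [of "1 - l" "l / 4"] by simp
  also have "\<dots> \<le> (1 - l)\<^sup>2 * (norm v)\<^sup>2 - (l / 2) * (1 - l) * (norm w)\<^sup>2
      + (l / 4)\<^sup>2 * ((norm a)\<^sup>2 * (norm w)\<^sup>2)"
    using \<open>inner y v = _\<close> \<open>(norm y)\<^sup>2 \<le> _\<close> by (simp add: mult_left_mono)
  also have "\<dots> = (1 - l)\<^sup>2 * (norm v)\<^sup>2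
      - (l / 4) * (norm w)\<^sup>2 * (2 * (1 - l) - l * (norm a)\<^sup>2 / 4)"
    by (simp add: field_simps power2_eq_square)
  also have "\<dots> \<le> ((1 - l) * norm v)\<^sup>2"
    using l by (simp add: power_mult_distrib)
  finally have "norm ((1 - l) *\<^sub>R v - (l / 4) *\<^sub>R y) \<le> (1 - l) * norm v"
    by (rule power2_le_imp_le) (use l in simp)
  also have "(1 - l) * norm v \<le> (1 - l) * (norm d * norm x)"
    unfolding v_def using l by (intro mult_left_mono norm_blinfun) simp
  finally show "norm (blinfun_apply (d - l *\<^sub>R (d + (1/4) *\<^sub>R (a o\<^sub>L (hilbert_adjoint a o\<^sub>L d)))) x)
      \<le> (1 - l) * norm d * norm x"
    by (simp add: blinfun.diff_left blinfun.add_left blinfun.scaleR_left v_def w_def y_def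
        scaleR_add_right scaleR_diff_left algebra_simps)
qed (use l in simp)

lemma cstar_subalgebra_scaleR: "cstar_subalgebra A \<Longrightarrow> T \<in> A \<Longrightarrow> r *\<^sub>R T \<in> A"
  by (metis cstar_subalgebraD(4) scaleC_op_of_real)

text \<open>
  The solution is $(1 + \frac14 a a^*)^{-1} a$. Obtaining it as a fixed point of a self-map of \<open>A\<close>
  shows that it lies in \<open>A\<close> even if \<open>A\<close> has no unit.
\<close>

lemma resolvent_in_cstar_subalgebra:
  fixes a :: "'a :: chilbert_space \<Rightarrow>\<^sub>L 'a"
  assumes A: "cstar_subalgebra A" and a: "a \<in> A"
  obtains c where "c \<in> A" "c + (1/4) *\<^sub>R (a o\<^sub>L (hilbert_adjoint a o\<^sub>L c)) = a"
proof -
  define M where "M = (norm a)\<^sup>2 / 4"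
  have M: "M \<ge> 0" by (simp add: M_def)
  \<comment> \<open>then \<open>l M = 1 - l\<close>, more than \<open>norm_resolvent_step\<close> asks for\<close>
  define l where "l = 1 / (1 + M)"
  have l: "0 < l" "l \<le> 1" using M by (simp_all add: l_def)
  have "l * M = 1 - l" using M by (simp add: l_def field_simps)
  then have lM: "l * (norm a)\<^sup>2 / 4 \<le> 2 * (1 - l)"
    using l by (simp add: M_def)
  have ab: "a \<in> bounded_ops" using cstar_subalgebraD(1) [OF A] a by (rule subsetD)
  define q where "q c = a o\<^sub>L (hilbert_adjoint a o\<^sub>L c)" for c :: "'a \<Rightarrow>\<^sub>L 'a"
  have q_diff: "q (c - d) = q c - q d" for c d
    by (rule blinfun_eqI) (simp add: q_def blinfun.diff_left blinfun.diff_right)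
  define \<Phi> where "\<Phi> c = c - l *\<^sub>R (c + (1/4) *\<^sub>R q c - a)" for c
  have sub: "subspace A" by (rule cstar_subalgebra_subspace [OF A])
  have qA: "q c \<in> A" if "c \<in> A" for c
    unfolding q_def by (intro cstar_subalgebraD(5,7) [OF A] a that)
  have "\<exists>!c\<in>A. \<Phi> c = c"
  proof (rule Banach_fix [where c = "1 - l"])
    show "complete A" by (simp add: complete_eq_closed cstar_subalgebraD(6) [OF A])
    show "\<Phi> ` A \<subseteq> A"
      unfolding \<Phi>_def
      by (intro image_subsetI subspace_diff [OF sub] subspace_add [OF sub] subspace_scale [OF sub] qA a)
    show "dist (\<Phi> c) (\<Phi> d) \<le> (1 - l) * dist c d" for c d
    proof -
      have "\<Phi> c - \<Phi> d = (c - d) - l *\<^sub>R ((c - d) + (1/4) *\<^sub>R q (c - d))"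
        by (simp add: \<Phi>_def q_diff algebra_simps)
      then show ?thesis
        using norm_resolvent_step [OF ab _ l(2) lM, of "c - d"] l by (simp add: dist_norm q_def)
    qed
  qed (use a l in auto)
  then obtain c where "c \<in> A" "\<Phi> c = c" by (elim ex1E conjE)
  then have "l *\<^sub>R (c + (1/4) *\<^sub>R q c - a) = 0" by (simp add: \<Phi>_def)
  then have "c + (1/4) *\<^sub>R q c = a" using l by simp
  with \<open>c \<in> A\<close> show thesis by (intro that) (simp_all add: q_def)
qed

lemma star_homD:
  assumes "star_hom A B \<tau>"
  shows "T \<in> A \<Longrightarrow> \<tau> T \<in> B" "S \<in> A \<Longrightarrow> T \<in> A \<Longrightarrow> \<tau> (S + T) = \<tau> S + \<tau> T"
    "T \<in> A \<Longrightarrow> \<tau> (scaleC_op c T) = scaleC_op c (\<tau> T)"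
    "S \<in> A \<Longrightarrow> T \<in> A \<Longrightarrow> \<tau> (S o\<^sub>L T) = \<tau> S o\<^sub>L \<tau> T"
    "T \<in> A \<Longrightarrow> \<tau> (hilbert_adjoint T) = hilbert_adjoint (\<tau> T)"
    "T \<in> A \<Longrightarrow> \<tau> (r *\<^sub>R T) = r *\<^sub>R \<tau> T"
  using assms unfolding star_hom_def by (auto simp flip: scaleC_op_of_real)

lemma star_hom_diff:
  assumes A: "cstar_subalgebra A" and \<tau>: "star_hom A B \<tau>" and "S \<in> A" "T \<in> A"
  shows "\<tau> (S - T) = \<tau> S - \<tau> T"
proof -
  have "\<tau> (S + (-1) *\<^sub>R T) = \<tau> S + (-1) *\<^sub>R \<tau> T"
    using star_homD(2,6) [OF \<tau>] assms(3,4) cstar_subalgebra_scaleR [OF A] by metis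
  then show ?thesis by simp
qed

text \<open>
  The lift of a nonzero \<open>b = \<tau> a\<close> is \<open>\<parallel>b\<parallel> c\<close>, where \<open>c\<close> is the resolvent solution for \<open>a\<close> scaled by
  \<open>1 / \<parallel>b\<parallel>\<close>. A homomorphism preserves the equation of \<open>c\<close>, so \<open>bounded_resolvent\<close> bounds both \<open>c\<close> and
  \<open>\<tau> c\<close>, whatever the norm of \<open>a\<close>.
\<close>

proposition closed_image_star_hom:
  fixes \<tau> :: "('a :: chilbert_space \<Rightarrow>\<^sub>L 'a) \<Rightarrow> ('b :: chilbert_space \<Rightarrow>\<^sub>L 'b)"
  assumes A: "cstar_subalgebra A" and \<tau>: "star_hom A bounded_ops \<tau>"
    and contr: "\<And>T. T \<in> A \<Longrightarrow> norm (\<tau> T) \<le> norm T"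
  shows "closed (\<tau> ` A)"
proof (rule closed_image_of_approximate_lifts [OF cstar_subalgebra_subspace [OF A] cstar_subalgebraD(6) [OF A]
      star_hom_diff [OF A \<tau>] contr])
  fix b assume "b \<in> \<tau> ` A"
  then obtain a where a: "a \<in> A" "b = \<tau> a" by (rule imageE)
  show "\<exists>c\<in>A. norm c \<le> norm b \<and> norm (b - \<tau> c) \<le> norm b / 4"
  proof (cases "b = 0")
    case True
    have "\<tau> 0 = 0" using star_hom_diff [OF A \<tau> a(1) a(1)] by simp
    with True show ?thesis
      by (intro bexI [of _ 0] cstar_subalgebraD(2) [OF A]) simp
  next
    case False
    define s where "s = norm b"
    have s: "s > 0" using False by (simp add: s_def)
    define a1 where "a1 = (1 / s) *\<^sub>R a"
    have a1: "a1 \<in> A" unfolding a1_def by (rule cstar_subalgebra_scaleR [OF A a(1)])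
    have a1b: "a1 \<in> bounded_ops" using cstar_subalgebraD(1) [OF A] a1 by (rule subsetD)
    have \<tau>a1: "\<tau> a1 = (1 / s) *\<^sub>R b" unfolding a1_def a(2) by (rule star_homD(6) [OF \<tau> a(1)])
    have norm_b1: "norm (\<tau> a1) = 1" using s by (simp add: \<tau>a1 s_def)
    obtain c where c: "c \<in> A" "c + (1/4) *\<^sub>R (a1 o\<^sub>L (hilbert_adjoint a1 o\<^sub>L c)) = a1"
      by (rule resolvent_in_cstar_subalgebra [OF A a1])
    define x where "x = \<tau> a1 o\<^sub>L (hilbert_adjoint (\<tau> a1) o\<^sub>L \<tau> c)"
    have adj: "hilbert_adjoint a1 o\<^sub>L c \<in> A"
      by (intro cstar_subalgebraD(5,7) [OF A] a1 c(1))
    have prod: "a1 o\<^sub>L (hilbert_adjoint a1 o\<^sub>L c) \<in> A" by (intro cstar_subalgebraD(5) [OF A] a1 adj)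
    have "\<tau> a1 = \<tau> (c + (1/4) *\<^sub>R (a1 o\<^sub>L (hilbert_adjoint a1 o\<^sub>L c)))" by (simp only: c(2))
    also have "\<dots> = \<tau> c + (1/4) *\<^sub>R x"
      unfolding x_def star_homD(2) [OF \<tau> c(1) cstar_subalgebra_scaleR [OF A prod]]
        star_homD(6) [OF \<tau> prod] star_homD(4) [OF \<tau> a1 adj]
        star_homD(4) [OF \<tau> cstar_subalgebraD(7) [OF A a1] c(1)] star_homD(5) [OF \<tau> a1] ..
    finally have eq: "\<tau> c + (1/4) *\<^sub>R x = \<tau> a1" by simp
    have \<tau>a1b: "\<tau> a1 \<in> bounded_ops" by (rule star_homD(1) [OF \<tau> a1])
    have c1: "norm c \<le> 1" by (rule bounded_resolvent [OF a1b c(2)])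
    have d1: "norm (\<tau> c) \<le> 1" by (rule bounded_resolvent [OF \<tau>a1b]) (use eq in \<open>simp only: x_def\<close>)
    have "norm x \<le> norm (\<tau> a1) * (norm (hilbert_adjoint (\<tau> a1)) * norm (\<tau> c))"
      unfolding x_def by (meson norm_blinfun_compose mult_left_mono norm_ge_zero order_trans)
    also have "\<dots> \<le> 1 * (1 * 1)"
      using norm_adjoint_le [OF \<tau>a1b] d1 by (intro mult_mono) (simp_all add: norm_b1)
    finally have "norm x \<le> 1" by simp
    moreover have "b - \<tau> (s *\<^sub>R c) = (s / 4) *\<^sub>R x"
    proof -
      have "b = s *\<^sub>R \<tau> a1" using s by (simp add: \<tau>a1)
      then show ?thesis
        unfolding star_homD(6) [OF \<tau> c(1)] eq [symmetric] by (simp add: scaleR_add_right)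
    qed
    ultimately have "norm (b - \<tau> (s *\<^sub>R c)) \<le> s / 4"
      using s by (simp add: mult_left_le)
    moreover have "norm (s *\<^sub>R c) \<le> s" using s c1 by (simp add: mult_left_le)
    ultimately show ?thesis
      unfolding s_def [symmetric] by (intro bexI [of _ "s *\<^sub>R c"] conjI cstar_subalgebra_scaleR [OF A c(1)])
  qed
qed

section \<open>Orthonormal families and amplification\<close>

definition orthonormal :: "'i set \<Rightarrow> ('i \<Rightarrow> 'a :: complex_inner) \<Rightarrow> bool" where
  "orthonormal I b \<longleftrightarrow> (\<forall>i\<in>I. \<forall>j\<in>I. cinner (b i) (b j) = (if i = j then 1 else 0))"

lemma orthonormalD: "orthonormal I b \<Longrightarrow> i \<in> I \<Longrightarrow> j \<in> I \<Longrightarrow> cinner (b i) (b j) = (if i = j then 1 else 0)"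
  by (simp add: orthonormal_def)

lemma orthonormal_subset: "orthonormal I b \<Longrightarrow> J \<subseteq> I \<Longrightarrow> orthonormal J b"
  unfolding orthonormal_def by (meson subsetD)

lemma norm_sum_orthonormal:
  assumes "finite W" "orthonormal W b"
  shows "(norm (\<Sum>w\<in>W. c w *\<^sub>C b w))\<^sup>2 = (\<Sum>w\<in>W. (cmod (c w))\<^sup>2)"
proof -
  have "complex_of_real ((norm (\<Sum>w\<in>W. c w *\<^sub>C b w))\<^sup>2)
      = (\<Sum>w\<in>W. \<Sum>v\<in>W. c w * (cnj (c v) * cinner (b w) (b v)))"
    unfolding cinner_self [symmetric]
    by (subst sum.swap)
      (simp add: cinner.sum_left cinner.sum_right cinner_scaleC_left cinner_scaleC_right sum_distrib_left
        mult.left_commute)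
  also have "\<dots> = (\<Sum>w\<in>W. \<Sum>v\<in>W. if v = w then c w * cnj (c v) else 0)"
    by (intro sum.cong refl) (auto simp: orthonormalD [OF assms(2)])
  also have "\<dots> = (\<Sum>w\<in>W. c w * cnj (c w))"
    using assms(1) by simp
  also have "\<dots> = complex_of_real (\<Sum>w\<in>W. (cmod (c w))\<^sup>2)"
    by (simp only: complex_norm_square of_real_sum)
  finally show ?thesis
    by (simp only: of_real_eq_iff)
qed

text \<open>
  Gram-Schmidt: an additional vector either lies in the span already reached or contributes its
  normalised component orthogonal to it.
\<close>

lemma finite_orthonormal_expansion:
  fixes X :: "'a :: complex_inner set"
  assumes "finite X"
  shows "\<exists>B. finite B \<and> orthonormal B (\<lambda>b. b) \<and> (\<forall>x\<in>X. x = (\<Sum>b\<in>B. cinner x b *\<^sub>C b))"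
  using assms
proof (induction X)
  case empty
  then show ?case by (intro exI [of _ "{}"]) (simp add: orthonormal_def)
next
  case (insert y X)
  then obtain B where B: "finite B" "orthonormal B (\<lambda>b. b)"
    and X: "\<And>x. x \<in> X \<Longrightarrow> x = (\<Sum>b\<in>B. cinner x b *\<^sub>C b)" by blast
  define z where "z = y - (\<Sum>b\<in>B. cinner y b *\<^sub>C b)"
  have zB: "cinner z b = 0" if "b \<in> B" for b
  proof -
    have "(\<Sum>c\<in>B. cinner y c * cinner c b) = (\<Sum>c\<in>B. if c = b then cinner y c else 0)"
      using that by (intro sum.cong refl) (auto simp: orthonormalD [OF B(2)])
    also have "\<dots> = cinner y b" using that B(1) by simp
    finally show ?thesis
      by (simp add: z_def cinner.diff_left cinner.sum_left cinner_scaleC_left)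
  qed
  show ?case
  proof (cases "z = 0")
    case True
    with B X show ?thesis by (intro exI [of _ B]) (auto simp: z_def)
  next
    case False
    define e where "e = (1 / norm z) *\<^sub>R z"
    have eB: "cinner e b = 0" "cinner b e = 0" if "b \<in> B" for b
      using zB [OF that] cinner_commute [of b z]
      by (simp_all add: e_def cinner_scaleR_left cinner_scaleR_right)
    have ee: "cinner e e = 1"
      using False by (simp add: e_def cinner_scaleR_left cinner_scaleR_right cinner_self power2_eq_square)
    have enB: "e \<notin> B" using eB(1) [of e] ee by auto
    have xe: "cinner x e = 0" if "x = (\<Sum>b\<in>B. cinner x b *\<^sub>C b)" for x
      by (subst that) (simp add: cinner.sum_left cinner_scaleC_left eB)
    have "y = (\<Sum>b\<in>insert e B. cinner y b *\<^sub>C b)"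
    proof -
      have "cinner y e = cinner z e"
        by (simp add: z_def cinner.diff_left cinner.sum_left cinner_scaleC_left eB)
      then have "cinner y e = complex_of_real (norm z)"
        using False by (simp add: e_def cinner_scaleR_right cinner_self power2_eq_square)
      then have "cinner y e *\<^sub>C e = z"
        using False by (simp add: e_def flip: scaleR_scaleC)
      then show ?thesis using B(1) enB by (simp add: z_def)
    qed
    moreover have "orthonormal (insert e B) (\<lambda>b. b)"
      unfolding orthonormal_def using eB ee orthonormalD [OF B(2)] enB by auto
    moreover have "x = (\<Sum>b\<in>insert e B. cinner x b *\<^sub>C b)" if "x \<in> X" for x
      using X [OF that] xe [OF X [OF that]] B(1) enB by simp
    ultimately show ?thesis using B(1) by (intro exI [of _ "insert e B"]) auto
  qed
qed

text \<open>
  This is $\|T \otimes 1\| \le \|T\|$ for the matrix of \<open>T\<close> acting on \<open>'h\<close>-valued functions on \<open>W\<close>.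
  Coordinates of all values of \<open>f\<close> and \<open>g\<close> in one finite orthonormal set split the double sum into
  matrix coefficients of \<open>T\<close> itself.
\<close>

proposition amplification_bound:
  fixes T :: "'k :: complex_inner \<Rightarrow>\<^sub>L 'k" and f g :: "'i \<Rightarrow> 'h :: complex_inner"
  assumes T: "T \<in> bounded_ops" and W: "finite W" "orthonormal W \<xi>"
  shows "cmod (\<Sum>v\<in>W. \<Sum>u\<in>W. cinner (blinfun_apply T (\<xi> v)) (\<xi> u) * cinner (f v) (g u))
      \<le> norm T * (sqrt (\<Sum>v\<in>W. (norm (f v))\<^sup>2) * sqrt (\<Sum>u\<in>W. (norm (g u))\<^sup>2))"
proof -
  obtain B where B: "finite B" "orthonormal B (\<lambda>b. b)"
    and exp: "\<And>x. x \<in> f ` W \<union> g ` W \<Longrightarrow> x = (\<Sum>b\<in>B. cinner x b *\<^sub>C b)"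
    using finite_orthonormal_expansion [of "f ` W \<union> g ` W"] W(1) by auto
  define F where "F b = (\<Sum>v\<in>W. cinner (f v) b *\<^sub>C \<xi> v)" for b
  define G where "G b = (\<Sum>v\<in>W. cinner (g v) b *\<^sub>C \<xi> v)" for b
  have sum_norm: "(\<Sum>b\<in>B. (norm (\<Sum>v\<in>W. cinner (h v) b *\<^sub>C \<xi> v))\<^sup>2) = (\<Sum>v\<in>W. (norm (h v))\<^sup>2)"
    if "\<And>v. v \<in> W \<Longrightarrow> h v = (\<Sum>b\<in>B. cinner (h v) b *\<^sub>C b)" for h :: "'i \<Rightarrow> 'h"
  proof -
    have "(\<Sum>b\<in>B. (norm (\<Sum>v\<in>W. cinner (h v) b *\<^sub>C \<xi> v))\<^sup>2) = (\<Sum>b\<in>B. \<Sum>v\<in>W. (cmod (cinner (h v) b))\<^sup>2)"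
      by (simp add: norm_sum_orthonormal [OF W])
    also have "\<dots> = (\<Sum>v\<in>W. \<Sum>b\<in>B. (cmod (cinner (h v) b))\<^sup>2)" by (rule sum.swap)
    also have "\<dots> = (\<Sum>v\<in>W. (norm (\<Sum>b\<in>B. cinner (h v) b *\<^sub>C b))\<^sup>2)"
      by (simp add: norm_sum_orthonormal [OF B])
    also have "\<dots> = (\<Sum>v\<in>W. (norm (h v))\<^sup>2)"
      by (intro sum.cong refl) (simp flip: that)
    finally show ?thesis .
  qed
  have inner_exp: "cinner (f v) (g u) = (\<Sum>b\<in>B. cinner (f v) b * cnj (cinner (g u) b))"
    if "v \<in> W" for u v
  proof -
    have "cinner (f v) (g u) = cinner (\<Sum>b\<in>B. cinner (f v) b *\<^sub>C b) (g u)"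
      using that by (simp flip: exp)
    also have "\<dots> = (\<Sum>b\<in>B. cinner (f v) b * cinner b (g u))"
      by (simp add: cinner.sum_left cinner_scaleC_left)
    finally show ?thesis by (simp flip: cinner_commute)
  qed
  have "(\<Sum>v\<in>W. \<Sum>u\<in>W. cinner (blinfun_apply T (\<xi> v)) (\<xi> u) * cinner (f v) (g u))
      = (\<Sum>v\<in>W. \<Sum>u\<in>W. \<Sum>b\<in>B. cinner (f v) b * (cnj (cinner (g u) b) * cinner (blinfun_apply T (\<xi> v)) (\<xi> u)))"
    by (intro sum.cong refl) (simp add: inner_exp sum_distrib_left mult_ac)
  also have "\<dots> = (\<Sum>v\<in>W. \<Sum>b\<in>B. \<Sum>u\<in>W. cinner (f v) b * (cnj (cinner (g u) b) * cinner (blinfun_apply T (\<xi> v)) (\<xi> u)))"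
    by (intro sum.cong refl) (rule sum.swap)
  also have "\<dots> = (\<Sum>b\<in>B. \<Sum>v\<in>W. \<Sum>u\<in>W. cinner (f v) b * (cnj (cinner (g u) b) * cinner (blinfun_apply T (\<xi> v)) (\<xi> u)))"
    by (rule sum.swap)
  also have "\<dots> = (\<Sum>b\<in>B. \<Sum>u\<in>W. \<Sum>v\<in>W. cinner (f v) b * (cnj (cinner (g u) b) * cinner (blinfun_apply T (\<xi> v)) (\<xi> u)))"
    by (rule sum.cong [OF refl]) (rule sum.swap)
  also have "\<dots> = (\<Sum>b\<in>B. cinner (blinfun_apply T (F b)) (G b))"
    by (simp add: F_def G_def blinfun.sum_right bounded_ops_scaleC [OF T] cinner.sum_left cinner.sum_right
        cinner_scaleC_left cinner_scaleC_right sum_distrib_left mult.left_commute)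
  finally have "cmod (\<Sum>v\<in>W. \<Sum>u\<in>W. cinner (blinfun_apply T (\<xi> v)) (\<xi> u) * cinner (f v) (g u))
      = cmod (\<Sum>b\<in>B. cinner (blinfun_apply T (F b)) (G b))" by simp
  also have "\<dots> \<le> (\<Sum>b\<in>B. norm T * (\<bar>norm (F b)\<bar> * \<bar>norm (G b)\<bar>))"
  proof (rule sum_norm_le)
    fix b
    have "cmod (cinner (blinfun_apply T (F b)) (G b)) \<le> norm (blinfun_apply T (F b)) * norm (G b)"
      by (rule Cauchy_Schwarz_cinner)
    also have "\<dots> \<le> norm T * norm (F b) * norm (G b)"
      by (intro mult_right_mono norm_blinfun) simp
    finally show "cmod (cinner (blinfun_apply T (F b)) (G b)) \<le> norm T * (\<bar>norm (F b)\<bar> * \<bar>norm (G b)\<bar>)"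
      by (simp add: mult.assoc)
  qed
  also have "\<dots> \<le> norm T * (L2_set (\<lambda>b. norm (F b)) B * L2_set (\<lambda>b. norm (G b)) B)"
    unfolding sum_distrib_left [symmetric] by (intro mult_left_mono L2_set_mult_ineq) simp
  also have "\<dots> = norm T * (sqrt (\<Sum>v\<in>W. (norm (f v))\<^sup>2) * sqrt (\<Sum>u\<in>W. (norm (g u))\<^sup>2))"
    unfolding L2_set_def F_def G_def using exp by (subst (1 2) sum_norm) auto
  finally show ?thesis .
qed

section \<open>Operators given by their values on an orthonormal basis\<close>

lemma orthonormal_basis_orthonormal: "orthonormal_basis I b \<Longrightarrow> orthonormal I b"
  by (simp add: orthonormal_basis_def orthonormal_def)

lemma closed_cspan_minimal:
  assumes "M \<subseteq> S" "closed S" "complex_vector.subspace S"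
  shows "closed_cspan M \<subseteq> S"
  unfolding closed_cspan_def
  by (intro closure_minimal complex_vector.span_minimal assms)

lemma closed_cspan_superset: "M \<subseteq> closed_cspan M"
  unfolding closed_cspan_def by (meson closure_subset complex_vector.span_superset order_trans)

lemma closed_closed_cspan: "closed (closed_cspan M)"
  by (simp add: closed_cspan_def)

lemma subspace_closed_cspan: "complex_vector.subspace (closed_cspan M)"
  unfolding complex_vector.subspace_def
proof (intro conjI ballI allI)
  let ?S = "complex_vector.span M"
  show "0 \<in> closed_cspan M"
    unfolding closed_cspan_def using complex_vector.span_zero closure_subset by (rule subsetD [rotated])
next
  fix x y assume "x \<in> closed_cspan M" "y \<in> closed_cspan M"
  then obtain f g where "\<forall>n. f n \<in> complex_vector.span M" "f \<longlonglongrightarrow> x" "\<forall>n. g n \<in> complex_vector.span M" "g \<longlonglongrightarrow> y"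
    unfolding closed_cspan_def by (meson closure_sequential)
  then show "x + y \<in> closed_cspan M"
    unfolding closed_cspan_def closure_sequential
    by (intro exI [of _ "\<lambda>n. f n + g n"] conjI allI complex_vector.span_add tendsto_add) simp_all
next
  fix c x assume "x \<in> closed_cspan M"
  then obtain f where "\<forall>n. f n \<in> complex_vector.span M" "f \<longlonglongrightarrow> x"
    unfolding closed_cspan_def by (meson closure_sequential)
  then show "c *\<^sub>C x \<in> closed_cspan M"
    unfolding closed_cspan_def closure_sequential
    by (intro exI [of _ "\<lambda>n. c *\<^sub>C f n"] conjI allI complex_vector.span_scale
        bounded_linear.tendsto [OF bounded_linear_scaleC]) simp_all
qed

text \<open>
  The induction principle of an orthonormal basis: a closed subspace that contains the basis is
  everything.
\<close>

lemma orthonormal_basis_minimal: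
  assumes "orthonormal_basis I \<xi>" "\<xi> ` I \<subseteq> S" "closed S" "complex_vector.subspace S"
  shows "x \<in> S"
  using closed_cspan_minimal [OF assms(2-4)] assms(1) by (auto simp: orthonormal_basis_def)

lemma orthonormal_basis_operator_eqI:
  assumes onb: "orthonormal_basis I \<xi>" and S: "S \<in> bounded_ops" and T: "T \<in> bounded_ops"
    and eq: "\<And>w. w \<in> I \<Longrightarrow> blinfun_apply S (\<xi> w) = blinfun_apply T (\<xi> w)"
  shows "S = T"
proof (rule blinfun_eqI)
  fix x
  have "closed {x. blinfun_apply S x = blinfun_apply T x}"
    by (intro closed_Collect_eq continuous_intros)
  then have "x \<in> {x. blinfun_apply S x = blinfun_apply T x}"
    by (rule orthonormal_basis_minimal [OF onb, rotated])
      (auto simp: eq complex_vector.subspace_def blinfun.add_right bounded_ops_scaleC [OF S] bounded_ops_scaleC [OF T])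
  then show "blinfun_apply S x = blinfun_apply T x" by simp
qed

lemma orthonormal_basis_vector_eqI:
  assumes onb: "orthonormal_basis I \<xi>"
    and eq: "\<And>w. w \<in> I \<Longrightarrow> cinner (\<xi> w) x = cinner (\<xi> w) y"
  shows "x = y"
proof (rule cinner_ext)
  fix z
  have "closed {z. cinner z x = cinner z y}"
    by (intro closed_Collect_eq cinner.continuous_on continuous_intros)
  then have "z \<in> {z. cinner z x = cinner z y}"
    by (rule orthonormal_basis_minimal [OF onb, rotated])
      (auto simp: eq complex_vector.subspace_def cinner_add_left cinner_scaleC_left cinner.zero_left)
  then show "cinner z x = cinner z y" by simp
qed

text \<open>
  On finite linear combinations the prescribed values do not increase the norm, since the images that
  survive are again orthonormal; the graph extends to the closure.
\<close>

proposition basis_operator_exists: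
  fixes \<xi> :: "'i \<Rightarrow> 'a :: chilbert_space"
  assumes onb: "orthonormal_basis I \<xi>" and f: "inj_on f J" "f ` J \<subseteq> I"
  shows "\<exists>T\<in>bounded_ops. \<forall>w\<in>I. blinfun_apply T (\<xi> w) = (if w \<in> J then \<xi> (f w) else 0)"
proof -
  note on = orthonormal_basis_orthonormal [OF onb]
  define \<eta> where "\<eta> w = (if w \<in> J then \<xi> (f w) else 0)" for w
  define lc where "lc F c \<zeta> = (\<Sum>w\<in>F. c w *\<^sub>C \<zeta> w)" for F c and \<zeta> :: "'i \<Rightarrow> 'a"
  define R where "R = {(lc F c \<xi>, lc F c \<eta>) | F c. finite F \<and> F \<subseteq> I}"
  have RI: "(lc F c \<xi>, lc F c \<eta>) \<in> R" if "finite F" "F \<subseteq> I" for F c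
    using that by (auto simp: R_def)
  have RE: "\<exists>F c. finite F \<and> F \<subseteq> I \<and> a = lc F c \<xi> \<and> b = lc F c \<eta>" if "(a, b) \<in> R" for a b
  proof -
    from that obtain F c where "finite F" "F \<subseteq> I" "(a, b) = (lc F c \<xi>, lc F c \<eta>)"
      unfolding R_def by (elim CollectE exE conjE)
    then show ?thesis by (intro exI [of _ F] exI [of _ c]) simp
  qed
  have bound: "norm b \<le> norm a" if "(a, b) \<in> R" for a b
  proof -
    from RE [OF that] obtain F c where F: "finite F" "F \<subseteq> I" and ab: "a = lc F c \<xi>" "b = lc F c \<eta>"
      by (elim exE conjE)
    have "b = (\<Sum>w\<in>F \<inter> J. c w *\<^sub>C \<xi> (f w))"
      unfolding ab lc_def \<eta>_def using F(1) by (intro sum.mono_neutral_cong_right) auto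
    moreover have "orthonormal (F \<inter> J) (\<lambda>w. \<xi> (f w))"
      unfolding orthonormal_def using f orthonormalD [OF on] by (auto simp: inj_on_eq_iff image_subset_iff)
    ultimately have "(norm b)\<^sup>2 = (\<Sum>w\<in>F \<inter> J. (cmod (c w))\<^sup>2)"
      using F(1) by (simp add: norm_sum_orthonormal)
    also have "\<dots> \<le> (\<Sum>w\<in>F. (cmod (c w))\<^sup>2)"
      using F(1) by (intro sum_mono2) auto
    also have "\<dots> = (norm a)\<^sup>2"
    proof -
      have "orthonormal F \<xi>" using on F(2) by (rule orthonormal_subset)
      then show ?thesis unfolding ab lc_def by (intro norm_sum_orthonormal [symmetric] F)
    qed
    finally show ?thesis by simp
  qed
  have comb: "(a + k *\<^sub>C a', b + k *\<^sub>C b') \<in> R" if "(a, b) \<in> R" "(a', b') \<in> R" for a b a' b' k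
  proof -
    from RE [OF that(1)] obtain F c where F: "finite F" "F \<subseteq> I" and ab: "a = lc F c \<xi>" "b = lc F c \<eta>"
      by (elim exE conjE)
    from RE [OF that(2)] obtain F' c' where F': "finite F'" "F' \<subseteq> I" and ab': "a' = lc F' c' \<xi>" "b' = lc F' c' \<eta>"
      by (elim exE conjE)
    define d where "d w = (if w \<in> F then c w else 0) + k * (if w \<in> F' then c' w else 0)" for w
    have "lc F c \<zeta> + k *\<^sub>C lc F' c' \<zeta> = lc (F \<union> F') d \<zeta>" for \<zeta>
    proof -
      have "lc F c \<zeta> = lc (F \<union> F') (\<lambda>w. if w \<in> F then c w else 0) \<zeta>"
        unfolding lc_def using F F' by (intro sum.mono_neutral_cong_left) auto
      moreover have "lc F' c' \<zeta> = lc (F \<union> F') (\<lambda>w. if w \<in> F' then c' w else 0) \<zeta>"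
        unfolding lc_def using F F' by (intro sum.mono_neutral_cong_left) auto
      ultimately show ?thesis
        by (simp add: lc_def d_def complex_vector.scale_sum_right scaleC_add_left sum.distrib scaleC_scaleC)
    qed
    then show ?thesis
      unfolding ab ab' using RI [of "F \<union> F'" d] F F' by simp
  qed
  have diff: "p - q \<in> R" if "p \<in> R" "q \<in> R" for p q
    using comb [of "fst p" "snd p" "fst q" "snd q" "-1"] that
    by (simp add: complex_vector.scale_minus_left minus_prod_def)
  have "closure (fst ` R) = UNIV"
  proof -
    have "\<xi> ` I \<subseteq> fst ` R"
    proof
      fix x assume "x \<in> \<xi> ` I"
      then obtain w where "w \<in> I" "x = \<xi> w" by blast
      then show "x \<in> fst ` R"
        using RI [of "{w}" "\<lambda>_. 1"] by (force simp: lc_def)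
    qed
    moreover have "complex_vector.subspace (fst ` R)"
      unfolding complex_vector.subspace_def
    proof (intro conjI ballI allI)
      have zero: "(0, 0) \<in> R" using RI [of "{}" undefined] by (simp add: lc_def)
      then show "0 \<in> fst ` R" by force
      show "x + y \<in> fst ` R" if "x \<in> fst ` R" "y \<in> fst ` R" for x y
        using that comb [where k = 1] by force
      show "c *\<^sub>C x \<in> fst ` R" if "x \<in> fst ` R" for c x
        using that comb [OF zero, where k = c] by force
    qed
    ultimately have "complex_vector.span (\<xi> ` I) \<subseteq> fst ` R"
      by (rule complex_vector.span_minimal)
    then have "closed_cspan (\<xi> ` I) \<subseteq> closure (fst ` R)"
      unfolding closed_cspan_def by (rule closure_mono)
    with onb show ?thesis by (auto simp: orthonormal_basis_def)
  qed
  then have total: "x \<in> closure (fst ` R)" for x by simp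
  have ex: "\<exists>y. (x, y) \<in> closure R" for x
    by (rule contraction_closure_total [of R x, OF bound diff total]) (assumption | rule exI)+
  define t where "t x = (SOME y. (x, y) \<in> closure R)" for x
  have t: "(x, t x) \<in> closure R" for x
    unfolding t_def by (rule someI_ex [OF ex])
  have t_eqI: "t x = y" if "(x, y) \<in> closure R" for x y
    by (rule contraction_closure_unique [of R, OF bound diff t that])
  have t_comb: "t (x + k *\<^sub>C y) = t x + k *\<^sub>C t y" for x y k
    by (intro t_eqI closure_pair_binop [of R "\<lambda>x y. x + k *\<^sub>C y" "\<lambda>x y. x + k *\<^sub>C y", OF comb _ _ t t]
        tendsto_add bounded_linear.tendsto [OF bounded_linear_scaleC]) simp_all
  have t0: "t 0 = 0" using t_comb [of 0 1 0] by simp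
  have bl: "bounded_linear t"
  proof (rule bounded_linear_intro [where K = 1])
    show "t (x + y) = t x + t y" for x y using t_comb [of x 1 y] by simp
    show "t (r *\<^sub>R x) = r *\<^sub>R t x" for r x
      using t_comb [of 0 "complex_of_real r" x] by (simp add: t0 scaleR_scaleC)
    show "norm (t x) \<le> norm x * 1" for x
      using contraction_closure_bound [of R, OF bound t] by simp
  qed
  have "t (\<xi> w) = \<eta> w" if "w \<in> I" for w
    using RI [of "{w}" "\<lambda>_. 1"] that closure_subset [of R] by (intro t_eqI) (auto simp: lc_def)
  moreover have "Blinfun t \<in> bounded_ops"
    using t_comb [of 0] by (simp add: bounded_ops_def bounded_linear_Blinfun_apply [OF bl] t0)
  ultimately show ?thesis
    by (intro bexI [of _ "Blinfun t"]) (simp_all add: bounded_linear_Blinfun_apply [OF bl] \<eta>_def)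
qed

lemma
  fixes \<xi> :: "'i \<Rightarrow> 'a :: chilbert_space"
  assumes onb: "orthonormal_basis I \<xi>" and f: "inj_on f J" "f ` J \<subseteq> I" "J \<subseteq> I"
    and T: "T \<in> bounded_ops"
      "\<And>w. w \<in> I \<Longrightarrow> blinfun_apply T (\<xi> w) = (if w \<in> J then \<xi> (f w) else 0)"
  shows basis_operator_adjoint_image: "w \<in> J \<Longrightarrow> blinfun_apply (hilbert_adjoint T) (\<xi> (f w)) = \<xi> w"
    and basis_operator_adjoint_other:
      "u \<in> I \<Longrightarrow> u \<notin> f ` J \<Longrightarrow> blinfun_apply (hilbert_adjoint T) (\<xi> u) = 0"
proof -
  note on = orthonormalD [OF orthonormal_basis_orthonormal [OF onb]]
  have *: "cinner (\<xi> v) (blinfun_apply (hilbert_adjoint T) (\<xi> u)) = (if v \<in> J \<and> f v = u then 1 else 0)"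
    if "v \<in> I" "u \<in> I" for u v
    using that f by (auto simp: T(2) on cinner.zero_left image_subset_iff simp flip: cinner_adjoint [OF T(1)])
  show "blinfun_apply (hilbert_adjoint T) (\<xi> (f w)) = \<xi> w" if "w \<in> J"
    using that f by (intro orthonormal_basis_vector_eqI [OF onb]) (auto simp: * on inj_on_eq_iff image_subset_iff subset_iff)
  show "blinfun_apply (hilbert_adjoint T) (\<xi> u) = 0" if "u \<in> I" "u \<notin> f ` J"
    using that by (intro orthonormal_basis_vector_eqI [OF onb]) (auto simp: * cinner.zero_right)
qed

text \<open>
  A projection is determined by its range, because each of two projections with the same range
  absorbs the other.
\<close>

lemma proj_onto_range:
  fixes P :: "'a :: chilbert_space \<Rightarrow>\<^sub>L 'a"
  assumes "is_projection P" shows "proj_onto (range (blinfun_apply P)) = P"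
  unfolding proj_onto_def
proof (rule the_equality)
  fix Q assume Q: "is_projection Q \<and> range (blinfun_apply Q) = range (blinfun_apply P)"
  have absorb: "E o\<^sub>L F = F"
    if "is_projection E" "range (blinfun_apply F) \<subseteq> range (blinfun_apply E)" for E F :: "'a \<Rightarrow>\<^sub>L 'a"
  proof (rule blinfun_eqI)
    fix x
    have "blinfun_apply F x \<in> range (blinfun_apply E)"
      using that(2) by (rule subsetD) (rule rangeI)
    then obtain y where "blinfun_apply F x = blinfun_apply E y" by (rule rangeE)
    moreover have "blinfun_apply E (blinfun_apply E y) = blinfun_apply E y"
      using that(1) by (metis is_projection_def blinfun_apply_blinfun_compose)
    ultimately show "blinfun_apply (E o\<^sub>L F) x = blinfun_apply F x" by simp
  qed
  have "Q = hilbert_adjoint (P o\<^sub>L Q)"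
    using absorb [of P Q] assms Q by (simp add: is_projection_def)
  also have "\<dots> = Q o\<^sub>L P"
    using assms Q by (simp add: adjoint_compose is_projection_def)
  also have "\<dots> = P" using absorb [of Q P] Q by simp
  finally show "Q = P" .
qed (use assms in simp)

lemma basis_projection:
  assumes onb: "orthonormal_basis I \<xi>" and J: "J \<subseteq> I" and T: "T \<in> bounded_ops"
    "\<And>w. w \<in> I \<Longrightarrow> blinfun_apply T (\<xi> w) = (if w \<in> J then \<xi> w else 0)"
  shows "is_projection T" "proj_onto (closed_cspan (\<xi> ` J)) = T"
proof -
  have T2: "T o\<^sub>L T = T"
    using J by (intro orthonormal_basis_operator_eqI [OF onb] bounded_ops_intros T(1)) (auto simp: T(2))
  have id: "inj_on (\<lambda>w. w) J" "(\<lambda>w. w) ` J \<subseteq> I" using J by simp_all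
  have T': "w \<in> J \<Longrightarrow> blinfun_apply (hilbert_adjoint T) (\<xi> w) = \<xi> w"
    "w \<in> I \<Longrightarrow> w \<notin> J \<Longrightarrow> blinfun_apply (hilbert_adjoint T) (\<xi> w) = 0" for w
    using basis_operator_adjoint_image [OF onb id J T, of w]
      basis_operator_adjoint_other [OF onb id J T, of w] by simp_all
  have "hilbert_adjoint T = T"
    by (intro orthonormal_basis_operator_eqI [OF onb] bounded_ops_intros T(1)) (auto simp: T(2) T')
  with T(1) T2 show proj: "is_projection T" by (simp add: is_projection_def)
  have "closed_cspan (\<xi> ` J) \<subseteq> {x. blinfun_apply T x = x}"
  proof (rule closed_cspan_minimal)
    show "closed {x. blinfun_apply T x = x}" by (intro closed_Collect_eq continuous_intros)
  qed (use J in \<open>auto simp: T(2) complex_vector.subspace_def blinfun.add_right bounded_ops_scaleC [OF T(1)]\<close>)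
  then have sub: "closed_cspan (\<xi> ` J) \<subseteq> range (blinfun_apply T)" by (metis (mono_tags, lifting) mem_Collect_eq rangeI subset_iff)
  have \<xi>J: "\<xi> w \<in> closed_cspan (\<xi> ` J)" if "w \<in> J" for w
    by (intro subsetD [OF closed_cspan_superset] imageI that)
  have "blinfun_apply T x \<in> closed_cspan (\<xi> ` J)" for x
  proof -
    have "closed (blinfun_apply T -` closed_cspan (\<xi> ` J))"
      by (intro closed_vimage closed_closed_cspan continuous_intros)
    then have "x \<in> blinfun_apply T -` closed_cspan (\<xi> ` J)"
      using subspace_closed_cspan [of "\<xi> ` J"]
      by (intro orthonormal_basis_minimal [OF onb])
        (auto simp: T(2) \<xi>J complex_vector.subspace_def blinfun.add_right bounded_ops_scaleC [OF T(1)])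
    then show ?thesis by simp
  qed
  then have "closed_cspan (\<xi> ` J) = range (blinfun_apply T)"
    by (intro subset_antisym sub image_subsetI)
  then show "proj_onto (closed_cspan (\<xi> ` J)) = T"
    using proj_onto_range [OF proj] by simp
qed

section \<open>Paths\<close>

text \<open>
  The product \<open>\<alpha>w\<close>, first \<open>w\<close> and then \<open>\<alpha>\<close>, which is meaningful if \<open>w\<close> ends where \<open>\<alpha>\<close> starts.
\<close>

definition path_mult :: "'v \<times> 'e list \<Rightarrow> 'v \<times> 'e list \<Rightarrow> 'v \<times> 'e list" where
  "path_mult \<alpha> w = (fst w, snd w @ snd \<alpha>)"

lemma path_range_Nil [simp]: "path_range G (v, []) = v"
  by (simp add: path_range_def pre_digraph.awalk_verts.simps)

lemma path_range_Cons [simp]: "path_range G (v, e # p) = path_range G (head G e, p)"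
  by (simp add: path_range_def pre_digraph.awalk_verts.simps pre_digraph.awalk_verts_non_Nil)

lemma path_range_snoc [simp]: "path_range G (v, p @ [e]) = head G e"
  by (induction p arbitrary: v) simp_all

context wf_digraph
begin

lemma Nil_in_free_semigroupoid [simp]: "(v, []) \<in> free_semigroupoid G \<longleftrightarrow> v \<in> verts G"
  by (auto simp: free_semigroupoid_def awalk_Nil_iff)

lemma Cons_in_free_semigroupoid [simp]:
  "(v, e # p) \<in> free_semigroupoid G \<longleftrightarrow>
    e \<in> arcs G \<and> v = tail G e \<and> (head G e, p) \<in> free_semigroupoid G"
  by (auto simp: free_semigroupoid_def awalk_Cons_iff)

lemma snoc_in_free_semigroupoid [simp]:
  "(v, p @ [e]) \<in> free_semigroupoid G \<longleftrightarrow>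
    (v, p) \<in> free_semigroupoid G \<and> e \<in> arcs G \<and> path_range G (v, p) = tail G e"
  by (induction p arbitrary: v) auto

lemma fst_in_verts: "w \<in> free_semigroupoid G \<Longrightarrow> fst w \<in> verts G"
  by (cases w; cases "snd w") auto

lemma path_range_in_verts: "w \<in> free_semigroupoid G \<Longrightarrow> path_range G w \<in> verts G"
  by (cases w; cases "snd w" rule: rev_cases) auto

lemma path_mult_in_free_semigroupoid:
  assumes "(v, p) \<in> free_semigroupoid G" "(x, q) \<in> free_semigroupoid G" "path_range G (v, p) = x"
  shows "(v, p @ q) \<in> free_semigroupoid G \<and> path_range G (v, p @ q) = path_range G (x, q)"
  using assms by (induction p arbitrary: v) auto

lemma
  assumes "w \<in> free_semigroupoid G" "\<alpha> \<in> free_semigroupoid G" "path_range G w = fst \<alpha>"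
  shows path_mult_closed: "path_mult \<alpha> w \<in> free_semigroupoid G"
    and path_range_mult: "path_range G (path_mult \<alpha> w) = path_range G \<alpha>"
  using path_mult_in_free_semigroupoid [of "fst w" "snd w" "fst \<alpha>" "snd \<alpha>"] assms
  by (simp_all add: path_mult_def)

lemma inj_on_path_mult: "inj_on (path_mult \<alpha>) X"
  by (auto simp: inj_on_def path_mult_def prod_eq_iff)

end

section \<open>Toeplitz families\<close>

text \<open>
  The algebraic content of the relations. The inequality between the sum of the final projections of
  the edges into \<open>x\<close> and \<open>P x\<close> is replaced by the equivalent condition that each of these final
  projections is below \<open>P x\<close>, which involves one edge at a time.
\<close>

locale toeplitz_family = wf_digraph G
  for G :: "('v, 'e) pre_digraph"
  and P :: "'v \<Rightarrow> ('h :: chilbert_space \<Rightarrow>\<^sub>L 'h)" and S :: "'e \<Rightarrow> ('h \<Rightarrow>\<^sub>L 'h)" +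
  assumes P_projection: "x \<in> verts G \<Longrightarrow> is_projection (P x)"
    and P_orthogonal: "x \<in> verts G \<Longrightarrow> y \<in> verts G \<Longrightarrow> x \<noteq> y \<Longrightarrow> P x o\<^sub>L P y = 0"
    and S_ops: "e \<in> arcs G \<Longrightarrow> S e \<in> bounded_ops"
    and adj_S_S: "e \<in> arcs G \<Longrightarrow> f \<in> arcs G \<Longrightarrow>
      hilbert_adjoint (S e) o\<^sub>L S f = (if e = f then P (tail G e) else 0)"
    and P_head_S: "e \<in> arcs G \<Longrightarrow> P (head G e) o\<^sub>L S e = S e"
begin

lemma P_ops: "x \<in> verts G \<Longrightarrow> P x \<in> bounded_ops"
  and P_idem: "x \<in> verts G \<Longrightarrow> P x o\<^sub>L P x = P x"
  and adj_P: "x \<in> verts G \<Longrightarrow> hilbert_adjoint (P x) = P x"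
  using P_projection by (auto simp: is_projection_def)

lemma P_P: "x \<in> verts G \<Longrightarrow> y \<in> verts G \<Longrightarrow> P x o\<^sub>L P y = (if x = y then P x else 0)"
  using P_idem P_orthogonal by auto

lemma S_P_tail:
  assumes e: "e \<in> arcs G" shows "S e o\<^sub>L P (tail G e) = S e"
proof (rule blinfun_eqI)
  fix h
  define k where "k = blinfun_apply (P (tail G e)) h - h"
  have "blinfun_apply (P (tail G e)) (blinfun_apply (P (tail G e)) h) = blinfun_apply (P (tail G e)) h"
    using P_idem [OF tail_in_verts [OF e]] by (metis blinfun_apply_blinfun_compose)
  then have "blinfun_apply (hilbert_adjoint (S e) o\<^sub>L S e) k = 0"
    using adj_S_S [OF e e] by (simp add: k_def blinfun.diff_right)
  then have "cinner (blinfun_apply (S e) k) (blinfun_apply (S e) k) = 0"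
    by (simp add: cinner_adjoint [OF S_ops [OF e]] cinner.zero_right)
  then have "blinfun_apply (S e) k = 0" by (simp add: cinner_self)
  then show "blinfun_apply (S e o\<^sub>L P (tail G e)) h = blinfun_apply (S e) h"
    by (simp add: k_def blinfun.diff_right)
qed

lemma P_S:
  assumes "x \<in> verts G" "e \<in> arcs G" shows "P x o\<^sub>L S e = (if x = head G e then S e else 0)"
proof -
  have "P x o\<^sub>L S e = (P x o\<^sub>L P (head G e)) o\<^sub>L S e"
    using P_head_S [OF assms(2)] by (simp add: blinfun_compose_assoc)
  then show ?thesis using assms by (simp add: P_P P_head_S)
qed

text \<open>
  Starting the product from the vertex projection makes the formula cover vertices as well; on a
  nonempty path it does not change the product of the edge operators.
\<close>

definition path_op :: "'v \<times> 'e list \<Rightarrow> ('h \<Rightarrow>\<^sub>L 'h)" where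
  "path_op w = fold (\<lambda>e T. S e o\<^sub>L T) (snd w) (P (fst w))"

lemma path_op_Nil: "path_op (v, []) = P v"
  by (simp add: path_op_def)

lemma path_op_snoc: "path_op (v, p @ [e]) = S e o\<^sub>L path_op (v, p)"
  by (simp add: path_op_def)

lemma fold_compose: "fold (\<lambda>e T. S e o\<^sub>L T) p (A o\<^sub>L B) = fold (\<lambda>e T. S e o\<^sub>L T) p A o\<^sub>L B"
  by (induction p arbitrary: A) (simp_all flip: blinfun_compose_assoc)

lemma path_op_Cons:
  assumes "e \<in> arcs G" shows "path_op (tail G e, e # p) = path_op (head G e, p) o\<^sub>L S e"
  using assms by (simp add: path_op_def S_P_tail P_head_S flip: fold_compose)

lemma path_op_ops: "w \<in> free_semigroupoid G \<Longrightarrow> path_op w \<in> bounded_ops"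
proof (induction "snd w" arbitrary: w rule: rev_induct)
  case Nil
  then show ?case by (cases w) (simp add: path_op_Nil P_ops)
next
  case (snoc e p)
  then show ?case using snoc(1) [of "(fst w, p)"]
    by (cases w) (auto simp: path_op_snoc S_ops intro!: compose_in_bounded_ops)
qed

lemma P_path_op:
  assumes "x \<in> verts G" "w \<in> free_semigroupoid G"
  shows "P x o\<^sub>L path_op w = (if path_range G w = x then path_op w else 0)"
proof (cases w)
  case (Pair v p)
  show ?thesis
  proof (cases p rule: rev_cases)
    case Nil
    then show ?thesis using assms Pair by (simp add: path_op_Nil P_P)
  next
    case (snoc q e)
    then have "P x o\<^sub>L path_op w = (P x o\<^sub>L S e) o\<^sub>L path_op (v, q)"
      by (simp add: Pair path_op_snoc blinfun_compose_assoc)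
    then show ?thesis using assms Pair snoc by (auto simp: P_S path_op_snoc)
  qed
qed

lemma path_op_P:
  assumes "x \<in> verts G" "w \<in> free_semigroupoid G"
  shows "path_op w o\<^sub>L P x = (if fst w = x then path_op w else 0)"
proof -
  have "path_op w o\<^sub>L P x = fold (\<lambda>e T. S e o\<^sub>L T) (snd w) (P (fst w) o\<^sub>L P x)"
    by (simp add: path_op_def fold_compose)
  also have "\<dots> = (if fst w = x then path_op w else fold (\<lambda>e T. S e o\<^sub>L T) (snd w) (0 o\<^sub>L 0))"
    using assms by (simp add: P_P fst_in_verts path_op_def)
  also have "fold (\<lambda>e T. S e o\<^sub>L T) (snd w) (0 o\<^sub>L 0) = 0"
    by (simp only: fold_compose) simp
  finally show ?thesis .
qed

definition path_adj :: "'v \<times> 'e list \<Rightarrow> ('h \<Rightarrow>\<^sub>L 'h)" where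
  "path_adj w = hilbert_adjoint (path_op w)"

lemma path_adj_ops: "w \<in> free_semigroupoid G \<Longrightarrow> path_adj w \<in> bounded_ops"
  by (simp add: path_adj_def adjoint_in_bounded_ops path_op_ops)

lemma P_path_adj:
  assumes "x \<in> verts G" "w \<in> free_semigroupoid G"
  shows "P x o\<^sub>L path_adj w = (if fst w = x then path_adj w else 0)"
proof -
  have "P x o\<^sub>L path_adj w = hilbert_adjoint (path_op w o\<^sub>L P x)"
    using assms by (simp add: path_adj_def adjoint_compose path_op_ops P_ops adj_P)
  then show ?thesis using assms by (simp add: path_op_P path_adj_def adjoint_zero)
qed

lemma path_adj_Nil: "v \<in> verts G \<Longrightarrow> path_adj (v, []) = P v"
  by (simp add: path_adj_def path_op_Nil adj_P)

lemma path_adj_Cons: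
  assumes "e \<in> arcs G" "(head G e, p) \<in> free_semigroupoid G"
  shows "path_adj (tail G e, e # p) = hilbert_adjoint (S e) o\<^sub>L path_adj (head G e, p)"
  using assms by (simp add: path_adj_def path_op_Cons adjoint_compose path_op_ops S_ops)

lemma path_op_mult:
  assumes "w \<in> free_semigroupoid G" "\<alpha> \<in> free_semigroupoid G" "path_range G w = fst \<alpha>"
  shows "path_op (path_mult \<alpha> w) = path_op \<alpha> o\<^sub>L path_op w"
proof -
  have "path_op (path_mult \<alpha> w) = fold (\<lambda>e T. S e o\<^sub>L T) (snd \<alpha>) (path_op w)"
    by (simp add: path_op_def path_mult_def)
  also have "path_op w = P (fst \<alpha>) o\<^sub>L path_op w"
    using assms by (simp add: P_path_op fst_in_verts)
  also have "fold (\<lambda>e T. S e o\<^sub>L T) (snd \<alpha>) \<dots> = path_op \<alpha> o\<^sub>L path_op w"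
    by (simp only: fold_compose path_op_def)
  finally show ?thesis .
qed

lemma path_adj_mult:
  assumes "w \<in> free_semigroupoid G" "\<alpha> \<in> free_semigroupoid G" "path_range G w = fst \<alpha>"
  shows "path_adj (path_mult \<alpha> w) = path_adj w o\<^sub>L path_adj \<alpha>"
  using assms by (simp add: path_adj_def path_op_mult adjoint_compose path_op_ops)

definition monomial :: "'v \<times> 'e list \<Rightarrow> 'v \<times> 'e list \<Rightarrow> ('h \<Rightarrow>\<^sub>L 'h)" where
  "monomial \<alpha> \<beta> = path_op \<alpha> o\<^sub>L path_adj \<beta>"

lemma monomial_ops:
  "\<alpha> \<in> free_semigroupoid G \<Longrightarrow> \<beta> \<in> free_semigroupoid G \<Longrightarrow> monomial \<alpha> \<beta> \<in> bounded_ops"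
  by (simp add: monomial_def compose_in_bounded_ops path_op_ops path_adj_ops)

lemma adj_monomial:
  "\<alpha> \<in> free_semigroupoid G \<Longrightarrow> \<beta> \<in> free_semigroupoid G \<Longrightarrow>
    hilbert_adjoint (monomial \<alpha> \<beta>) = monomial \<beta> \<alpha>"
  by (simp add: monomial_def path_adj_def adjoint_compose adjoint_adjoint path_op_ops adjoint_in_bounded_ops)

lemma P_monomial:
  assumes "x \<in> verts G" "\<alpha> \<in> free_semigroupoid G"
  shows "P x o\<^sub>L monomial \<alpha> \<beta> = (if path_range G \<alpha> = x then monomial \<alpha> \<beta> else 0)"
  using P_path_op [OF assms] by (simp add: monomial_def flip: blinfun_compose_assoc)

lemma S_monomial:
  assumes "e \<in> arcs G" "\<alpha> \<in> free_semigroupoid G"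
  shows "S e o\<^sub>L monomial \<alpha> \<beta> = (if path_range G \<alpha> = tail G e then monomial (edge_mult e \<alpha>) \<beta> else 0)"
proof -
  have "S e o\<^sub>L monomial \<alpha> \<beta> = S e o\<^sub>L (P (tail G e) o\<^sub>L monomial \<alpha> \<beta>)"
    using S_P_tail [OF assms(1)] by (simp flip: blinfun_compose_assoc)
  also have "\<dots> = (if path_range G \<alpha> = tail G e then S e o\<^sub>L monomial \<alpha> \<beta> else 0)"
    using assms by (simp add: P_monomial)
  finally have *: "S e o\<^sub>L monomial \<alpha> \<beta> = (if path_range G \<alpha> = tail G e then S e o\<^sub>L monomial \<alpha> \<beta> else 0)" .
  have "S e o\<^sub>L monomial \<alpha> \<beta> = monomial (edge_mult e \<alpha>) \<beta>"
    by (simp add: monomial_def edge_mult_def path_op_def blinfun_compose_assoc)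
  from * [unfolded this] this show ?thesis by (simp only:)
qed

lemma adj_S_monomial_snoc:
  assumes "e \<in> arcs G" "(v, p @ [f]) \<in> free_semigroupoid G"
  shows "hilbert_adjoint (S e) o\<^sub>L monomial (v, p @ [f]) \<beta> = (if e = f then monomial (v, p) \<beta> else 0)"
proof -
  have "hilbert_adjoint (S e) o\<^sub>L monomial (v, p @ [f]) \<beta> = (hilbert_adjoint (S e) o\<^sub>L S f) o\<^sub>L monomial (v, p) \<beta>"
    by (simp add: monomial_def path_op_snoc blinfun_compose_assoc)
  then show ?thesis using assms by (simp add: adj_S_S P_monomial)
qed

text \<open>
  If \<open>\<alpha>\<close> has no edge left to cancel, the edge is moved to the other side and prolongs \<open>\<beta>\<close> at its source.
  With \<open>P_monomial\<close>, \<open>S_monomial\<close> and \<open>adj_S_monomial_snoc\<close> this describes the left multiplication of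
  monomials by all generators in terms of the graph alone.
\<close>

lemma adj_S_monomial_Nil:
  assumes "e \<in> arcs G" "v \<in> verts G" "\<beta> \<in> free_semigroupoid G" "fst \<beta> = v"
  shows "hilbert_adjoint (S e) o\<^sub>L monomial (v, []) \<beta> =
    (if head G e = v then monomial (tail G e, []) (tail G e, e # snd \<beta>) else 0)"
proof -
  have "monomial (v, []) \<beta> = path_adj \<beta>"
    using assms by (simp add: monomial_def path_op_Nil P_path_adj)
  moreover have "hilbert_adjoint (S e) = hilbert_adjoint (S e) o\<^sub>L P (head G e)"
    using assms adjoint_compose [OF P_ops S_ops, of "head G e" e] by (simp add: P_head_S adj_P)
  ultimately have *: "hilbert_adjoint (S e) o\<^sub>L monomial (v, []) \<beta>
      = hilbert_adjoint (S e) o\<^sub>L (P (head G e) o\<^sub>L path_adj \<beta>)"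
    by (metis blinfun_compose_assoc)
  show ?thesis
  proof (cases "head G e = v")
    case True
    define q where "q = snd \<beta>"
    have \<beta>: "\<beta> = (head G e, q)" using True assms(4) by (simp add: q_def prod_eq_iff)
    have mem: "(head G e, q) \<in> free_semigroupoid G" using assms(3) \<beta> by simp
    have "monomial (tail G e, []) (tail G e, e # q) = P (tail G e) o\<^sub>L path_adj (tail G e, e # q)"
      by (simp add: monomial_def path_op_Nil)
    also have "\<dots> = path_adj (tail G e, e # q)"
      using assms(1) mem by (simp add: P_path_adj)
    also have "\<dots> = hilbert_adjoint (S e) o\<^sub>L path_adj \<beta>"
      unfolding \<beta> by (rule path_adj_Cons [OF assms(1) mem])
    also have "path_adj \<beta> = P (head G e) o\<^sub>L path_adj \<beta>"
      using assms(1) mem by (simp add: P_path_adj \<beta>)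
    finally show ?thesis using * True by (simp add: q_def)
  next
    case False
    then show ?thesis using * assms by (simp add: P_path_adj)
  qed
qed

end

section \<open>The Poisson kernel\<close>

context wf_digraph
begin

definition paths_of_length :: "'b set \<Rightarrow> 'a \<Rightarrow> nat \<Rightarrow> ('a \<times> 'b list) set" where
  "paths_of_length E x n = {w \<in> free_semigroupoid G. path_range G w = x \<and> set (snd w) \<subseteq> E \<and> length (snd w) = n}"

lemma paths_of_length_0: "x \<in> verts G \<Longrightarrow> paths_of_length E x 0 = {(x, [])}"
  by (auto simp: paths_of_length_def)

text \<open>
  The recursion peels off the first edge of a path, because $S_w^*$ ends with the adjoint of that edge
  operator.
\<close>

lemma paths_of_length_Suc:
  assumes "E \<subseteq> arcs G"
  shows "paths_of_length E x (Suc n) =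
    (\<lambda>(w, e). (tail G e, e # snd w)) ` (SIGMA w:paths_of_length E x n. {e \<in> E. head G e = fst w})"
proof (intro subset_antisym subsetI)
  fix w assume w: "w \<in> paths_of_length E x (Suc n)"
  then obtain e p where p: "snd w = e # p" by (cases "snd w") (auto simp: paths_of_length_def)
  then have weq: "w = (fst w, e # p)" by (simp add: prod_eq_iff)
  have "(fst w, e # p) \<in> paths_of_length E x (Suc n)" using w weq by simp
  then have "fst w = tail G e" "(head G e, p) \<in> paths_of_length E x n" "e \<in> E"
    by (auto simp: paths_of_length_def)
  then show "w \<in> (\<lambda>(w, e). (tail G e, e # snd w)) ` (SIGMA w:paths_of_length E x n. {e \<in> E. head G e = fst w})"
    using weq by (intro image_eqI [of _ _ "((head G e, p), e)"]) auto
next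
  fix u assume "u \<in> (\<lambda>(w, e). (tail G e, e # snd w)) ` (SIGMA w:paths_of_length E x n. {e \<in> E. head G e = fst w})"
  then obtain w e where u: "u = (tail G e, e # snd w)" and w: "w \<in> paths_of_length E x n" "e \<in> E" "head G e = fst w"
    by auto
  then have "(head G e, snd w) \<in> paths_of_length E x n" by simp
  then show "u \<in> paths_of_length E x (Suc n)"
    using assms w(2) u by (auto simp: paths_of_length_def)
qed

lemma finite_paths_of_length: "finite E \<Longrightarrow> E \<subseteq> arcs G \<Longrightarrow> x \<in> verts G \<Longrightarrow> finite (paths_of_length E x n)"
  by (induction n) (auto simp: paths_of_length_0 paths_of_length_Suc)

lemma sum_paths_of_length_Suc:
  assumes "finite E" "E \<subseteq> arcs G" "x \<in> verts G"
  shows "(\<Sum>w\<in>paths_of_length E x (Suc n). f w) =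
    (\<Sum>w\<in>paths_of_length E x n. \<Sum>e | e \<in> E \<and> head G e = fst w. f (tail G e, e # snd w))"
proof -
  have "inj_on (\<lambda>(w, e). (tail G e, e # snd w)) (SIGMA w:paths_of_length E x n. {e \<in> E. head G e = fst w})"
    by (auto simp: inj_on_def prod_eq_iff)
  then have "(\<Sum>w\<in>paths_of_length E x (Suc n). f w)
      = (\<Sum>(w, e)\<in>(SIGMA w:paths_of_length E x n. {e \<in> E. head G e = fst w}). f (tail G e, e # snd w))"
    unfolding paths_of_length_Suc [OF assms(2)] by (simp add: sum.reindex case_prod_unfold)
  also have "\<dots> = (\<Sum>w\<in>paths_of_length E x n. \<Sum>e | e \<in> E \<and> head G e = fst w. f (tail G e, e # snd w))"
    using assms by (intro sum.Sigma [symmetric] finite_paths_of_length) auto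
  finally show ?thesis .
qed

definition paths_upto :: "'b set \<Rightarrow> 'a \<Rightarrow> nat \<Rightarrow> ('a \<times> 'b list) set" where
  "paths_upto E x m = {w \<in> free_semigroupoid G. path_range G w = x \<and> set (snd w) \<subseteq> E \<and> length (snd w) \<le> m}"

lemma paths_upto_eq_UN: "paths_upto E x m = (\<Union>n\<le>m. paths_of_length E x n)"
  by (auto simp: paths_upto_def paths_of_length_def)

lemma finite_paths_upto: "finite E \<Longrightarrow> E \<subseteq> arcs G \<Longrightarrow> x \<in> verts G \<Longrightarrow> finite (paths_upto E x m)"
  by (simp add: paths_upto_eq_UN finite_paths_of_length)

end

context toeplitz_family
begin

text \<open>
  Bessel's inequality for mutually orthogonal projections.
\<close>

lemma finite_sum_compressions_le:
  assumes V: "finite V" "V \<subseteq> verts G"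
  shows "(\<Sum>x\<in>V. (norm (blinfun_apply (P x) h))\<^sup>2) \<le> (norm h)\<^sup>2"
proof -
  define k where "k = (\<Sum>x\<in>V. blinfun_apply (P x) h)"
  have PP: "cinner (blinfun_apply (P x) h) (blinfun_apply (P y) h)
      = (if x = y then complex_of_real ((norm (blinfun_apply (P x) h))\<^sup>2) else 0)"
    if "x \<in> verts G" "y \<in> verts G" for x y
  proof (cases "x = y")
    case False
    have "cinner (blinfun_apply (P x) h) (blinfun_apply (P y) h) = cinner h (blinfun_apply (P x o\<^sub>L P y) h)"
      using that by (simp add: cinner_adjoint P_ops adj_P)
    with False that show ?thesis by (simp add: P_orthogonal cinner.zero_right)
  qed (simp add: cinner_self)
  have hP: "cinner h (blinfun_apply (P x) h) = complex_of_real ((norm (blinfun_apply (P x) h))\<^sup>2)"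
    if "x \<in> verts G" for x
  proof -
    have "cinner h (blinfun_apply (P x) h) = cinner h (blinfun_apply (P x o\<^sub>L P x) h)"
      using that by (simp only: P_idem)
    also have "\<dots> = cinner (blinfun_apply (P x) h) (blinfun_apply (P x) h)"
      using that by (simp add: cinner_adjoint P_ops adj_P)
    finally show ?thesis by (simp only: cinner_self)
  qed
  define t where "t = (\<Sum>x\<in>V. (norm (blinfun_apply (P x) h))\<^sup>2)"
  have "cinner k k = (\<Sum>x\<in>V. \<Sum>y\<in>V. cinner (blinfun_apply (P x) h) (blinfun_apply (P y) h))"
    unfolding k_def cinner.sum_left cinner.sum_right by (rule sum.swap)
  also have "\<dots> = (\<Sum>x\<in>V. \<Sum>y\<in>V. if x = y then complex_of_real ((norm (blinfun_apply (P x) h))\<^sup>2) else 0)"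
    by (intro sum.cong refl PP subsetD [OF V(2)])
  also have "\<dots> = complex_of_real t"
    unfolding t_def of_real_sum using V(1) by (intro sum.cong refl) simp
  finally have "complex_of_real ((norm k)\<^sup>2) = complex_of_real t"
    by (simp only: cinner_self)
  then have kk: "(norm k)\<^sup>2 = t"
    by (simp only: of_real_eq_iff)
  have "cinner h k = (\<Sum>x\<in>V. complex_of_real ((norm (blinfun_apply (P x) h))\<^sup>2))"
    unfolding k_def cinner.sum_right by (intro sum.cong refl hP subsetD [OF V(2)])
  then have "cinner h k = complex_of_real t" by (simp only: t_def of_real_sum)
  then have "t \<le> norm h * norm k"
    using Cauchy_Schwarz_cinner [of h k] by simp
  then have "norm k * norm k \<le> norm h * norm k"
    using kk by (simp add: power2_eq_square)
  then have "norm k \<le> norm h" by (cases "norm k = 0") auto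
  then have "(norm k)\<^sup>2 \<le> (norm h)\<^sup>2" by (intro power_mono) simp_all
  then show ?thesis using kk t_def by simp
qed

definition final_proj :: "'e set \<Rightarrow> 'v \<Rightarrow> ('h \<Rightarrow>\<^sub>L 'h)" where
  "final_proj E v = (\<Sum>e | e \<in> E \<and> head G e = v. S e o\<^sub>L hilbert_adjoint (S e))"

lemma cinner_final_proj:
  assumes "E \<subseteq> arcs G"
  shows "cinner (blinfun_apply (final_proj E v) h) g =
      (\<Sum>e | e \<in> E \<and> head G e = v.
        cinner (blinfun_apply (hilbert_adjoint (S e)) h) (blinfun_apply (hilbert_adjoint (S e)) g))"
    and "cinner h (blinfun_apply (final_proj E v) g) =
      (\<Sum>e | e \<in> E \<and> head G e = v.
        cinner (blinfun_apply (hilbert_adjoint (S e)) h) (blinfun_apply (hilbert_adjoint (S e)) g))"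
  using assms
  by (auto simp: final_proj_def blinfun.sum_left cinner.sum_left cinner.sum_right
      cinner_adjoint cinner_adjoint' S_ops subset_iff intro!: sum.cong)

lemma adj_S_final_proj:
  assumes "finite E" "E \<subseteq> arcs G" "e \<in> E" "head G e = v"
  shows "blinfun_apply (hilbert_adjoint (S e)) (blinfun_apply (final_proj E v) h)
    = blinfun_apply (hilbert_adjoint (S e)) h"
proof -
  let ?F = "{f \<in> E. head G f = v}"
  have e: "e \<in> arcs G" using assms(2,3) by (rule subsetD)
  have "blinfun_apply (hilbert_adjoint (S e)) (blinfun_apply (final_proj E v) h)
      = (\<Sum>f\<in>?F. blinfun_apply (hilbert_adjoint (S e) o\<^sub>L S f) (blinfun_apply (hilbert_adjoint (S f)) h))"
    by (simp add: final_proj_def blinfun.sum_left blinfun.sum_right)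
  also have "\<dots> = (\<Sum>f\<in>?F. if f = e then blinfun_apply (P (tail G e) o\<^sub>L hilbert_adjoint (S e)) h else 0)"
  proof (intro sum.cong refl)
    fix f assume "f \<in> ?F"
    then have f: "f \<in> arcs G" using assms(2) by (auto simp: subset_iff)
    show "blinfun_apply (hilbert_adjoint (S e) o\<^sub>L S f) (blinfun_apply (hilbert_adjoint (S f)) h)
        = (if f = e then blinfun_apply (P (tail G e) o\<^sub>L hilbert_adjoint (S e)) h else 0)"
      unfolding adj_S_S [OF e f] by simp
  qed
  also have "\<dots> = blinfun_apply (P (tail G e) o\<^sub>L hilbert_adjoint (S e)) h"
    using assms by (simp add: sum.delta)
  also have "P (tail G e) o\<^sub>L hilbert_adjoint (S e) = hilbert_adjoint (S e)"
    using adjoint_compose [OF S_ops P_ops, of e "tail G e"] e by (simp add: S_P_tail adj_P)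
  finally show ?thesis .
qed

text \<open>
  For finite \<open>E\<close>, \<open>final_proj E v\<close> is a projection below \<open>P v\<close>, and this is the square root of
  \<open>P v - r\<^sup>2 final_proj E v\<close>.
\<close>

definition defect :: "'e set \<Rightarrow> real \<Rightarrow> 'v \<Rightarrow> ('h \<Rightarrow>\<^sub>L 'h)" where
  "defect E r v = P v - (1 - sqrt (1 - r\<^sup>2)) *\<^sub>R final_proj E v"

lemma cinner_defect:
  assumes E: "finite E" "E \<subseteq> arcs G" and r: "0 \<le> r" "r \<le> 1"
    and h: "blinfun_apply (P v) h = h" and g: "blinfun_apply (P v) g = g"
  shows "cinner (blinfun_apply (defect E r v) h) (blinfun_apply (defect E r v) g) =
    cinner h g - complex_of_real (r\<^sup>2) * (\<Sum>e | e \<in> E \<and> head G e = v.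
      cinner (blinfun_apply (hilbert_adjoint (S e)) h) (blinfun_apply (hilbert_adjoint (S e)) g))"
proof -
  define c where "c = 1 - sqrt (1 - r\<^sup>2)"
  have "r\<^sup>2 \<le> 1" using r by (simp add: power_le_one)
  then have "(sqrt (1 - r\<^sup>2))\<^sup>2 = 1 - r\<^sup>2" by simp
  then have "r\<^sup>2 = 2 * c - c * c" by (simp add: c_def power2_eq_square algebra_simps)
  then have cr: "complex_of_real (r\<^sup>2) = 2 * complex_of_real c - complex_of_real c * complex_of_real c"
    by (simp only: of_real_mult of_real_diff of_real_numeral)
  let ?Q = "blinfun_apply (final_proj E v)"
  define s where "s = (\<Sum>e | e \<in> E \<and> head G e = v.
      cinner (blinfun_apply (hilbert_adjoint (S e)) h) (blinfun_apply (hilbert_adjoint (S e)) g))"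
  have "cinner (?Q h) g = s" "cinner h (?Q g) = s"
    unfolding s_def by (rule cinner_final_proj [OF E(2)])+
  moreover have "cinner (?Q h) (?Q g) = s"
    unfolding s_def cinner_final_proj(1) [OF E(2)]
    by (intro sum.cong refl) (simp add: adj_S_final_proj [OF E])
  ultimately show ?thesis
    unfolding s_def [symmetric] cr
    by (simp add: defect_def h g blinfun.diff_left blinfun.scaleR_left cinner.diff_left cinner.diff_right
        cinner_scaleR_left cinner_scaleR_right algebra_simps flip: c_def)
qed

definition poisson :: "'e set \<Rightarrow> real \<Rightarrow> 'v \<times> 'e list \<Rightarrow> 'h \<Rightarrow> 'h" where
  "poisson E r w h = r ^ length (snd w) *\<^sub>R blinfun_apply (defect E r (fst w)) (blinfun_apply (path_adj w) h)"

definition gram :: "'e set \<Rightarrow> 'v \<Rightarrow> nat \<Rightarrow> 'h \<Rightarrow> 'h \<Rightarrow> complex" where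
  "gram E x n h g = (\<Sum>w\<in>paths_of_length E x n. cinner (blinfun_apply (path_adj w) h) (blinfun_apply (path_adj w) g))"

text \<open>
  The defect operator turns the sum over paths of one length into a difference of the sums for two
  consecutive lengths, weighted so that summing over all lengths telescopes.
\<close>

lemma poisson_length:
  assumes E: "finite E" "E \<subseteq> arcs G" and x: "x \<in> verts G" and r: "0 \<le> r" "r \<le> 1"
  shows "(\<Sum>w\<in>paths_of_length E x n. cinner (poisson E r w h) (poisson E r w g)) =
    complex_of_real (r ^ (2 * n)) * (gram E x n h g - complex_of_real (r\<^sup>2) * gram E x (Suc n) h g)"
proof -
  let ?d = "\<lambda>w e. cinner (blinfun_apply (hilbert_adjoint (S e)) (blinfun_apply (path_adj w) h))
      (blinfun_apply (hilbert_adjoint (S e)) (blinfun_apply (path_adj w) g))"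
  have "cinner (poisson E r w h) (poisson E r w g) = complex_of_real (r ^ (2 * n)) *
      (cinner (blinfun_apply (path_adj w) h) (blinfun_apply (path_adj w) g)
        - complex_of_real (r\<^sup>2) * (\<Sum>e | e \<in> E \<and> head G e = fst w. ?d w e))"
    if "w \<in> paths_of_length E x n" for w
  proof -
    have w: "w \<in> free_semigroupoid G" "length (snd w) = n" using that by (simp_all add: paths_of_length_def)
    have absorb: "blinfun_apply (P (fst w)) (blinfun_apply (path_adj w) k) = blinfun_apply (path_adj w) k" for k
      using P_path_adj [OF fst_in_verts [OF w(1)] w(1)] by (metis blinfun_apply_blinfun_compose)
    have "complex_of_real (r ^ n) * complex_of_real (r ^ n) = complex_of_real (r ^ (2 * n))"
      by (simp add: mult_2 power_add)
    then show ?thesis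
      unfolding cinner_defect [OF E r absorb absorb, symmetric]
      by (simp add: poisson_def w(2) cinner_scaleR_left cinner_scaleR_right mult.assoc [symmetric])
  qed
  then have "(\<Sum>w\<in>paths_of_length E x n. cinner (poisson E r w h) (poisson E r w g)) = complex_of_real (r ^ (2 * n)) *
      (gram E x n h g - complex_of_real (r\<^sup>2) * (\<Sum>w\<in>paths_of_length E x n. \<Sum>e | e \<in> E \<and> head G e = fst w. ?d w e))"
    by (simp add: gram_def sum_distrib_left sum_subtractf right_diff_distrib)
  also have "(\<Sum>w\<in>paths_of_length E x n. \<Sum>e | e \<in> E \<and> head G e = fst w. ?d w e) = gram E x (Suc n) h g"
    unfolding gram_def sum_paths_of_length_Suc [OF E x]
  proof (intro sum.cong refl)
    fix w e assume w: "w \<in> paths_of_length E x n" and e: "e \<in> {e. e \<in> E \<and> head G e = fst w}"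
    then have "(head G e, snd w) = w" by simp
    moreover have "e \<in> arcs G" using e E(2) by (auto simp: subset_iff)
    ultimately have "path_adj (tail G e, e # snd w) = hilbert_adjoint (S e) o\<^sub>L path_adj w"
      using path_adj_Cons [of e "snd w"] w by (simp add: paths_of_length_def)
    then show "?d w e = cinner (blinfun_apply (path_adj (tail G e, e # snd w)) h)
        (blinfun_apply (path_adj (tail G e, e # snd w)) g)" by simp
  qed
  finally show ?thesis .
qed

lemma poisson_telescope:
  assumes E: "finite E" "E \<subseteq> arcs G" and x: "x \<in> verts G" and r: "0 \<le> r" "r \<le> 1"
  shows "(\<Sum>n\<le>m. \<Sum>w\<in>paths_of_length E x n. cinner (poisson E r w h) (poisson E r w g)) =
    cinner (blinfun_apply (P x) h) (blinfun_apply (P x) g) - complex_of_real (r ^ (2 * Suc m)) * gram E x (Suc m) h g"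
proof (induction m)
  case 0
  have "gram E x 0 h g = cinner (blinfun_apply (P x) h) (blinfun_apply (P x) g)"
    using x by (simp add: gram_def paths_of_length_0 path_adj_Nil)
  then show ?case by (simp add: poisson_length [OF E x r])
next
  case (Suc m)
  then show ?case
    by (simp add: poisson_length [OF E x r] power_add power2_eq_square algebra_simps)
qed

lemma gram_self: "gram E x n h h = complex_of_real (\<Sum>w\<in>paths_of_length E x n. (norm (blinfun_apply (path_adj w) h))\<^sup>2)"
  by (simp only: gram_def cinner_self of_real_sum)

text \<open>
  The case \<open>r = 1\<close> of the telescoping identity: without damping, passing to longer paths loses exactly
  the nonnegative contribution of the kernel.
\<close>

lemma gram_self_le:
  assumes E: "finite E" "E \<subseteq> arcs G" and x: "x \<in> verts G"
  shows "(\<Sum>w\<in>paths_of_length E x n. (norm (blinfun_apply (path_adj w) h))\<^sup>2) \<le> (norm h)\<^sup>2"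
proof (induction n)
  case 0
  show ?case
    using x is_projection_norm_le [OF P_projection [OF x], of h] by (simp add: paths_of_length_0 path_adj_Nil power_mono)
next
  case (Suc n)
  have "complex_of_real (\<Sum>w\<in>paths_of_length E x n. (norm (poisson E 1 w h))\<^sup>2) = gram E x n h h - gram E x (Suc n) h h"
    using poisson_length [OF E x, where r = 1 and n = n and h = h and g = h] by (simp add: cinner_self)
  then have "(\<Sum>w\<in>paths_of_length E x n. (norm (poisson E 1 w h))\<^sup>2)
      = (\<Sum>w\<in>paths_of_length E x n. (norm (blinfun_apply (path_adj w) h))\<^sup>2)
        - (\<Sum>w\<in>paths_of_length E x (Suc n). (norm (blinfun_apply (path_adj w) h))\<^sup>2)"
    unfolding gram_self of_real_diff [symmetric] of_real_eq_iff .
  moreover have "0 \<le> (\<Sum>w\<in>paths_of_length E x n. (norm (poisson E 1 w h))\<^sup>2)" by (intro sum_nonneg) simp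
  ultimately show ?case using Suc by linarith
qed

lemma norm_gram_le:
  assumes E: "finite E" "E \<subseteq> arcs G" and x: "x \<in> verts G"
  shows "cmod (gram E x n h g) \<le> norm h * norm g"
proof -
  let ?a = "\<lambda>h w. norm (blinfun_apply (path_adj w) h)"
  have L2: "L2_set (?a h) (paths_of_length E x n) \<le> norm h" for h
    unfolding L2_set_def using gram_self_le [OF E x] by (intro real_le_lsqrt) (auto intro: sum_nonneg)
  have "cmod (gram E x n h g) \<le> (\<Sum>w\<in>paths_of_length E x n. \<bar>?a h w\<bar> * \<bar>?a g w\<bar>)"
    unfolding gram_def by (rule sum_norm_le) (simp add: Cauchy_Schwarz_cinner)
  also have "\<dots> \<le> L2_set (?a h) (paths_of_length E x n) * L2_set (?a g) (paths_of_length E x n)"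
    by (rule L2_set_mult_ineq)
  also have "\<dots> \<le> norm h * norm g"
    by (intro mult_mono L2 norm_ge_zero L2_set_nonneg)
  finally show ?thesis .
qed

text \<open>
  Up to a damped remainder the truncated kernel preserves inner products on the range of \<open>P x\<close>.
\<close>

lemma poisson_gram:
  assumes E: "finite E" "E \<subseteq> arcs G" and x: "x \<in> verts G" and r: "0 \<le> r" "r \<le> 1"
  shows "(\<Sum>w\<in>paths_upto E x m. cinner (poisson E r w h) (poisson E r w g)) =
    cinner (blinfun_apply (P x) h) (blinfun_apply (P x) g) - complex_of_real (r ^ (2 * Suc m)) * gram E x (Suc m) h g"
  unfolding poisson_telescope [OF E x r, symmetric] paths_upto_eq_UN
  by (rule sum.UNION_disjoint) (use E x in \<open>auto simp: finite_paths_of_length\<close>, auto simp: paths_of_length_def)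

text \<open>
  For \<open>h = g\<close> the remainder in \<open>poisson_gram\<close> has the right sign, so truncation keeps the kernel
  contractive. Paths with different ranges see the mutually orthogonal components \<open>P x h\<close>.
\<close>

lemma poisson_norm_le:
  assumes E: "finite E" "E \<subseteq> arcs G" and V: "finite V" "V \<subseteq> verts G" and r: "0 \<le> r" "r \<le> 1"
  shows "(\<Sum>w\<in>(\<Union>x\<in>V. paths_upto E x m). (norm (poisson E r w h))\<^sup>2) \<le> (norm h)\<^sup>2"
proof -
  have "(\<Sum>w\<in>(\<Union>x\<in>V. paths_upto E x m). (norm (poisson E r w h))\<^sup>2)
      = (\<Sum>x\<in>V. \<Sum>w\<in>paths_upto E x m. (norm (poisson E r w h))\<^sup>2)"
    using E V by (intro sum.UNION_disjoint) (auto simp: finite_paths_upto subset_iff, auto simp: paths_upto_def)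
  also have "\<dots> \<le> (\<Sum>x\<in>V. (norm (blinfun_apply (P x) h))\<^sup>2)"
  proof (rule sum_mono)
    fix x assume "x \<in> V"
    then have x: "x \<in> verts G" using V by (auto simp: subset_iff)
    have "complex_of_real (\<Sum>w\<in>paths_upto E x m. (norm (poisson E r w h))\<^sup>2)
        = complex_of_real ((norm (blinfun_apply (P x) h))\<^sup>2
          - r ^ (2 * Suc m) * (\<Sum>w\<in>paths_of_length E x (Suc m). (norm (blinfun_apply (path_adj w) h))\<^sup>2))"
      using poisson_gram [OF E x r, where m = m and h = h and g = h] by (simp only: cinner_self gram_self of_real_sum of_real_diff of_real_mult)
    then have "(\<Sum>w\<in>paths_upto E x m. (norm (poisson E r w h))\<^sup>2) = (norm (blinfun_apply (P x) h))\<^sup>2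
          - r ^ (2 * Suc m) * (\<Sum>w\<in>paths_of_length E x (Suc m). (norm (blinfun_apply (path_adj w) h))\<^sup>2)"
      by (simp only: of_real_eq_iff)
    moreover have "0 \<le> r ^ (2 * Suc m) * (\<Sum>w\<in>paths_of_length E x (Suc m). (norm (blinfun_apply (path_adj w) h))\<^sup>2)"
      using r by (intro mult_nonneg_nonneg sum_nonneg) simp_all
    ultimately show "(\<Sum>w\<in>paths_upto E x m. (norm (poisson E r w h))\<^sup>2) \<le> (norm (blinfun_apply (P x) h))\<^sup>2"
      by linarith
  qed
  also have "\<dots> \<le> (norm h)\<^sup>2" by (rule finite_sum_compressions_le [OF V])
  finally show ?thesis .
qed

lemma poisson_path_mult:
  assumes "w \<in> free_semigroupoid G" "\<alpha> \<in> free_semigroupoid G" "path_range G w = fst \<alpha>"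
  shows "poisson E r (path_mult \<alpha> w) h = r ^ length (snd \<alpha>) *\<^sub>R poisson E r w (blinfun_apply (path_adj \<alpha>) h)"
  using path_adj_mult [OF assms] by (simp add: poisson_def path_mult_def power_add mult.commute)

text \<open>
  The truncated form of $K^* (L_\alpha L_\beta^* \otimes 1) K = r^{|\alpha|+|\beta|} S_\alpha S_\beta^*$:
  the left-hand side runs over those nonzero matrix entries of $L_\alpha L_\beta^*$, all equal to one,
  that lie within the truncation.
\<close>

lemma poisson_intertwine:
  assumes E: "finite E" "E \<subseteq> arcs G" and r: "0 \<le> r" "r \<le> 1"
    and \<alpha>: "\<alpha> \<in> free_semigroupoid G" and \<beta>: "\<beta> \<in> free_semigroupoid G" and src: "fst \<alpha> = fst \<beta>"
  shows "(\<Sum>w\<in>paths_upto E (fst \<alpha>) m. cinner (poisson E r (path_mult \<beta> w) h) (poisson E r (path_mult \<alpha> w) g)) =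
    complex_of_real (r ^ (length (snd \<alpha>) + length (snd \<beta>))) *
      (cinner (blinfun_apply (monomial \<alpha> \<beta>) h) g -
        complex_of_real (r ^ (2 * Suc m)) *
          gram E (fst \<alpha>) (Suc m) (blinfun_apply (path_adj \<beta>) h) (blinfun_apply (path_adj \<alpha>) g))"
proof -
  let ?h = "blinfun_apply (path_adj \<beta>) h" and ?g = "blinfun_apply (path_adj \<alpha>) g"
  let ?x = "fst \<alpha>"
  have x: "?x \<in> verts G" using \<alpha> by (rule fst_in_verts)
  have Ph: "blinfun_apply (P ?x) ?h = ?h"
    using P_path_adj [OF x \<beta>] src by (metis blinfun_apply_blinfun_compose)
  have Pg: "blinfun_apply (P ?x) ?g = ?g"
    using P_path_adj [OF x \<alpha>] by (metis blinfun_apply_blinfun_compose)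
  have "cinner (blinfun_apply (monomial \<alpha> \<beta>) h) g = cinner ?h ?g"
    using cinner_adjoint [OF path_op_ops [OF \<alpha>], of ?h g] by (simp add: monomial_def path_adj_def)
  moreover have "(\<Sum>w\<in>paths_upto E ?x m. cinner (poisson E r (path_mult \<beta> w) h) (poisson E r (path_mult \<alpha> w) g))
      = (\<Sum>w\<in>paths_upto E ?x m. complex_of_real (r ^ (length (snd \<alpha>) + length (snd \<beta>)))
          * cinner (poisson E r w ?h) (poisson E r w ?g))"
    using src by (intro sum.cong refl)
      (simp add: poisson_path_mult paths_upto_def \<alpha> \<beta> cinner_scaleR_left cinner_scaleR_right power_add)
  ultimately show ?thesis
    unfolding sum_distrib_left [symmetric] poisson_gram [OF E x r] Ph Pg by simp
qed

end

section \<open>The left regular representation\<close>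

locale left_regular = wf_digraph G
  for G :: "('v, 'e) pre_digraph" +
  fixes \<xi> :: "'v \<times> 'e list \<Rightarrow> 'k :: chilbert_space"
  assumes basis: "orthonormal_basis (free_semigroupoid G) \<xi>"
begin

abbreviation "L \<equiv> quiver_L G \<xi>"
abbreviation "Q \<equiv> quiver_P G \<xi>"

definition ending_at :: "'v \<Rightarrow> ('v \<times> 'e list) set" where
  "ending_at x = {w \<in> free_semigroupoid G. path_range G w = x}"

lemma ending_at_subset: "ending_at x \<subseteq> free_semigroupoid G"
  by (auto simp: ending_at_def)

lemma edge_mult_closed:
  "e \<in> arcs G \<Longrightarrow> w \<in> ending_at (tail G e) \<Longrightarrow> edge_mult e w \<in> ending_at (head G e)"
  by (cases w) (simp add: ending_at_def edge_mult_def)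

lemma inj_on_edge_mult: "inj_on (edge_mult e) X"
  by (auto simp: inj_on_def edge_mult_def prod_eq_iff)

lemma edge_mult_image: "e \<in> arcs G \<Longrightarrow> edge_mult e ` ending_at (tail G e) \<subseteq> free_semigroupoid G"
  using edge_mult_closed ending_at_subset by (intro image_subsetI) (meson subsetD)

lemma
  assumes e: "e \<in> arcs G"
  shows L_ops: "L e \<in> bounded_ops"
    and L_basis: "w \<in> free_semigroupoid G \<Longrightarrow>
      blinfun_apply (L e) (\<xi> w) = (if w \<in> ending_at (tail G e) then \<xi> (edge_mult e w) else 0)"
proof -
  obtain T where T: "T \<in> bounded_ops" "\<forall>w\<in>free_semigroupoid G.
      blinfun_apply T (\<xi> w) = (if w \<in> ending_at (tail G e) then \<xi> (edge_mult e w) else 0)"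
    using basis_operator_exists [OF basis inj_on_edge_mult edge_mult_image [OF e]] by (rule bexE)
  have "L e = T"
    unfolding quiver_L_def
  proof (rule the_equality)
    show "T \<in> bounded_ops \<and> (\<forall>w\<in>free_semigroupoid G. blinfun_apply T (\<xi> w) =
        (if path_range G w = tail G e then \<xi> (edge_mult e w) else 0))"
      using T by (simp add: ending_at_def)
    show "T' = T" if "T' \<in> bounded_ops \<and> (\<forall>w\<in>free_semigroupoid G. blinfun_apply T' (\<xi> w) =
        (if path_range G w = tail G e then \<xi> (edge_mult e w) else 0))" for T'
      using that T by (intro orthonormal_basis_operator_eqI [OF basis]) (simp_all add: ending_at_def)
  qed
  then show "L e \<in> bounded_ops" "w \<in> free_semigroupoid G \<Longrightarrow>
      blinfun_apply (L e) (\<xi> w) = (if w \<in> ending_at (tail G e) then \<xi> (edge_mult e w) else 0)"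
    using T by simp_all
qed

lemma
  shows Q_projection: "is_projection (Q x)"
    and Q_basis: "w \<in> free_semigroupoid G \<Longrightarrow>
      blinfun_apply (Q x) (\<xi> w) = (if w \<in> ending_at x then \<xi> w else 0)"
proof -
  have id: "inj_on (\<lambda>w. w) (ending_at x)" "(\<lambda>w. w) ` ending_at x \<subseteq> free_semigroupoid G"
    using ending_at_subset by simp_all
  obtain T where T: "T \<in> bounded_ops" "\<forall>w\<in>free_semigroupoid G.
      blinfun_apply T (\<xi> w) = (if w \<in> ending_at x then \<xi> w else 0)"
    using basis_operator_exists [OF basis id] by (rule bexE)
  then have "is_projection T" "proj_onto (closed_cspan (\<xi> ` ending_at x)) = T"
    using basis_projection [OF basis ending_at_subset [of x], of T] by simp_all
  moreover have "proj_onto (closed_cspan (\<xi> ` ending_at x)) = Q x"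
    by (simp add: quiver_P_def ending_at_def)
  ultimately show "is_projection (Q x)" "w \<in> free_semigroupoid G \<Longrightarrow>
      blinfun_apply (Q x) (\<xi> w) = (if w \<in> ending_at x then \<xi> w else 0)"
    using T by simp_all
qed

lemma Q_ops: "Q x \<in> bounded_ops"
  using Q_projection by (simp add: is_projection_def)

lemma
  assumes e: "e \<in> arcs G"
  shows adj_L_edge_mult: "w \<in> ending_at (tail G e) \<Longrightarrow>
      blinfun_apply (hilbert_adjoint (L e)) (\<xi> (edge_mult e w)) = \<xi> w"
    and adj_L_other: "u \<in> free_semigroupoid G \<Longrightarrow> u \<notin> edge_mult e ` ending_at (tail G e) \<Longrightarrow>
      blinfun_apply (hilbert_adjoint (L e)) (\<xi> u) = 0"
  by (rule basis_operator_adjoint_image [OF basis inj_on_edge_mult edge_mult_image [OF e] ending_at_subset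
        L_ops [OF e] L_basis [OF e]]; assumption)
    (rule basis_operator_adjoint_other [OF basis inj_on_edge_mult edge_mult_image [OF e] ending_at_subset
        L_ops [OF e] L_basis [OF e]]; assumption)

sublocale toeplitz_family G Q L
proof
  show "is_projection (Q x)" for x by (rule Q_projection)
  show "L e \<in> bounded_ops" if "e \<in> arcs G" for e using that by (rule L_ops)
  show "Q x o\<^sub>L Q y = 0" if "x \<noteq> y" for x y
    using that by (intro orthonormal_basis_operator_eqI [OF basis] bounded_ops_intros Q_ops)
      (auto simp: Q_basis ending_at_def)
  show "Q (head G e) o\<^sub>L L e = L e" if e: "e \<in> arcs G" for e
  proof (intro orthonormal_basis_operator_eqI [OF basis] bounded_ops_intros Q_ops L_ops e)
    fix w assume w: "w \<in> free_semigroupoid G"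
    show "blinfun_apply (Q (head G e) o\<^sub>L L e) (\<xi> w) = blinfun_apply (L e) (\<xi> w)"
    proof (cases "w \<in> ending_at (tail G e)")
      case True
      have "edge_mult e w \<in> free_semigroupoid G"
        using edge_mult_closed [OF e True] ending_at_subset by (rule subsetD [rotated])
      then show ?thesis using edge_mult_closed [OF e True] w True by (simp add: L_basis e Q_basis)
    qed (simp add: L_basis e w)
  qed
  show "hilbert_adjoint (L e) o\<^sub>L L f = (if e = f then Q (tail G e) else 0)"
    if e: "e \<in> arcs G" and f: "f \<in> arcs G" for e f
  proof (rule orthonormal_basis_operator_eqI [OF basis])
    show "hilbert_adjoint (L e) o\<^sub>L L f \<in> bounded_ops" by (intro bounded_ops_intros L_ops e f)
    show "(if e = f then Q (tail G e) else 0) \<in> bounded_ops" by (simp add: Q_ops zero_in_bounded_ops)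
    fix w assume w: "w \<in> free_semigroupoid G"
    show "blinfun_apply (hilbert_adjoint (L e) o\<^sub>L L f) (\<xi> w) = blinfun_apply (if e = f then Q (tail G e) else 0) (\<xi> w)"
    proof (cases "w \<in> ending_at (tail G f)")
      case True
      have fw: "edge_mult f w \<in> free_semigroupoid G"
        using edge_mult_closed [OF f True] ending_at_subset by (rule subsetD [rotated])
      have "edge_mult f w \<notin> edge_mult e ` ending_at (tail G e)" if "e \<noteq> f"
        using that by (auto simp: edge_mult_def)
      then show ?thesis
        using True w fw by (cases "e = f") (simp_all add: L_basis f Q_basis adj_L_edge_mult adj_L_other e)
    qed (simp add: L_basis f w Q_basis)
  qed
qed

lemma path_op_basis:
  assumes "\<alpha> \<in> free_semigroupoid G" "w \<in> free_semigroupoid G"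
  shows "blinfun_apply (path_op \<alpha>) (\<xi> w) = (if w \<in> ending_at (fst \<alpha>) then \<xi> (path_mult \<alpha> w) else 0)"
  using assms(1)
proof (induction "snd \<alpha>" arbitrary: \<alpha> rule: rev_induct)
  case Nil
  then have "path_op \<alpha> = Q (fst \<alpha>)" by (simp add: path_op_def)
  then show ?case using assms(2) Nil by (simp add: Q_basis path_mult_def flip: Nil(1))
next
  case (snoc e p)
  define \<beta> where "\<beta> = (fst \<alpha>, p)"
  have "\<alpha> = (fst \<alpha>, p @ [e])" using snoc(2) by (simp add: prod_eq_iff)
  then have *: "\<beta> \<in> free_semigroupoid G" "e \<in> arcs G" "path_range G \<beta> = tail G e"
    using snoc(3) snoc_in_free_semigroupoid unfolding \<beta>_def by metis+
  have "path_op \<alpha> = L e o\<^sub>L path_op \<beta>"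
    by (simp add: path_op_def \<beta>_def flip: snoc(2))
  moreover have "blinfun_apply (path_op \<beta>) (\<xi> w) = (if w \<in> ending_at (fst \<beta>) then \<xi> (path_mult \<beta> w) else 0)"
    using snoc(1) [of \<beta>] *(1) by (simp add: \<beta>_def)
  moreover have "path_mult \<beta> w \<in> free_semigroupoid G" "path_mult \<beta> w \<in> ending_at (tail G e)" if "w \<in> ending_at (fst \<beta>)"
    using that path_mult_closed [of w \<beta>] path_range_mult [of w \<beta>] * by (simp_all add: ending_at_def)
  moreover have "edge_mult e (path_mult \<beta> w) = path_mult \<alpha> w"
    by (simp add: edge_mult_def path_mult_def \<beta>_def flip: snoc(2))
  ultimately show ?case
    using *(2) by (simp add: L_basis \<beta>_def)
qed

lemma path_mult_image: "\<alpha> \<in> free_semigroupoid G \<Longrightarrow> path_mult \<alpha> ` ending_at (fst \<alpha>) \<subseteq> free_semigroupoid G"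
  by (intro image_subsetI path_mult_closed) (simp_all add: ending_at_def)

text \<open>
  A monomial replaces the final part \<open>\<beta>\<close> of a path by \<open>\<alpha>\<close>, and annihilates the paths that do not end
  with \<open>\<beta>\<close> (\<open>monomial_basis_other\<close>).
\<close>

lemma monomial_basis:
  assumes "\<alpha> \<in> free_semigroupoid G" "\<beta> \<in> free_semigroupoid G" "fst \<alpha> = fst \<beta>" "w \<in> ending_at (fst \<beta>)"
  shows "blinfun_apply (monomial \<alpha> \<beta>) (\<xi> (path_mult \<beta> w)) = \<xi> (path_mult \<alpha> w)"
proof -
  have "blinfun_apply (path_adj \<beta>) (\<xi> (path_mult \<beta> w)) = \<xi> w"
    unfolding path_adj_def
    by (rule basis_operator_adjoint_image [OF basis inj_on_path_mult path_mult_image [OF assms(2)] ending_at_subset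
          path_op_ops [OF assms(2)] path_op_basis [OF assms(2)] assms(4)])
  then show ?thesis
    using assms path_op_basis [OF assms(1), of w] by (simp add: monomial_def ending_at_def)
qed

lemma monomial_basis_other:
  assumes "\<beta> \<in> free_semigroupoid G" "v \<in> free_semigroupoid G" "v \<notin> path_mult \<beta> ` ending_at (fst \<beta>)"
  shows "blinfun_apply (monomial \<alpha> \<beta>) (\<xi> v) = 0"
proof -
  have "blinfun_apply (path_adj \<beta>) (\<xi> v) = 0"
    unfolding path_adj_def
    by (rule basis_operator_adjoint_other [OF basis inj_on_path_mult path_mult_image [OF assms(1)] ending_at_subset
          path_op_ops [OF assms(1)] path_op_basis [OF assms(1)] assms(2,3)])
  then show ?thesis by (simp add: monomial_def)
qed

end

section \<open>The algebra generated jointly by two Toeplitz families\<close>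

text \<open>
  That a combination of monomials in the first family determines the one in the second follows only
  from the norm estimate, so both are generated together: \<open>joint_alg\<close> is a *-algebra of pairs, and
  the estimate makes it the graph of a homomorphism.
\<close>

locale toeplitz_pair = A: toeplitz_family G P S + B: toeplitz_family G P' S'
  for G :: "('v, 'e) pre_digraph"
  and P :: "'v \<Rightarrow> ('k :: chilbert_space \<Rightarrow>\<^sub>L 'k)" and S :: "'e \<Rightarrow> ('k \<Rightarrow>\<^sub>L 'k)"
  and P' :: "'v \<Rightarrow> ('h :: chilbert_space \<Rightarrow>\<^sub>L 'h)" and S' :: "'e \<Rightarrow> ('h \<Rightarrow>\<^sub>L 'h)"
begin

inductive_set joint_alg :: "(('k \<Rightarrow>\<^sub>L 'k) \<times> ('h \<Rightarrow>\<^sub>L 'h)) set" where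
  joint_alg_zero: "(0, 0) \<in> joint_alg"
| joint_alg_step: "(a, b) \<in> joint_alg \<Longrightarrow> \<alpha> \<in> free_semigroupoid G \<Longrightarrow> \<beta> \<in> free_semigroupoid G \<Longrightarrow> fst \<alpha> = fst \<beta> \<Longrightarrow>
    (a + scaleC_op c (A.monomial \<alpha> \<beta>), b + scaleC_op c (B.monomial \<alpha> \<beta>)) \<in> joint_alg"

lemma joint_alg_ops: "(a, b) \<in> joint_alg \<Longrightarrow> a \<in> bounded_ops \<and> b \<in> bounded_ops"
  by (induction rule: joint_alg.induct) (simp_all add: bounded_ops_intros A.monomial_ops B.monomial_ops)

lemma joint_alg_monomial:
  "\<alpha> \<in> free_semigroupoid G \<Longrightarrow> \<beta> \<in> free_semigroupoid G \<Longrightarrow> fst \<alpha> = fst \<beta> \<Longrightarrow>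
    (A.monomial \<alpha> \<beta>, B.monomial \<alpha> \<beta>) \<in> joint_alg"
  using joint_alg_step [OF joint_alg_zero, of \<alpha> \<beta> 1] by (simp add: scaleC_op_one)

lemma joint_alg_add:
  assumes "(a, b) \<in> joint_alg" "(a', b') \<in> joint_alg" shows "(a + a', b + b') \<in> joint_alg"
  using assms(2)
proof (induction rule: joint_alg.induct)
  case (joint_alg_step a'' b'' \<alpha> \<beta> c)
  then show ?case using joint_alg.joint_alg_step [of "a + a''" "b + b''" \<alpha> \<beta> c] by (simp add: add.assoc)
qed (simp add: assms(1))

lemma joint_alg_scale: "(a, b) \<in> joint_alg \<Longrightarrow> (scaleC_op k a, scaleC_op k b) \<in> joint_alg"
proof (induction rule: joint_alg.induct)
  case (joint_alg_step a b \<alpha> \<beta> c)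
  then show ?case
    using joint_alg.joint_alg_step [of "scaleC_op k a" "scaleC_op k b" \<alpha> \<beta> "k * c"]
    by (simp add: scaleC_op_add scaleC_op_scaleC_op)
qed (simp add: scaleC_op_zero joint_alg_zero)

lemma joint_alg_diff: "p \<in> joint_alg \<Longrightarrow> q \<in> joint_alg \<Longrightarrow> p - q \<in> joint_alg"
  using joint_alg_add [of "fst p" "snd p" "scaleC_op (complex_of_real (-1)) (fst q)" "scaleC_op (complex_of_real (-1)) (snd q)"]
    joint_alg_scale [of "fst q" "snd q" "complex_of_real (-1)"]
  unfolding scaleC_op_of_real by (simp add: minus_prod_def)

lemma joint_alg_adjoint: "(a, b) \<in> joint_alg \<Longrightarrow> (hilbert_adjoint a, hilbert_adjoint b) \<in> joint_alg"
proof (induction rule: joint_alg.induct)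
  case (joint_alg_step a b \<alpha> \<beta> c)
  then show ?case
    using joint_alg.joint_alg_step [of "hilbert_adjoint a" "hilbert_adjoint b" \<beta> \<alpha> "cnj c"] joint_alg_ops [of a b]
    by (simp add: adjoint_add adjoint_scaleC_op A.adj_monomial B.adj_monomial A.monomial_ops B.monomial_ops
        scaleC_op_in_bounded_ops)
qed (simp add: adjoint_zero joint_alg_zero)

text \<open>
  The pairs by which \<open>joint_alg\<close> can be multiplied from the left are closed under composition. So that
  \<open>joint_alg\<close> is closed under products reduces to the products of one generator and one monomial.
\<close>

definition multiplier :: "('k \<Rightarrow>\<^sub>L 'k) \<Rightarrow> ('h \<Rightarrow>\<^sub>L 'h) \<Rightarrow> bool" where
  "multiplier x y \<longleftrightarrow> (\<forall>a b. (a, b) \<in> joint_alg \<longrightarrow> (x o\<^sub>L a, y o\<^sub>L b) \<in> joint_alg)"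

lemma multiplierI:
  assumes "x \<in> bounded_ops" "y \<in> bounded_ops"
    and mono: "\<And>\<alpha> \<beta>. \<alpha> \<in> free_semigroupoid G \<Longrightarrow> \<beta> \<in> free_semigroupoid G \<Longrightarrow> fst \<alpha> = fst \<beta> \<Longrightarrow>
      (x o\<^sub>L A.monomial \<alpha> \<beta>, y o\<^sub>L B.monomial \<alpha> \<beta>) \<in> joint_alg"
  shows "multiplier x y"
  unfolding multiplier_def
proof (intro allI impI)
  fix a b assume "(a, b) \<in> joint_alg"
  then show "(x o\<^sub>L a, y o\<^sub>L b) \<in> joint_alg"
  proof (induction rule: joint_alg.induct)
    case (joint_alg_step a b \<alpha> \<beta> c)
    then show ?case
      using joint_alg_add [OF joint_alg_step(5) joint_alg_scale [OF mono [OF joint_alg_step(2-4)], of c]] assms(1,2)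
      by (simp add: compose_add compose_scaleC_op)
  qed (simp add: joint_alg_zero)
qed

lemma multiplier_compose: "multiplier x y \<Longrightarrow> multiplier x' y' \<Longrightarrow> multiplier (x o\<^sub>L x') (y o\<^sub>L y')"
  by (simp add: multiplier_def blinfun_compose_assoc)

lemma multiplier_P: "x \<in> verts G \<Longrightarrow> multiplier (P x) (P' x)"
  by (rule multiplierI) (simp_all add: A.P_ops B.P_ops A.P_monomial B.P_monomial joint_alg_monomial joint_alg_zero)

lemma multiplier_S:
  assumes "e \<in> arcs G" shows "multiplier (S e) (S' e)"
proof (rule multiplierI)
  fix \<alpha> \<beta> :: "'v \<times> 'e list"
  assume "\<alpha> \<in> free_semigroupoid G" "\<beta> \<in> free_semigroupoid G" "fst \<alpha> = fst \<beta>"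
  moreover have "edge_mult e \<alpha> \<in> free_semigroupoid G" if "\<alpha> \<in> free_semigroupoid G" "path_range G \<alpha> = tail G e"
    using that assms by (cases \<alpha>) (simp add: edge_mult_def)
  ultimately show "(S e o\<^sub>L A.monomial \<alpha> \<beta>, S' e o\<^sub>L B.monomial \<alpha> \<beta>) \<in> joint_alg"
    using assms by (simp add: A.S_monomial B.S_monomial joint_alg_zero) (simp add: joint_alg_monomial edge_mult_def)
qed (simp_all add: assms A.S_ops B.S_ops)

lemma multiplier_adj_S:
  assumes e: "e \<in> arcs G" shows "multiplier (hilbert_adjoint (S e)) (hilbert_adjoint (S' e))"
proof (rule multiplierI)
  fix \<alpha> \<beta> :: "'v \<times> 'e list"
  assume \<alpha>: "\<alpha> \<in> free_semigroupoid G" and \<beta>: "\<beta> \<in> free_semigroupoid G" and fst: "fst \<alpha> = fst \<beta>"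
  obtain v p where vp: "\<alpha> = (v, p)" by (cases \<alpha>)
  show "(hilbert_adjoint (S e) o\<^sub>L A.monomial \<alpha> \<beta>, hilbert_adjoint (S' e) o\<^sub>L B.monomial \<alpha> \<beta>) \<in> joint_alg"
  proof (cases p rule: rev_cases)
    case Nil
    have v: "v \<in> verts G" and fst\<beta>: "fst \<beta> = v" using \<alpha> fst by (simp_all add: vp Nil)
    have "(A.monomial (tail G e, []) (tail G e, e # snd \<beta>), B.monomial (tail G e, []) (tail G e, e # snd \<beta>)) \<in> joint_alg"
      if "head G e = v"
    proof -
      have "(head G e, snd \<beta>) = \<beta>" using that fst\<beta> by (simp add: prod_eq_iff)
      then show ?thesis using e \<beta> by (intro joint_alg_monomial) simp_all
    qed
    then show ?thesis
      unfolding vp Nil A.adj_S_monomial_Nil [OF e v \<beta> fst\<beta>] B.adj_S_monomial_Nil [OF e v \<beta> fst\<beta>]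
      by (simp add: joint_alg_zero)
  next
    case (snoc q f)
    have vq: "(v, q @ [f]) \<in> free_semigroupoid G" using \<alpha> by (simp only: vp snoc)
    then have "(v, q) \<in> free_semigroupoid G" by simp
    then have "(A.monomial (v, q) \<beta>, B.monomial (v, q) \<beta>) \<in> joint_alg"
      using \<beta> fst by (intro joint_alg_monomial) (simp_all add: vp)
    then show ?thesis
      unfolding vp snoc A.adj_S_monomial_snoc [OF e vq] B.adj_S_monomial_snoc [OF e vq]
      by (simp add: joint_alg_zero)
  qed
qed (simp_all add: e A.S_ops B.S_ops adjoint_in_bounded_ops)

lemma multiplier_path:
  assumes "w \<in> free_semigroupoid G"
  shows "multiplier (A.path_op w) (B.path_op w) \<and> multiplier (A.path_adj w) (B.path_adj w)"
  using assms
proof (induction "snd w" arbitrary: w rule: rev_induct)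
  case Nil
  then obtain v where "w = (v, [])" by (cases w) simp
  then show ?case
    using Nil(2) by (simp add: A.path_op_Nil B.path_op_Nil A.path_adj_Nil B.path_adj_Nil multiplier_P)
next
  case (snoc e p)
  then obtain v where w: "w = (v, p @ [e])" by (cases w) simp
  have v: "(v, p) \<in> free_semigroupoid G" and e: "e \<in> arcs G" using snoc(3) by (simp_all add: w)
  have IH: "multiplier (A.path_op (v, p)) (B.path_op (v, p))" "multiplier (A.path_adj (v, p)) (B.path_adj (v, p))"
    using snoc(1) [of "(v, p)"] v by simp_all
  have "A.path_adj w = A.path_adj (v, p) o\<^sub>L hilbert_adjoint (S e)"
    "B.path_adj w = B.path_adj (v, p) o\<^sub>L hilbert_adjoint (S' e)"
    by (simp_all add: w A.path_adj_def B.path_adj_def A.path_op_snoc B.path_op_snoc adjoint_compose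
        A.S_ops B.S_ops A.path_op_ops B.path_op_ops v e)
  then show ?case
    unfolding w A.path_op_snoc B.path_op_snoc
    by (simp add: multiplier_compose IH multiplier_S multiplier_adj_S e)
qed

lemma joint_alg_compose:
  assumes "(a, b) \<in> joint_alg" "(a', b') \<in> joint_alg" shows "(a o\<^sub>L a', b o\<^sub>L b') \<in> joint_alg"
  using assms(1)
proof (induction rule: joint_alg.induct)
  case (joint_alg_step a b \<alpha> \<beta> c)
  have "multiplier (A.monomial \<alpha> \<beta>) (B.monomial \<alpha> \<beta>)"
    unfolding A.monomial_def B.monomial_def using multiplier_path joint_alg_step(2,3) by (intro multiplier_compose) simp_all
  then have "(A.monomial \<alpha> \<beta> o\<^sub>L a', B.monomial \<alpha> \<beta> o\<^sub>L b') \<in> joint_alg"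
    using assms(2) by (simp add: multiplier_def)
  from joint_alg_add [OF joint_alg_step(5) joint_alg_scale [OF this, of c]] show ?case
    by (simp add: compose_add scaleC_op_compose)
qed (simp add: joint_alg_zero)

lemma joint_alg_P: "x \<in> verts G \<Longrightarrow> (P x, P' x) \<in> joint_alg"
  using joint_alg_monomial [of "(x, [])" "(x, [])"]
  by (simp add: A.monomial_def B.monomial_def A.path_op_Nil B.path_op_Nil A.path_adj_Nil B.path_adj_Nil A.P_idem B.P_idem)

lemma joint_alg_S:
  assumes "e \<in> arcs G" shows "(S e, S' e) \<in> joint_alg"
  using multiplier_S [OF assms] joint_alg_P [of "tail G e"] assms
  by (auto simp: multiplier_def A.S_P_tail B.S_P_tail dest!: spec [of _ "P (tail G e)"])

end

section \<open>The norm estimate\<close>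

text \<open>
  This is where countability of the graph enters: the estimate is a limit along a sequence of finite
  sets of vertices and edges.
\<close>

lemma countable_exhaustion:
  assumes "countable A"
  obtains F :: "nat \<Rightarrow> 'a set" where "\<And>k. finite (F k)" "\<And>k. F k \<subseteq> A"
    "\<And>X. finite X \<Longrightarrow> X \<subseteq> A \<Longrightarrow> \<forall>\<^sub>F k in sequentially. X \<subseteq> F k"
proof
  let ?F = "\<lambda>k. {a \<in> A. to_nat_on A a \<le> k}"
  have inj: "inj_on (to_nat_on A) A" using assms by (rule inj_on_to_nat_on)
  show "finite (?F k)" for k
  proof (rule finite_imageD)
    show "finite (to_nat_on A ` ?F k)" by (rule finite_subset [of _ "{..k}"]) auto
    show "inj_on (to_nat_on A) (?F k)" using inj by (rule inj_on_subset) simp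
  qed
  show "?F k \<subseteq> A" for k by simp
  show "\<forall>\<^sub>F k in sequentially. X \<subseteq> ?F k" if "finite X" "X \<subseteq> A" for X
  proof -
    have "\<forall>\<^sub>F k in sequentially. \<forall>a\<in>X. to_nat_on A a \<le> k"
      using that(1) by (intro eventually_ball_finite ballI eventually_ge_at_top)
    then show ?thesis by eventually_elim (use that(2) in \<open>auto simp: subset_iff\<close>)
  qed
qed

locale quiver_comparison = left_regular G \<xi> + B: toeplitz_family G P' S'
  for G :: "('v, 'e) pre_digraph"
  and \<xi> :: "'v \<times> 'e list \<Rightarrow> 'k :: chilbert_space"
  and P' :: "'v \<Rightarrow> ('h :: chilbert_space \<Rightarrow>\<^sub>L 'h)" and S' :: "'e \<Rightarrow> ('h \<Rightarrow>\<^sub>L 'h)" +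
  assumes countable_verts: "countable (verts G)" and countable_arcs: "countable (arcs G)"
begin

sublocale toeplitz_pair G Q L P' S' ..

text \<open>
  The coefficient $\langle (a \otimes 1) K h, K g \rangle$ of the truncated kernel \<open>K\<close>.
\<close>

definition compression :: "'e set \<Rightarrow> 'v set \<Rightarrow> real \<Rightarrow> nat \<Rightarrow> ('k \<Rightarrow>\<^sub>L 'k) \<Rightarrow> 'h \<Rightarrow> 'h \<Rightarrow> complex" where
  "compression E V r N a h g =
    (\<Sum>v\<in>(\<Union>x\<in>V. paths_upto E x N). \<Sum>u\<in>(\<Union>x\<in>V. paths_upto E x N).
      cinner (blinfun_apply a (\<xi> v)) (\<xi> u) * cinner (B.poisson E r v h) (B.poisson E r u g))"

lemma finite_window:
  "finite E \<Longrightarrow> E \<subseteq> arcs G \<Longrightarrow> finite V \<Longrightarrow> V \<subseteq> verts G \<Longrightarrow> finite (\<Union>x\<in>V. paths_upto E x N)"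
  by (intro finite_UN_I finite_paths_upto) auto

lemma window_subset: "(\<Union>x\<in>V. paths_upto E x N) \<subseteq> free_semigroupoid G"
  by (auto simp: paths_upto_def)

lemma compression_le:
  assumes E: "finite E" "E \<subseteq> arcs G" and V: "finite V" "V \<subseteq> verts G" and r: "0 \<le> r" "r \<le> 1"
    and a: "a \<in> bounded_ops"
  shows "cmod (compression E V r N a h g) \<le> norm a * (norm h * norm g)"
proof -
  let ?W = "\<Union>x\<in>V. paths_upto E x N"
  have "cmod (compression E V r N a h g) \<le> norm a *
      (sqrt (\<Sum>v\<in>?W. (norm (B.poisson E r v h))\<^sup>2) * sqrt (\<Sum>u\<in>?W. (norm (B.poisson E r u g))\<^sup>2))"
    unfolding compression_def
    by (intro amplification_bound a finite_window E V
        orthonormal_subset [OF orthonormal_basis_orthonormal [OF basis] window_subset])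
  also have "\<dots> \<le> norm a * (norm h * norm g)"
    by (intro mult_left_mono mult_mono real_le_lsqrt B.poisson_norm_le E V r real_sqrt_ge_zero sum_nonneg) simp_all
  finally show ?thesis .
qed

lemma compression_add: "compression E V r N (a + b) h g = compression E V r N a h g + compression E V r N b h g"
  by (simp add: compression_def blinfun.add_left cinner_add_left distrib_right sum.distrib)

lemma compression_scaleC: "compression E V r N (scaleC_op c a) h g = c * compression E V r N a h g"
  by (simp add: compression_def scaleC_op_apply cinner_scaleC_left sum_distrib_left mult.assoc)

text \<open>
  A matrix entry of \<open>L\<^sub>\<alpha> L\<^sub>\<beta>\<^sup>*\<close> is one at \<open>(\<beta>w, \<alpha>w)\<close> and zero elsewhere. Both \<open>\<alpha>w\<close> and \<open>\<beta>w\<close> have length at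
  most \<open>N\<close> precisely if the length of \<open>w\<close> is at most \<open>N\<close> minus the greater of the two lengths, which is \<open>m\<close>.
\<close>

lemma compression_monomial:
  assumes E: "finite E" "E \<subseteq> arcs G" and V: "finite V" "V \<subseteq> verts G"
    and \<alpha>: "\<alpha> \<in> free_semigroupoid G" "set (snd \<alpha>) \<subseteq> E" "path_range G \<alpha> \<in> V"
    and \<beta>: "\<beta> \<in> free_semigroupoid G" "set (snd \<beta>) \<subseteq> E" "path_range G \<beta> \<in> V"
    and src: "fst \<alpha> = fst \<beta>" and N: "N = m + max (length (snd \<alpha>)) (length (snd \<beta>))"
  shows "compression E V r N (monomial \<alpha> \<beta>) h g =
    (\<Sum>w\<in>paths_upto E (fst \<alpha>) m. cinner (B.poisson E r (path_mult \<beta> w) h) (B.poisson E r (path_mult \<alpha> w) g))"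
proof -
  let ?W = "\<Union>x\<in>V. paths_upto E x N"
  define t where "t p = cinner (blinfun_apply (monomial \<alpha> \<beta>) (\<xi> (fst p))) (\<xi> (snd p)) *
    cinner (B.poisson E r (fst p) h) (B.poisson E r (snd p) g)" for p
  let ?j = "\<lambda>w. (path_mult \<beta> w, path_mult \<alpha> w)"
  let ?U = "paths_upto E (fst \<alpha>) m"
  have U: "w \<in> free_semigroupoid G" "path_range G w = fst \<alpha>" "path_range G w = fst \<beta>" "w \<in> ending_at (fst \<beta>)" if "w \<in> ?U" for w
    using that src by (simp_all add: paths_upto_def ending_at_def)
  have sub: "?j ` ?U \<subseteq> ?W \<times> ?W"
  proof (intro image_subsetI SigmaI)
    fix w assume w: "w \<in> ?U"
    have "path_mult \<gamma> w \<in> paths_upto E (path_range G \<gamma>) N"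
      if "\<gamma> \<in> free_semigroupoid G" "set (snd \<gamma>) \<subseteq> E" "fst \<gamma> = fst \<alpha>"
        "length (snd \<gamma>) \<le> max (length (snd \<alpha>)) (length (snd \<beta>))" for \<gamma>
      using path_mult_closed [of w \<gamma>] path_range_mult [of w \<gamma>] that w U [OF w] N
      by (auto simp: paths_upto_def path_mult_def)
    from this [of \<alpha>] this [of \<beta>] show "path_mult \<beta> w \<in> ?W" "path_mult \<alpha> w \<in> ?W"
      using \<alpha> \<beta> src by (auto intro!: UN_I)
  qed
  have mem: "fst p \<in> ?W" "snd p \<in> ?W" if "p \<in> ?W \<times> ?W - ?j ` ?U" for p
    using that by (simp_all only: Diff_iff mem_Times_iff)
  have zero: "t p = 0" if p: "p \<in> ?W \<times> ?W - ?j ` ?U" for p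
  proof (cases "fst p \<in> path_mult \<beta> ` ending_at (fst \<beta>)")
    case True
    then obtain w where w: "w \<in> ending_at (fst \<beta>)" "fst p = path_mult \<beta> w" by (rule imageE)
    have wF: "w \<in> free_semigroupoid G" "path_range G w = fst \<alpha>" using w(1) src by (simp_all add: ending_at_def)
    have "snd p \<noteq> path_mult \<alpha> w"
    proof
      assume eq: "snd p = path_mult \<alpha> w"
      have "set (snd w) \<subseteq> E" "length (snd w) + length (snd \<beta>) \<le> N" "length (snd w) + length (snd \<alpha>) \<le> N"
        using mem [OF p] unfolding w(2) eq by (auto simp: paths_upto_def path_mult_def)
      then have "w \<in> ?U" using wF N by (auto simp: paths_upto_def)
      then have "?j w \<in> ?j ` ?U" by (rule imageI)
      moreover have "p = ?j w" using w(2) eq by (simp add: prod_eq_iff)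
      ultimately show False using p by simp
    qed
    then have "cinner (\<xi> (path_mult \<alpha> w)) (\<xi> (snd p)) = 0"
      using path_mult_closed [OF wF(1) \<alpha>(1) wF(2)] subsetD [OF window_subset mem(2) [OF p]]
      by (simp add: orthonormalD [OF orthonormal_basis_orthonormal [OF basis]])
    then show ?thesis
      unfolding t_def w(2) monomial_basis [OF \<alpha>(1) \<beta>(1) src w(1)] by simp
  next
    case False
    have "fst p \<in> free_semigroupoid G" using mem(1) [OF p] by (rule subsetD [OF window_subset])
    then show ?thesis
      unfolding t_def by (simp add: monomial_basis_other [OF \<beta>(1) _ False] cinner.zero_left)
  qed
  have "compression E V r N (monomial \<alpha> \<beta>) h g = (\<Sum>p\<in>?W \<times> ?W. t p)"
    by (simp add: compression_def t_def sum.cartesian_product case_prod_unfold)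
  also have "\<dots> = (\<Sum>p\<in>?j ` ?U. t p)"
    using finite_window [OF E V] sub zero by (intro sum.mono_neutral_right ballI finite_cartesian_product)
  also have "\<dots> = (\<Sum>w\<in>?U. t (?j w))"
  proof (subst sum.reindex)
    show "inj_on ?j ?U" by (auto simp: inj_on_def path_mult_def prod_eq_iff)
  qed simp
  also have "\<dots> = (\<Sum>w\<in>?U. cinner (B.poisson E r (path_mult \<beta> w) h) (B.poisson E r (path_mult \<alpha> w) g))"
  proof (rule sum.cong [OF refl])
    fix w assume w: "w \<in> ?U"
    have "cinner (\<xi> (path_mult \<alpha> w)) (\<xi> (path_mult \<alpha> w)) = 1"
      using path_mult_closed [OF U(1) [OF w] \<alpha>(1) U(2) [OF w]]
      by (simp add: orthonormalD [OF orthonormal_basis_orthonormal [OF basis]])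
    then show "t (?j w) = cinner (B.poisson E r (path_mult \<beta> w) h) (B.poisson E r (path_mult \<alpha> w) g)"
      by (simp add: t_def monomial_basis [OF \<alpha>(1) \<beta>(1) src U(4) [OF w]])
  qed
  finally show ?thesis .
qed

text \<open>
  The compressions of \<open>a\<close> are bounded by \<open>\<parallel>a\<parallel>\<close> and converge to the coefficients of \<open>b\<close>. By linearity
  the convergence has to be checked on monomials only, where it is \<open>poisson_intertwine\<close>.
\<close>

lemma joint_alg_norm_le:
  assumes "(a, b) \<in> joint_alg" shows "norm b \<le> norm a"
proof -
  obtain F :: "nat \<Rightarrow> 'e set" where F: "\<And>k. finite (F k)" "\<And>k. F k \<subseteq> arcs G"
    "\<And>X. finite X \<Longrightarrow> X \<subseteq> arcs G \<Longrightarrow> \<forall>\<^sub>F k in sequentially. X \<subseteq> F k"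
    by (rule countable_exhaustion [OF countable_arcs]) blast
  obtain V :: "nat \<Rightarrow> 'v set" where V: "\<And>k. finite (V k)" "\<And>k. V k \<subseteq> verts G"
    "\<And>X. finite X \<Longrightarrow> X \<subseteq> verts G \<Longrightarrow> \<forall>\<^sub>F k in sequentially. X \<subseteq> V k"
    by (rule countable_exhaustion [OF countable_verts]) blast
  \<comment> \<open>\<open>r k\<close> tends to 1 so slowly that its power with exponent \<open>(k + 1)\<^sup>2\<close> is \<open>(1/2) ^ (k + 1)\<close>; the summand \<open>k\<close>
      in \<open>N k\<close> makes up for the lengths of \<open>\<alpha>\<close> and \<open>\<beta>\<close>, which are subtracted from \<open>N k\<close>, once \<open>k\<close> exceeds them\<close>
  define r where "r k = root (Suc k) (1/2)" for k
  define N where "N k = Suc k * Suc k + k" for k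
  have r: "0 \<le> r k" "r k \<le> 1" for k
    by (simp_all add: r_def)
  have r1: "r \<longlonglongrightarrow> 1"
    unfolding r_def by (rule LIMSEQ_Suc [OF LIMSEQ_root_const]) simp
  have r_pow: "r k ^ (Suc k * Suc k) = (1/2) ^ Suc k" for k
  proof -
    have "r k ^ Suc k = 1/2" unfolding r_def by (rule real_root_pow_pos) simp_all
    then show ?thesis by (simp only: power_mult)
  qed
  define \<Phi> where "\<Phi> k = compression (F k) (V k) (r k) (N k)" for k
  have monomial_lim: "(\<lambda>k. \<Phi> k (monomial \<alpha> \<beta>) h g) \<longlonglongrightarrow> cinner (blinfun_apply (B.monomial \<alpha> \<beta>) h) g"
    if \<alpha>: "\<alpha> \<in> free_semigroupoid G" and \<beta>: "\<beta> \<in> free_semigroupoid G" and src: "fst \<alpha> = fst \<beta>"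
    for \<alpha> \<beta> :: "'v \<times> 'e list" and h g
  proof -
    let ?l = "length (snd \<alpha>) + length (snd \<beta>)"
    let ?d = "max (length (snd \<alpha>)) (length (snd \<beta>))"
    let ?h = "blinfun_apply (B.path_adj \<beta>) h" and ?g = "blinfun_apply (B.path_adj \<alpha>) g"
    let ?X = "cinner (blinfun_apply (B.monomial \<alpha> \<beta>) h) g"
    define m where "m k = N k - ?d" for k
    define \<epsilon> where "\<epsilon> k = complex_of_real (r k ^ (2 * Suc (m k))) * B.gram (F k) (fst \<alpha>) (Suc (m k)) ?h ?g" for k
    have arcs: "set (snd \<alpha>) \<subseteq> arcs G" "set (snd \<beta>) \<subseteq> arcs G"
      using \<alpha> \<beta> by (auto simp: free_semigroupoid_def awalk_def)
    have x: "fst \<alpha> \<in> verts G" using \<alpha> by (rule fst_in_verts)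
    have "\<forall>\<^sub>F k in sequentially. set (snd \<alpha>) \<union> set (snd \<beta>) \<subseteq> F k" by (intro F(3)) (simp_all add: arcs)
    moreover have "\<forall>\<^sub>F k in sequentially. {path_range G \<alpha>, path_range G \<beta>} \<subseteq> V k"
      by (intro V(3)) (simp_all add: path_range_in_verts \<alpha> \<beta>)
    moreover have big: "\<forall>\<^sub>F k in sequentially. ?d \<le> k" by (rule eventually_ge_at_top)
    ultimately have ev: "\<forall>\<^sub>F k in sequentially. complex_of_real (r k ^ ?l) * (?X - \<epsilon> k) = \<Phi> k (monomial \<alpha> \<beta>) h g"
    proof eventually_elim
      case (elim k)
      have "N k = m k + ?d" using elim(3) by (simp add: m_def N_def)
      then have "\<Phi> k (monomial \<alpha> \<beta>) h g =
          (\<Sum>w\<in>paths_upto (F k) (fst \<alpha>) (m k). cinner (B.poisson (F k) (r k) (path_mult \<beta> w) h) (B.poisson (F k) (r k) (path_mult \<alpha> w) g))"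
        unfolding \<Phi>_def using elim(1,2) by (intro compression_monomial F V \<alpha> \<beta> src) simp_all
      then show ?case
        unfolding B.poisson_intertwine [OF F(1,2) r \<alpha> \<beta> src] by (simp add: \<epsilon>_def)
    qed
    have dom: "\<forall>\<^sub>F k in sequentially. norm (\<epsilon> k) \<le> (norm ?h * norm ?g) * (1/2) ^ Suc k"
      using big
    proof eventually_elim
      case (elim k)
      have "N k - k \<le> m k" unfolding m_def using elim by (rule diff_le_mono2)
      then have "Suc k * Suc k \<le> m k" by (simp only: N_def add_diff_cancel_right')
      then have "Suc k * Suc k \<le> 2 * Suc (m k)" by (rule le_trans) simp
      then have "r k ^ (2 * Suc (m k)) \<le> (1/2) ^ Suc k"
        unfolding r_pow [symmetric] by (intro power_decreasing r)
      moreover have "cmod (B.gram (F k) (fst \<alpha>) (Suc (m k)) ?h ?g) \<le> norm ?h * norm ?g"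
        by (intro B.norm_gram_le F x)
      ultimately have "r k ^ (2 * Suc (m k)) * cmod (B.gram (F k) (fst \<alpha>) (Suc (m k)) ?h ?g)
          \<le> (1/2) ^ Suc k * (norm ?h * norm ?g)"
        using r by (intro mult_mono) simp_all
      moreover have "norm (\<epsilon> k) = r k ^ (2 * Suc (m k)) * cmod (B.gram (F k) (fst \<alpha>) (Suc (m k)) ?h ?g)"
        unfolding \<epsilon>_def norm_mult norm_of_real using r [of k] by simp
      ultimately show ?case by (simp only: mult.commute)
    qed
    have "(\<lambda>k. (norm ?h * norm ?g) * (1/2) ^ Suc k) \<longlonglongrightarrow> (norm ?h * norm ?g) * 0"
      by (intro tendsto_mult tendsto_const LIMSEQ_Suc LIMSEQ_power_zero) simp
    then have "\<epsilon> \<longlonglongrightarrow> 0"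
      by (intro Lim_null_comparison [OF dom]) (simp only: mult_zero_right)
    then have "(\<lambda>k. complex_of_real (r k ^ ?l) * (?X - \<epsilon> k)) \<longlonglongrightarrow> complex_of_real (1 ^ ?l) * (?X - 0)"
      by (intro tendsto_mult tendsto_diff tendsto_const tendsto_of_real tendsto_power r1)
    then have "(\<lambda>k. \<Phi> k (monomial \<alpha> \<beta>) h g) \<longlonglongrightarrow> complex_of_real (1 ^ ?l) * (?X - 0)"
      by (rule Lim_transform_eventually [OF _ ev])
    then show ?thesis by simp
  qed
  have lim: "(\<lambda>k. \<Phi> k a h g) \<longlonglongrightarrow> cinner (blinfun_apply b h) g" for h g
    using assms
  proof (induction rule: joint_alg.induct)
    case joint_alg_zero
    show ?case by (simp add: \<Phi>_def compression_def cinner.zero_left)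
  next
    case (joint_alg_step a b \<alpha> \<beta> c)
    have "(\<lambda>k. \<Phi> k a h g + c * \<Phi> k (monomial \<alpha> \<beta>) h g)
        \<longlonglongrightarrow> cinner (blinfun_apply b h) g + c * cinner (blinfun_apply (B.monomial \<alpha> \<beta>) h) g"
      by (intro tendsto_add tendsto_mult tendsto_const monomial_lim joint_alg_step)
    then show ?case
      by (simp add: \<Phi>_def compression_add compression_scaleC blinfun.add_left cinner_add_left
          scaleC_op_apply cinner_scaleC_left)
  qed
  have a: "a \<in> bounded_ops" using joint_alg_ops [OF assms] by simp
  show ?thesis
  proof (rule norm_blinfun_bound)
    fix h
    let ?g = "blinfun_apply b h"
    have "(\<lambda>k. norm (\<Phi> k a h ?g)) \<longlonglongrightarrow> norm (cinner ?g ?g)"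
      by (intro tendsto_norm lim)
    then have "norm (cinner ?g ?g) \<le> norm a * (norm h * norm ?g)"
      by (rule LIMSEQ_le_const2) (simp add: \<Phi>_def compression_le F V r a)
    then have "norm ?g * norm ?g \<le> norm a * norm h * norm ?g"
      by (simp add: cinner_self norm_mult power2_eq_square mult.assoc)
    then show "norm ?g \<le> norm a * norm h"
      by (cases "norm ?g = 0") auto
  qed simp
qed

end

section \<open>C*-subalgebras under a contractive *-homomorphism\<close>

lemma cstar_subalgebra_preimage:
  fixes \<tau> :: "('a :: chilbert_space \<Rightarrow>\<^sub>L 'a) \<Rightarrow> ('b :: chilbert_space \<Rightarrow>\<^sub>L 'b)"
  assumes A: "cstar_subalgebra A" and B: "cstar_subalgebra B" and \<tau>: "star_hom A bounded_ops \<tau>"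
    and contr: "\<And>T. T \<in> A \<Longrightarrow> norm (\<tau> T) \<le> norm T"
  shows "cstar_subalgebra {T \<in> A. \<tau> T \<in> B}"
proof -
  have "closed {T \<in> A. \<tau> T \<in> B}"
    unfolding closed_sequential_limits
  proof (intro allI impI, elim conjE)
    fix X T assume X: "\<forall>n. X n \<in> {T \<in> A. \<tau> T \<in> B}" and lim: "X \<longlonglongrightarrow> T"
    have XA: "X n \<in> A" for n using X by simp
    have TA: "T \<in> A" by (rule closed_sequentially [OF cstar_subalgebraD(6) [OF A] XA lim])
    have "dist (\<tau> (X n)) (\<tau> T) \<le> dist (X n) T" for n
      using contr [of "X n - T"] subspace_diff [OF cstar_subalgebra_subspace [OF A] XA TA]
      by (simp add: dist_norm star_hom_diff [OF A \<tau> XA TA])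
    then have "(\<lambda>n. \<tau> (X n)) \<longlonglongrightarrow> \<tau> T"
      by (intro metric_tendsto_imp_tendsto [OF lim] always_eventually) simp
    then have "\<tau> T \<in> B"
      by (rule closed_sequentially [OF cstar_subalgebraD(6) [OF B], rotated]) (use X in simp)
    with TA show "T \<in> {T \<in> A. \<tau> T \<in> B}" by simp
  qed
  moreover have "\<tau> 0 = 0"
    using star_hom_diff [OF A \<tau>, of 0 0] cstar_subalgebraD(2) [OF A] by simp
  ultimately show ?thesis
    unfolding cstar_subalgebra_def closed_subalgebra_def
    using cstar_subalgebraD [OF A] cstar_subalgebraD [OF B] star_homD [OF \<tau>] by (auto simp: subset_iff)
qed

lemma cstar_subalgebra_image:
  fixes \<tau> :: "('a :: chilbert_space \<Rightarrow>\<^sub>L 'a) \<Rightarrow> ('b :: chilbert_space \<Rightarrow>\<^sub>L 'b)"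
  assumes A: "cstar_subalgebra A" and \<tau>: "star_hom A bounded_ops \<tau>"
    and contr: "\<And>T. T \<in> A \<Longrightarrow> norm (\<tau> T) \<le> norm T"
  shows "cstar_subalgebra (\<tau> ` A)"
proof -
  have "\<tau> 0 = 0"
    using star_hom_diff [OF A \<tau>, of 0 0] cstar_subalgebraD(2) [OF A] by simp
  then have "0 \<in> \<tau> ` A" by (metis cstar_subalgebraD(2) [OF A] imageI)
  moreover have "\<tau> ` A \<subseteq> bounded_ops" using star_homD(1) [OF \<tau>] by (rule image_subsetI)
  moreover have "\<tau> S + \<tau> T \<in> \<tau> ` A" "\<tau> S o\<^sub>L \<tau> T \<in> \<tau> ` A" if "S \<in> A" "T \<in> A" for S T
    unfolding star_homD(2,4) [OF \<tau> that, symmetric] by (intro imageI cstar_subalgebraD [OF A] that)+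
  moreover have "scaleC_op c (\<tau> T) \<in> \<tau> ` A" "hilbert_adjoint (\<tau> T) \<in> \<tau> ` A" if "T \<in> A" for c T
    unfolding star_homD(3,5) [OF \<tau> that, symmetric] by (intro imageI cstar_subalgebraD [OF A] that)+
  ultimately show ?thesis
    using closed_image_star_hom [OF A \<tau> contr]
    unfolding cstar_subalgebra_def closed_subalgebra_def by (simp add: ball_simps)
qed

section \<open>The epimorphism\<close>

text \<open>
  The inequality for the strongly convergent sum gives $\|S_e^* h\|^2 \le \langle P_x h, h \rangle$ for
  each edge \<open>e\<close> with range \<open>x\<close>, so $S_e^*$ vanishes on the kernel of $P_x$.
\<close>

lemma toeplitz_family_of_dagger_relations:
  fixes P :: "'v \<Rightarrow> ('h :: chilbert_space \<Rightarrow>\<^sub>L 'h)"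
  assumes "wf_digraph G" "dagger_relations G P S"
  shows "toeplitz_family G P S"
proof -
  interpret wf_digraph G by fact
  note dag = assms(2) [unfolded dagger_relations_def]
  have proj: "is_projection (P x)" if "x \<in> verts G" for x using dag that by simp
  have S: "S e \<in> bounded_ops" if "e \<in> arcs G" for e using dag that by (simp add: partial_isometry_def)
  have head: "P (head G e) o\<^sub>L S e = S e" if e: "e \<in> arcs G" for e
  proof -
    define x where "x = head G e"
    have x: "x \<in> verts G" using e by (simp add: x_def)
    have P: "P x \<in> bounded_ops" "P x o\<^sub>L P x = P x" "hilbert_adjoint (P x) = P x"
      using proj [OF x] by (simp_all add: is_projection_def)
    obtain T where T: "\<And>h. ((\<lambda>f. blinfun_apply (S f o\<^sub>L hilbert_adjoint (S f)) h) has_sum blinfun_apply T h)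
        {f \<in> arcs G. head G f = x}" and le: "op_le T (P x)"
      using dag x by meson
    have zero: "blinfun_apply (hilbert_adjoint (S e)) h = 0" if Ph: "blinfun_apply (P x) h = 0" for h
    proof -
      have sum: "((\<lambda>f. inner (blinfun_apply (S f o\<^sub>L hilbert_adjoint (S f)) h) h) has_sum inner (blinfun_apply T h) h)
          {f \<in> arcs G. head G f = x}"
        using has_sum_bounded_linear [OF bounded_linear_inner_left T] by (simp add: o_def)
      have eq: "inner (blinfun_apply (S f o\<^sub>L hilbert_adjoint (S f)) h) h
          = (norm (blinfun_apply (hilbert_adjoint (S f)) h))\<^sup>2" if "f \<in> arcs G" for f
        using that by (simp add: inner_eq_Re_cinner cinner_adjoint S cinner_self)
      have squares: "((\<lambda>f. (norm (blinfun_apply (hilbert_adjoint (S f)) h))\<^sup>2) has_sum inner (blinfun_apply T h) h)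
          {f \<in> arcs G. head G f = x}"
        using sum by (rule has_sum_cong [THEN iffD1, rotated]) (rule eq, simp)
      have "(\<Sum>f\<in>{e}. (norm (blinfun_apply (hilbert_adjoint (S f)) h))\<^sup>2) \<le> inner (blinfun_apply T h) h"
        by (rule has_sum_mono_neutral [OF has_sum_finite squares]) (use e in \<open>simp_all add: x_def\<close>)
      then have "(norm (blinfun_apply (hilbert_adjoint (S e)) h))\<^sup>2 \<le> inner (blinfun_apply T h) h"
        by simp
      moreover have "0 \<le> Re (cinner (blinfun_apply (P x - T) h) h)"
        using le by (auto simp: op_le_def complex_nonneg_Reals_iff)
      then have "inner (blinfun_apply T h) h \<le> 0"
        by (simp add: blinfun.diff_left Ph cinner.minus_left inner_eq_Re_cinner)
      ultimately have "(norm (blinfun_apply (hilbert_adjoint (S e)) h))\<^sup>2 \<le> 0" by linarith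
      then show ?thesis by simp
    qed
    have "hilbert_adjoint (S e) o\<^sub>L P x = hilbert_adjoint (S e)"
    proof (rule blinfun_eqI)
      fix h
      have "blinfun_apply (P x) (blinfun_apply (P x) h) = blinfun_apply (P x) h"
        using P(2) by (metis blinfun_apply_blinfun_compose)
      then have "blinfun_apply (hilbert_adjoint (S e)) (blinfun_apply (P x) h - h) = 0"
        by (intro zero) (simp add: blinfun.diff_right)
      then show "blinfun_apply (hilbert_adjoint (S e) o\<^sub>L P x) h = blinfun_apply (hilbert_adjoint (S e)) h"
        by (simp add: blinfun.diff_right)
    qed
    then have "hilbert_adjoint (hilbert_adjoint (S e) o\<^sub>L P x) = S e"
      by (simp add: adjoint_adjoint S e)
    then show ?thesis
      unfolding x_def [symmetric]
      by (simp add: adjoint_compose adjoint_in_bounded_ops S e P adjoint_adjoint)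
  qed
  show ?thesis
    by unfold_locales (use dag head S in auto)
qed

theorem theorem7p5:
  fixes G :: "('v, 'e) pre_digraph"
    and \<xi> :: "'v \<times> 'e list \<Rightarrow> 'k :: chilbert_space"
    and P' :: "'v \<Rightarrow> ('h :: chilbert_space \<Rightarrow>\<^sub>L 'h)"
    and S' :: "'e \<Rightarrow> ('h \<Rightarrow>\<^sub>L 'h)"
  assumes "wf_digraph G" and "countable (verts G)" and "countable (arcs G)"
    and "no_sources G" and "no_sinks G"
    and "orthonormal_basis (free_semigroupoid G) \<xi>"
    and "dagger_relations G P' S'"
  shows "\<exists>\<tau>. star_epi (cstar_generated (quiver_algebra G \<xi>)) (cstar_generated (S' ` arcs G)) \<tau> \<and>
           (\<forall>e\<in>arcs G. \<tau> (quiver_L G \<xi> e) = S' e)"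
proof -
  interpret quiver_comparison G \<xi> P' S'
    using assms by (intro quiver_comparison.intro left_regular.intro toeplitz_family_of_dagger_relations
        left_regular_axioms.intro quiver_comparison_axioms.intro)
  let ?R = "closure joint_alg"
  have R_sub: "joint_alg \<subseteq> ?R" by (rule closure_subset)
  have R_ops: "a \<in> bounded_ops" "b \<in> bounded_ops" if "(a, b) \<in> ?R" for a b
  proof -
    have "?R \<subseteq> bounded_ops \<times> bounded_ops"
      by (rule closure_minimal) (use joint_alg_ops in \<open>auto intro: closed_Times closed_bounded_ops\<close>)
    with that show "a \<in> bounded_ops" "b \<in> bounded_ops" by auto
  qed
  have R_unique: "b = b'" if "(a, b) \<in> ?R" "(a, b') \<in> ?R" for a b b'
    by (rule contraction_closure_unique [of joint_alg, OF joint_alg_norm_le joint_alg_diff that])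
  have R_norm: "norm b \<le> norm a" if "(a, b) \<in> ?R" for a b
    by (rule contraction_closure_bound [of joint_alg, OF joint_alg_norm_le that])
  have R_add: "(a + a', b + b') \<in> ?R" if "(a, b) \<in> ?R" "(a', b') \<in> ?R" for a b a' b'
    by (rule closure_pair_binop [of joint_alg "(+)" "(+)", OF joint_alg_add tendsto_add tendsto_add that])
  have R_compose: "(a o\<^sub>L a', b o\<^sub>L b') \<in> ?R" if "(a, b) \<in> ?R" "(a', b') \<in> ?R" for a b a' b'
    by (rule closure_pair_binop [of joint_alg "(o\<^sub>L)" "(o\<^sub>L)" a b a' b'])
      (rule that | erule (1) joint_alg_compose
        | erule (1) bounded_bilinear.tendsto [OF bounded_bilinear_blinfun_compose])+
  have R_scale: "(scaleC_op c a, scaleC_op c b) \<in> ?R" if "(a, b) \<in> ?R" for a b c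
    by (rule closure_pair_binop [of joint_alg "\<lambda>x y. scaleC_op c x" "\<lambda>x y. scaleC_op c x" a b a b])
      (rule that | erule joint_alg_scale | erule bounded_linear.tendsto [OF bounded_linear_scaleC_op])+
  have R_adjoint: "(hilbert_adjoint a, hilbert_adjoint b) \<in> ?R" if ab: "(a, b) \<in> ?R" for a b
  proof -
    obtain X where X: "\<forall>n. X n \<in> joint_alg" "X \<longlonglongrightarrow> (a, b)"
      using ab unfolding closure_sequential by (elim exE conjE)
    have Xn: "(fst (X n), snd (X n)) \<in> joint_alg" for n using X(1) by simp
    have "(\<lambda>n. hilbert_adjoint (fst (X n))) \<longlonglongrightarrow> hilbert_adjoint a"
      using tendsto_fst [OF X(2)] joint_alg_ops [OF Xn] by (intro tendsto_adjoint) simp_all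
    moreover have "(\<lambda>n. hilbert_adjoint (snd (X n))) \<longlonglongrightarrow> hilbert_adjoint b"
      using tendsto_snd [OF X(2)] joint_alg_ops [OF Xn] by (intro tendsto_adjoint) simp_all
    ultimately show ?thesis
      unfolding closure_sequential
      by (intro exI [of _ "\<lambda>n. (hilbert_adjoint (fst (X n)), hilbert_adjoint (snd (X n)))"] conjI allI
          tendsto_Pair joint_alg_adjoint Xn)
  qed
  \<comment> \<open>the closure of the joint algebra is the graph of \<open>\<tau>\<close>, whose domain \<open>D\<close> is a C*-algebra containing the generators\<close>
  define D where "D = {a. \<exists>b. (a, b) \<in> ?R}"
  have DI: "a \<in> D" if "(a, b) \<in> ?R" for a b using that unfolding D_def by (intro CollectI exI)
  have D_closure: "D = closure (fst ` joint_alg)"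
  proof (intro subset_antisym subsetI)
    fix a assume "a \<in> D"
    then obtain b where ab: "(a, b) \<in> ?R" unfolding D_def by (elim CollectE exE)
    have "fst ` ?R \<subseteq> closure (fst ` joint_alg)"
      by (rule image_closure_subset) (auto intro: continuous_intros closure_subset [THEN subsetD])
    then show "a \<in> closure (fst ` joint_alg)" using imageI [OF ab, of fst] by (simp add: subset_iff)
  next
    fix a assume total: "a \<in> closure (fst ` joint_alg)"
    show "a \<in> D"
      by (rule contraction_closure_total [of joint_alg a, OF joint_alg_norm_le joint_alg_diff total]) (assumption | erule DI)+
  qed
  define \<tau> where "\<tau> a = (SOME b. (a, b) \<in> ?R)" for a
  have \<tau>R: "(a, \<tau> a) \<in> ?R" if "a \<in> D" for a
    using that unfolding D_def \<tau>_def by (intro someI_ex [of "\<lambda>b. (a, b) \<in> ?R"]) simp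
  have \<tau>_eqI: "\<tau> a = b" if "(a, b) \<in> ?R" for a b
    using \<tau>R [OF DI [OF that]] that by (rule R_unique)
  have D: "cstar_subalgebra D"
    unfolding cstar_subalgebra_def closed_subalgebra_def
  proof (intro conjI ballI allI)
    show "D \<subseteq> bounded_ops" using R_ops(1) [OF \<tau>R] by (rule subsetI)
    show "0 \<in> D" by (rule DI [OF subsetD [OF R_sub joint_alg_zero]])
    show "closed D" by (simp add: D_closure)
    show "S + T \<in> D" "S o\<^sub>L T \<in> D" if "S \<in> D" "T \<in> D" for S T
      by (rule DI [OF R_add [OF \<tau>R [OF that(1)] \<tau>R [OF that(2)]]], rule DI [OF R_compose [OF \<tau>R [OF that(1)] \<tau>R [OF that(2)]]])
    show "scaleC_op c T \<in> D" "hilbert_adjoint T \<in> D" if "T \<in> D" for c T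
      by (rule DI [OF R_scale [OF \<tau>R [OF that]]], rule DI [OF R_adjoint [OF \<tau>R [OF that]]])
  qed
  have \<tau>_hom: "star_hom D bounded_ops \<tau>"
    unfolding star_hom_def
    by (intro conjI ballI allI funcsetI R_ops(2) [OF \<tau>R] \<tau>_eqI R_add R_scale R_compose R_adjoint \<tau>R)
  have L_D: "L e \<in> D" "\<tau> (L e) = S' e" if "e \<in> arcs G" for e
    using DI \<tau>_eqI subsetD [OF R_sub joint_alg_S [OF that]] by metis+
  have Q_D: "Q x \<in> D" "\<tau> (Q x) = P' x" if "x \<in> verts G" for x
    using DI \<tau>_eqI subsetD [OF R_sub joint_alg_P [OF that]] by metis+

  let ?A = "cstar_generated (quiver_algebra G \<xi>)" and ?B = "cstar_generated (S' ` arcs G)"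
  have gen: "?A \<subseteq> C" if C: "cstar_subalgebra C" "L ` arcs G \<subseteq> C" "Q ` verts G \<subseteq> C" for C
  proof (rule hull_minimal [where S = cstar_subalgebra, OF _ C(1)])
    show "quiver_algebra G \<xi> \<subseteq> C"
      unfolding quiver_algebra_def using C by (intro hull_minimal) (auto simp: cstar_subalgebra_def)
  qed
  have qa: "L ` arcs G \<union> Q ` verts G \<subseteq> ?A"
    unfolding quiver_algebra_def using hull_subset [of "L ` arcs G \<union> Q ` verts G" closed_subalgebra] hull_subset
    by (rule order_trans)
  have "quiver_algebra G \<xi> \<subseteq> bounded_ops"
    unfolding quiver_algebra_def using cstar_subalgebra_bounded_ops
    by (intro hull_minimal) (auto simp: cstar_subalgebra_def L_ops Q_ops)
  then have A: "cstar_subalgebra ?A" by (rule cstar_subalgebra_generated)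
  have B: "cstar_subalgebra ?B" by (rule cstar_subalgebra_generated) (auto simp: B.S_ops)
  have AD: "?A \<subseteq> D" by (rule gen [OF D]) (auto simp: L_D Q_D)
  have \<tau>A: "star_hom ?A bounded_ops \<tau>"
    using \<tau>_hom AD unfolding star_hom_def by (simp add: Pi_iff subset_iff)
  have contr: "norm (\<tau> a) \<le> norm a" if "a \<in> ?A" for a
    by (rule R_norm [OF \<tau>R [OF subsetD [OF AD that]]])
  have S'B: "S' e \<in> ?B" if "e \<in> arcs G" for e
    using that by (intro hull_inc imageI)
  \<comment> \<open>absence of sinks: every vertex projection is the initial projection of an edge\<close>
  have P'B: "P' x \<in> ?B" if x: "x \<in> verts G" for x
  proof -
    obtain e where e: "e \<in> arcs G" "tail G e = x" using assms(5) x by (auto simp: no_sinks_def)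
    then have "P' x = hilbert_adjoint (S' e) o\<^sub>L S' e" using B.adj_S_S [OF e(1) e(1)] by simp
    then show ?thesis using cstar_subalgebraD(5,7) [OF B] S'B [OF e(1)] by simp
  qed
  have "?A \<subseteq> {a \<in> ?A. \<tau> a \<in> ?B}"
    by (rule gen [OF cstar_subalgebra_preimage [OF A B \<tau>A contr]]) (use qa in \<open>auto simp: L_D Q_D S'B P'B\<close>)
  then have \<tau>B: "\<tau> a \<in> ?B" if "a \<in> ?A" for a using that by auto
  have "?B \<subseteq> \<tau> ` ?A"
  proof (rule hull_minimal [where S = cstar_subalgebra, OF _ cstar_subalgebra_image [OF A \<tau>A contr]])
    show "S' ` arcs G \<subseteq> \<tau> ` ?A"
    proof (rule image_subsetI)
      fix e assume e: "e \<in> arcs G"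
      then have "L e \<in> ?A" using qa by auto
      then have "\<tau> (L e) \<in> \<tau> ` ?A" by (rule imageI)
      then show "S' e \<in> \<tau> ` ?A" by (simp add: L_D(2) [OF e])
    qed
  qed
  with \<tau>B have image: "\<tau> ` ?A = ?B" by (intro subset_antisym image_subsetI)
  have "star_hom ?A ?B \<tau>"
    using \<tau>A \<tau>B unfolding star_hom_def by (simp add: Pi_iff)
  with image L_D(2) show ?thesis
    unfolding star_epi_def by (intro exI [of _ \<tau>] conjI ballI)
qed

end
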